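(* The map $\mathsf{forget}\colon\overline{\mathfrak{M}_1}\to\mathfrak{T}$ is a bijection, where $\overline{\mathfrak{M}_1}$ is the set of meanders with shallow top (of all orders $n\ge1$), $\mathfrak{T}$ is the set of finite black-rooted fat-trees with one special edge marked at every black vertex, and $\mathsf{forget}$ is the map that sends the meander given by $(\pi,\rho)$ to the tree $\Gamma(\pi,\rho)$, rooted at the black vertex containing $1$, with the smallest-labeled edge at every black vertex marked as special, and with edge labels erased.
   Context: For a positive integer $n$, a partition $\pi$ of $\{1,\ldots,n\}$ is non-crossing if there are no two distinct blocks $V,W$ and numbers $a<b<c<d$ with $a,c\in V$, $b,d\in W$. $\mathrm{NC}(n)$ is the set of non-crossing partitions of $\{1,\ldots,n\}$, ordered by $\pi\le\rho$ iff every block of $\pi$ is contained in a block of $\rho$; $d_H$ is the graph distance in the Hasse diagram of $(\mathrm{NC}(n),\le)$ (undirected graph on $\mathrm{NC}(n)$, with edges given by the covering relation). $\mathrm{Int}(n)\subseteq\mathrm{NC}(n)$ is the set of interval partitions: every block is of the form $\{p,p+1,\ldots,q\}$. Meanders with shallow top: $\overline{\mathfrak{M}_1}(n)=\{(\pi,\rho)\in\mathrm{Int}(n)\times\mathrm{NC}(n)\mid d_H(\pi,\rho)=n-1\}$ (the pair $(\pi,\rho)$ encodes the meander $M(\pi,\rho)$), and $\overline{\mathfrak{M}_1}=\bigcup_{n\ge1}\overline{\mathfrak{M}_1}(n)$. The graph $\Gamma(\pi,\rho)$: for $\pi,\rho\in\mathrm{NC}(n)$ it is the planar bipartite graph with one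 black vertex for each block of $\pi$, one white vertex for each block of $\rho$, and $n$ edges labeled $1,\ldots,n$, the edge labeled $i$ joining the block of $\pi$ containing $i$ to the block of $\rho$ containing $i$. It is drawn in the plane with the black vertices in the upper half-plane and white vertices in the lower half-plane, the edges $1,\ldots,n$ crossing the horizontal line in this order from left to right. Thus if the edges at a black vertex have labels $i_1<i_2<\cdots<i_k$, their counterclockwise cyclic order is $(i_1,i_2,\ldots,i_k)$, while at a white vertex this is their clockwise cyclic order. It is known that $\Gamma(\pi,\rho)$ is a tree if and only if $d_H(\pi,\rho)=n-1$. A fat-tree is a tree together with an embedding in the plane, i.e. with a (counterclockwise) cyclic order on the edges emanating from each vertex. $\mathfrak{T}$ is the set of (isomorphism classes of) finite rooted fat-trees with the following additional data: the vertices are properly colored black and white (every edge has one black and one white endpoint), with the root colored black; and for every black vertex, one of the edges emanating from it is marked as special (so every black vertex has at least one edge). Isomorphisms preserve root, colors, cyclic orders and special edges. The map $\mathsf{forget}$: given $(\pi,\rho)\in\overline{\mathfrak{M}_1}$, take the tree $\Gamma(\pi,\rho)$ with its cyclic orders coming from the planar embedding of $\Gamma(\pi,\rho)$ in which the black vertices lie in the upper half-plane, the white vertices lie in the lower half-plane, and the edges labeled $1,\ldots,n$ cross the horizontal line in this order from left to right, mark as the root the black vertex corresponding to the block of $\pi$ containing $1$, mark as special at every black vertex the edge with the smallest label, and forget the labels of the edges. *)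

theory Defs
  imports Main "HOL-Library.Disjoint_Sets" "HOL-Combinatorics.Orbits"
begin

section \<open>Non-crossing partitions and meanders with shallow top\<close>

definition noncrossing :: "nat set set \<Rightarrow> bool" where
  "noncrossing P \<longleftrightarrow>
     \<not> (\<exists>V\<in>P. \<exists>W\<in>P. V \<noteq> W \<and>
          (\<exists>a b c d. a < b \<and> b < c \<and> c < d \<and> a \<in> V \<and> c \<in> V \<and> b \<in> W \<and> d \<in> W))"

definition NC :: "nat \<Rightarrow> nat set set set" where
  "NC n = {P. partition_on {1..n} P \<and> noncrossing P}"

definition Interval_partitions :: "nat \<Rightarrow> nat set set set" where
  "Interval_partitions n = {P \<in> NC n. \<forall>V\<in>P. \<exists>p q. V = {p..q}}"

definition NC_less :: "nat \<Rightarrow> nat set set \<Rightarrow> nat set set \<Rightarrow> bool" where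
  "NC_less n P R \<longleftrightarrow> P \<in> NC n \<and> R \<in> NC n \<and> refines {1..n} P R \<and> P \<noteq> R"

definition NC_covers :: "nat \<Rightarrow> nat set set \<Rightarrow> nat set set \<Rightarrow> bool" where
  "NC_covers n P R \<longleftrightarrow> NC_less n P R \<and> \<not> (\<exists>Q. NC_less n P Q \<and> NC_less n Q R)"

definition Hasse :: "nat \<Rightarrow> (nat set set \<times> nat set set) set" where
  "Hasse n = {(P, R). NC_covers n P R \<or> NC_covers n R P}"

text \<open>Any two elements of \<open>NC n\<close> are joined by a path in the Hasse diagram (through the
  partition into singletons), so the minimum below is over a nonempty set.\<close>

definition dH :: "nat \<Rightarrow> nat set set \<Rightarrow> nat set set \<Rightarrow> nat" where
  "dH n P R = (LEAST k. (P, R) \<in> Hasse n ^^ k)"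

definition shallow_meanders_of_order :: "nat \<Rightarrow> (nat set set \<times> nat set set) set" where
  "shallow_meanders_of_order n =
     {(P, R). P \<in> Interval_partitions n \<and> R \<in> NC n \<and> dH n P R = n - 1}"

definition shallow_meanders :: "(nat set set \<times> nat set set) set" where
  "shallow_meanders = (\<Union>n\<in>{1..}. shallow_meanders_of_order n)"


section \<open>Fat-trees\<close>

text \<open>
  Undirected multigraphs with a rotation at every vertex: \<open>ends e\<close> is the set of
  endpoints of \<open>e\<close> (a singleton for a loop), and \<open>ccw v\<close> sends an edge at \<open>v\<close> to the next
  edge at \<open>v\<close> in counterclockwise order.  Only the values of \<open>ends\<close> on edges, and of \<open>ccw v\<close>
  on edges at \<open>v\<close>, are meaningful.
\<close>

record ('v, 'e) fat_graph =
  verts :: "'v set"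
  edges :: "'e set"
  ends :: "'e \<Rightarrow> 'v set"
  ccw :: "'v \<Rightarrow> 'e \<Rightarrow> 'e"

definition edges_at :: "('v, 'e, 'm) fat_graph_scheme \<Rightarrow> 'v \<Rightarrow> 'e set" where
  "edges_at G v = {e \<in> edges G. v \<in> ends G e}"

definition finite_graph :: "('v, 'e, 'm) fat_graph_scheme \<Rightarrow> bool" where
  "finite_graph G \<longleftrightarrow> finite (verts G) \<and> finite (edges G) \<and>
     (\<forall>e\<in>edges G. ends G e \<subseteq> verts G \<and> card (ends G e) \<in> {1, 2})"

definition connected_graph :: "('v, 'e, 'm) fat_graph_scheme \<Rightarrow> bool" where
  "connected_graph G \<longleftrightarrow> verts G \<noteq> {} \<and>
     (\<forall>u\<in>verts G. \<forall>v\<in>verts G. (u, v) \<in> {(x, y). \<exists>e\<in>edges G. ends G e = {x, y}}\<^sup>*)"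

text \<open>Cycles of length 1 are loops, cycles of length 2 are pairs of parallel edges.\<close>

definition is_cycle :: "('v, 'e, 'm) fat_graph_scheme \<Rightarrow> 'v list \<Rightarrow> 'e list \<Rightarrow> bool" where
  "is_cycle G vs es \<longleftrightarrow>
     es \<noteq> [] \<and> length vs = length es \<and> distinct vs \<and> distinct es \<and>
     set vs \<subseteq> verts G \<and> set es \<subseteq> edges G \<and>
     (\<forall>i<length es. ends G (es ! i) = {vs ! i, vs ! (Suc i mod length vs)})"

definition finite_tree :: "('v, 'e, 'm) fat_graph_scheme \<Rightarrow> bool" where
  "finite_tree G \<longleftrightarrow> finite_graph G \<and> connected_graph G \<and> \<not> (\<exists>vs es. is_cycle G vs es)"

definition fat_tree :: "('v, 'e, 'm) fat_graph_scheme \<Rightarrow> bool" where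
  "fat_tree G \<longleftrightarrow> finite_tree G \<and>
     (\<forall>v\<in>verts G. edges_at G v \<noteq> {} \<longrightarrow> cyclic_on (ccw G v) (edges_at G v))"

text \<open>The vertices outside \<open>black\<close> are the white ones; \<open>special\<close> is meaningful on black vertices
  only.\<close>

record ('v, 'e) marked_fat_graph = "('v, 'e) fat_graph" +
  root_vertex :: 'v
  black :: "'v set"
  special :: "'v \<Rightarrow> 'e"

definition marked_fat_tree :: "('v, 'e) marked_fat_graph \<Rightarrow> bool" where
  "marked_fat_tree G \<longleftrightarrow> fat_tree G \<and>
     black G \<subseteq> verts G \<and> root_vertex G \<in> black G \<and>
     (\<forall>e\<in>edges G. \<exists>b\<in>black G. \<exists>w\<in>verts G - black G. ends G e = {b, w}) \<and>
     (\<forall>v\<in>black G. special G v \<in> edges_at G v)"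

definition isomorphic ::
  "('v, 'e) marked_fat_graph \<Rightarrow> ('w, 'f) marked_fat_graph \<Rightarrow> bool" where
  "isomorphic G H \<longleftrightarrow> (\<exists>f g.
     bij_betw f (verts G) (verts H) \<and> bij_betw g (edges G) (edges H) \<and>
     (\<forall>e\<in>edges G. ends H (g e) = f ` ends G e) \<and>
     (\<forall>v\<in>verts G. \<forall>e\<in>edges_at G v. ccw H (f v) (g e) = g (ccw G v e)) \<and>
     f (root_vertex G) = root_vertex H \<and>
     (\<forall>v\<in>verts G. v \<in> black G \<longleftrightarrow> f v \<in> black H) \<and>
     (\<forall>v\<in>black G. special H (f v) = g (special G v)))"

text \<open>Every finite marked fat-tree has an isomorphic copy whose vertices and edges are natural
  numbers, so the isomorphism classes are taken among these.\<close>

definition nat_trees :: "(nat, nat) marked_fat_graph set" where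
  "nat_trees = {G. marked_fat_tree G}"

definition marked_fat_tree_classes :: "(nat, nat) marked_fat_graph set set" where
  "marked_fat_tree_classes =
     nat_trees // {(G, H). G \<in> nat_trees \<and> H \<in> nat_trees \<and> isomorphic G H}"


section \<open>The graph of a pair of partitions and the map \<open>forget\<close>\<close>

definition block_of :: "nat set set \<Rightarrow> nat \<Rightarrow> nat set" where
  "block_of P i = (THE V. V \<in> P \<and> i \<in> V)"

definition next_in :: "nat set \<Rightarrow> nat \<Rightarrow> nat" where
  "next_in S i = (if \<exists>j\<in>S. i < j then Min {j \<in> S. i < j} else Min S)"

definition prev_in :: "nat set \<Rightarrow> nat \<Rightarrow> nat" where
  "prev_in S i = (if \<exists>j\<in>S. j < i then Max {j \<in> S. j < i} else Max S)"

text \<open>\<open>Inl V\<close> is the black vertex of the block \<open>V\<close> of the first partition, \<open>Inr W\<close> the white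
  vertex of the block \<open>W\<close> of the second one.  Edges are the labels \<open>\<Union>P = {1..n}\<close>.  The labels at
  a vertex are the elements of its block; increasing labels run counterclockwise around black
  vertices (upper half-plane) and clockwise around white ones (lower half-plane).\<close>

definition Gamma ::
  "nat set set \<Rightarrow> nat set set \<Rightarrow> (nat set + nat set, nat) fat_graph" where
  "Gamma P R = \<lparr>
     verts = Inl ` P \<union> Inr ` R,
     edges = \<Union>P,
     ends = (\<lambda>i. {Inl (block_of P i), Inr (block_of R i)}),
     ccw = case_sum next_in prev_in \<rparr>"

text \<open>\<open>Gamma\<close> with its marking: the root is the black vertex containing the label 1, and the special
  edge at a black vertex is the one with the smallest label.\<close>

definition marked_Gamma ::
  "nat set set \<Rightarrow> nat set set \<Rightarrow> (nat set + nat set, nat) marked_fat_graph" where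
  "marked_Gamma P R = fat_graph.extend (Gamma P R)
     (marked_fat_graph.fields (Inl (block_of P 1)) (Inl ` P)
        (\<lambda>v. Min (edges_at (Gamma P R) v)))"

definition forget ::
  "nat set set \<times> nat set set \<Rightarrow> (nat, nat) marked_fat_graph set" where
  "forget = (\<lambda>(P, R). {T \<in> nat_trees. isomorphic (marked_Gamma P R) T})"

end

theory Submission
  imports Defs
begin

text \<open>
  Write \<open>\<sigma>\<close> for the next edge at the black end and \<open>\<alpha>\<close> for the next edge at the white end of an edge,
  both counterclockwise; \<open>\<sigma> \<circ> \<alpha>\<close> walks along the contour of the tree.  Draw an upward ray from each
  black vertex through the corner before its special edge.  The rays meet infinity in the order of
  the contour walk, and this is the order of the blocks of an interval partition; inside a block the
  labels follow \<open>\<sigma>\<close>.  So the labels are read off from the tree, and conversely this rule labels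
  every tree.

  For an interval partition \<open>P\<close> the join of \<open>P\<close> with a non-crossing \<open>R\<close> is non-crossing, whence
  the distance of \<open>P\<close> and \<open>R\<close> is \<open>|P| + |R| - 2 |P \<or> R|\<close>.  It equals \<open>n - 1\<close> iff
  \<open>|P \<or> R| = 1\<close> and \<open>|P| + |R| = n + 1\<close>, that is, iff the graph is a tree.
\<close>

subsection \<open>Classes of a relation and the Hasse diagram of non-crossing partitions\<close>

text \<open>The shallow top matters for the distance because in general the join of two non-crossing
  partitions may cross, and then no path can go through it. A block of consecutive labels, however,
  can be absorbed into \<open>R\<close> one pair of neighbours at a time, and neighbours leave no
  room for a crossing. The obstacle for surjectivity is that a fat-tree carries only rotations, no
  picture, so that planarity has to be extracted from them. The substitute is that the contour of a
  tree is a single cycle, and that a suitable union of branches is entered and left exactly once on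
  it; counting these two events yields that white blocks do not cross. For injectivity the labels
  are recovered downwards. If \<open>i\<close> is not special, label \<open>i - 1\<close> is the
  edge before \<open>i\<close> at the same black vertex. If \<open>i\<close> is special, the next
  special edge on the contour is the smallest label of the cyclically preceding block, and the last
  edge of that block is the one sought. Hence an isomorphism that fixes label 1 fixes all
  labels.\<close>

definition equiv_cl :: "('a \<times> 'a) set \<Rightarrow> ('a \<times> 'a) set" where
  "equiv_cl r = (r \<union> r\<inverse>)\<^sup>*"

lemma equiv_cl_refl [simp]: "(x, x) \<in> equiv_cl r"
  by (simp add: equiv_cl_def)

lemma equiv_cl_base: "(x, y) \<in> r \<Longrightarrow> (x, y) \<in> equiv_cl r"
  by (auto simp: equiv_cl_def)

lemma equiv_cl_sym: "(x, y) \<in> equiv_cl r \<Longrightarrow> (y, x) \<in> equiv_cl r"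
  unfolding equiv_cl_def by (meson symD sym_Un_converse sym_rtrancl)

lemma equiv_cl_commute: "(x, y) \<in> equiv_cl r \<longleftrightarrow> (y, x) \<in> equiv_cl r"
  using equiv_cl_sym[of x y r] equiv_cl_sym[of y x r] by blast

lemma equiv_cl_trans: "(x, y) \<in> equiv_cl r \<Longrightarrow> (y, z) \<in> equiv_cl r \<Longrightarrow> (x, z) \<in> equiv_cl r"
  unfolding equiv_cl_def by (rule rtrancl_trans)

lemma equiv_cl_least:
  assumes "(x, y) \<in> equiv_cl r" and "\<And>u v. (u, v) \<in> r \<Longrightarrow> (u, v) \<in> equiv_cl s"
  shows "(x, y) \<in> equiv_cl s"
  using assms(1) unfolding equiv_cl_def[of r]
proof (induction rule: rtrancl_induct)
  case (step u v)
  then have "(u, v) \<in> equiv_cl s" using assms(2)[of u v] assms(2)[of v u] equiv_cl_commute[of u v s] by blast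
  with step.IH show ?case by (rule equiv_cl_trans)
qed simp

lemma equiv_cl_eqI:
  assumes "\<And>u v. (u, v) \<in> r \<Longrightarrow> (u, v) \<in> equiv_cl s" and "\<And>u v. (u, v) \<in> s \<Longrightarrow> (u, v) \<in> equiv_cl r"
  shows "equiv_cl r = equiv_cl s"
proof (intro set_eqI iffI; clarify)
  fix x y
  show "(x, y) \<in> equiv_cl s" if "(x, y) \<in> equiv_cl r" using equiv_cl_least[OF that assms(1)] .
  show "(x, y) \<in> equiv_cl r" if "(x, y) \<in> equiv_cl s" using equiv_cl_least[OF that assms(2)] .
qed

lemma equiv_cl_closed:
  assumes "(x, y) \<in> equiv_cl r" and "\<And>u v. (u, v) \<in> r \<Longrightarrow> u \<in> A \<longleftrightarrow> v \<in> A"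
  shows "x \<in> A \<longleftrightarrow> y \<in> A"
  using assms(1) unfolding equiv_cl_def
  by (induction rule: rtrancl_induct) (use assms(2) in auto)

text \<open>A chain that uses the new pair several times can be shortened to one that uses it at
  most once, in one of the two directions.\<close>

lemma equiv_cl_insert:
  "(x, y) \<in> equiv_cl (insert (a, b) r) \<longleftrightarrow>
     (x, y) \<in> equiv_cl r \<or> (x, a) \<in> equiv_cl r \<and> (b, y) \<in> equiv_cl r \<or> (x, b) \<in> equiv_cl r \<and> (a, y) \<in> equiv_cl r"
  (is "?L \<longleftrightarrow> ?R")
proof
  assume ?L
  then show ?R unfolding equiv_cl_def[of "insert (a, b) r"]
  proof (induction rule: rtrancl_induct)
    case (step u v)
    then have "(u, v) \<in> equiv_cl r \<or> (u, v) = (a, b) \<or> (u, v) = (b, a)"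
      using equiv_cl_base[of u v r] equiv_cl_base[of v u r] equiv_cl_commute[of u v r] by auto
    with step.IH show ?case
      by (elim disjE conjE; simp; blast intro: equiv_cl_trans)
  qed simp
next
  have m: "(u, v) \<in> equiv_cl r \<Longrightarrow> (u, v) \<in> equiv_cl (insert (a, b) r)" for u v
    by (rule equiv_cl_least[of _ _ r]) (auto intro: equiv_cl_base)
  have ab: "(a, b) \<in> equiv_cl (insert (a, b) r)" by (rule equiv_cl_base) simp
  assume ?R
  then show ?L
    using m equiv_cl_trans[OF equiv_cl_trans[OF m ab] m] equiv_cl_trans[OF equiv_cl_trans[OF m equiv_cl_sym[OF ab]] m]
    by blast
qed

text \<open>When \<open>r\<close> relates only points of \<open>X\<close>, this is the number of
  connected components of a graph on \<open>X\<close>. It serves twice: for joins of partitions,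
  with labels as points, and for fat graphs, with vertices as points.\<close>

definition ncomp :: "'a set \<Rightarrow> ('a \<times> 'a) set \<Rightarrow> nat" where
  "ncomp X r = card ((\<lambda>x. equiv_cl r `` {x}) ` X)"

lemma equiv_cl_class_eq: "equiv_cl r `` {x} = equiv_cl r `` {y} \<longleftrightarrow> (x, y) \<in> equiv_cl r"
proof
  assume "equiv_cl r `` {x} = equiv_cl r `` {y}"
  moreover have "y \<in> equiv_cl r `` {y}" by simp
  ultimately show "(x, y) \<in> equiv_cl r" by blast
next
  assume "(x, y) \<in> equiv_cl r"
  then show "equiv_cl r `` {x} = equiv_cl r `` {y}"
    using equiv_cl_trans[of x y r] equiv_cl_trans[of y x r] equiv_cl_sym[of x y r] by blast
qed

lemma ncomp_insert_connected:
  assumes "(a, b) \<in> equiv_cl r"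
  shows "ncomp X (insert (a, b) r) = ncomp X r"
proof -
  have "equiv_cl (insert (a, b) r) = equiv_cl r"
    by (rule equiv_cl_eqI) (use assms in \<open>auto intro: equiv_cl_base\<close>)
  then show ?thesis by (simp add: ncomp_def)
qed

text \<open>The classes of \<open>a\<close> and \<open>b\<close> are replaced by their union
  \<open>?AB\<close>, and every other class stays as it is.\<close>

lemma ncomp_insert_disconnected:
  assumes "finite X" "a \<in> X" "b \<in> X" "(a, b) \<notin> equiv_cl r"
  shows "ncomp X r = Suc (ncomp X (insert (a, b) r))"
proof -
  let ?c = "\<lambda>x. equiv_cl r `` {x}" and ?d = "\<lambda>x. equiv_cl (insert (a, b) r) `` {x}"
  let ?AB = "?c a \<union> ?c b"
  have d: "?d x = (if (a, x) \<in> equiv_cl r \<or> (b, x) \<in> equiv_cl r then ?AB else ?c x)" for x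
  proof -
    have a: "(x, a) \<in> equiv_cl r \<longleftrightarrow> (a, x) \<in> equiv_cl r" and b: "(x, b) \<in> equiv_cl r \<longleftrightarrow> (b, x) \<in> equiv_cl r"
      by (rule equiv_cl_commute)+
    have "(x, y) \<in> equiv_cl r \<longleftrightarrow> (z, y) \<in> equiv_cl r" if "(z, x) \<in> equiv_cl r" for y z
      using equiv_cl_trans[of z x r y] equiv_cl_trans[of x z r y] that equiv_cl_sym[of z x r] by blast
    then show ?thesis unfolding set_eq_iff Image_singleton_iff equiv_cl_insert a b if_split_mem2
      by (metis Image_singleton_iff Un_iff)
  qed
  have ne: "?c a \<noteq> ?c b" using assms(4) by (simp add: equiv_cl_class_eq)
  have img: "?d ` X = insert ?AB (?c ` X - {?c a, ?c b})" (is "?l = ?r")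
  proof
    show "?l \<subseteq> ?r"
    proof
      fix z assume "z \<in> ?l"
      then obtain x where x: "x \<in> X" "z = ?d x" by blast
      show "z \<in> ?r"
      proof (cases "(a, x) \<in> equiv_cl r \<or> (b, x) \<in> equiv_cl r")
        case False
        then have "?c a \<noteq> ?c x" "?c b \<noteq> ?c x" by (simp_all add: equiv_cl_class_eq)
        moreover have "?d x = ?c x" using False d[of x] by simp
        ultimately show ?thesis using x by (metis Diff_iff empty_iff image_eqI insert_iff)
      next
        case True
        then show ?thesis using x(2) d[of x] by simp
      qed
    qed
    show "?r \<subseteq> ?l"
    proof
      fix z assume "z \<in> ?r"
      then consider "z = ?AB" | x where "x \<in> X" "z = ?c x" "z \<noteq> ?c a" "z \<noteq> ?c b" by auto
      then show "z \<in> ?l"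
      proof cases
        case 1
        then have "z = ?d a" by (simp add: d)
        with assms(2) show ?thesis by blast
      next
        case (2 x)
        then have "(a, x) \<notin> equiv_cl r" "(b, x) \<notin> equiv_cl r" by (auto simp flip: equiv_cl_class_eq)
        with 2(2) have "z = ?d x" by (simp add: d)
        with 2(1) show ?thesis by blast
      qed
    qed
  qed
  have "?AB \<notin> ?c ` X - {?c a, ?c b}"
  proof
    assume "?AB \<in> ?c ` X - {?c a, ?c b}"
    then obtain x where "?AB = ?c x" "?c x \<noteq> ?c a" by auto
    moreover have "a \<in> ?AB" by simp
    ultimately have "(x, a) \<in> equiv_cl r" by blast
    with \<open>?c x \<noteq> ?c a\<close> show False by (simp add: equiv_cl_class_eq)
  qed
  then have "card (?d ` X) = Suc (card (?c ` X - {?c a, ?c b}))"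
    unfolding img using assms(1) by simp
  moreover have "card (?c ` X - {?c a, ?c b}) = card (?c ` X) - 2"
    using ne assms by (subst card_Diff_subset) auto
  moreover have "card (?c ` X) \<ge> card {?c a, ?c b}"
    by (rule card_mono) (use assms in auto)
  ultimately show ?thesis using ne by (simp add: ncomp_def)
qed

lemma ncomp_insert:
  assumes "finite X" "a \<in> X" "b \<in> X"
  shows "ncomp X (insert (a, b) r) \<le> ncomp X r" "ncomp X r \<le> Suc (ncomp X (insert (a, b) r))"
  using ncomp_insert_connected[of a b r X] ncomp_insert_disconnected[OF assms, of r]
  by (cases "(a, b) \<in> equiv_cl r"; linarith)+

lemma ncomp_eq_1D:
  assumes "ncomp X r = 1" "x \<in> X" "y \<in> X"
  shows "(x, y) \<in> equiv_cl r"
proof -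
  obtain c where c: "(\<lambda>x. equiv_cl r `` {x}) ` X = {c}"
    using assms(1) by (auto simp: ncomp_def card_1_singleton_iff)
  have "equiv_cl r `` {z} = c" if "z \<in> X" for z
    using imageI[OF that, of "\<lambda>x. equiv_cl r `` {x}"] unfolding c by simp
  then have "equiv_cl r `` {x} = equiv_cl r `` {y}" using assms(2,3) by simp
  then show ?thesis by (simp add: equiv_cl_class_eq)
qed

lemma ncomp_eq_1I:
  assumes "X \<noteq> {}" "\<And>x y. x \<in> X \<Longrightarrow> y \<in> X \<Longrightarrow> (x, y) \<in> equiv_cl r"
  shows "ncomp X r = 1"
proof -
  obtain a where "a \<in> X" using assms(1) by auto
  have "equiv_cl r `` {x} = equiv_cl r `` {a}" if "x \<in> X" for x
    unfolding equiv_cl_class_eq using assms(2) that \<open>a \<in> X\<close> .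
  then have "(\<lambda>x. equiv_cl r `` {x}) ` X = (\<lambda>x. equiv_cl r `` {a}) ` X" by (rule image_cong[OF refl])
  also have "\<dots> = {equiv_cl r `` {a}}" using \<open>a \<in> X\<close> by (rule image_constant)
  finally have "(\<lambda>x. equiv_cl r `` {x}) ` X = {equiv_cl r `` {a}}" .
  then show ?thesis by (simp add: ncomp_def)
qed

lemma ncomp_pos: "finite X \<Longrightarrow> X \<noteq> {} \<Longrightarrow> ncomp X r \<ge> 1"
  by (simp add: ncomp_def Suc_le_eq card_gt_0_iff)

section \<open>Partitions as relations, and merging two blocks\<close>

definition block_rel :: "'a set set \<Rightarrow> ('a \<times> 'a) set" where
  "block_rel P = {(x, y). \<exists>V\<in>P. x \<in> V \<and> y \<in> V}"

lemma block_relI: "V \<in> P \<Longrightarrow> x \<in> V \<Longrightarrow> y \<in> V \<Longrightarrow> (x, y) \<in> block_rel P"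
  by (auto simp: block_rel_def)

lemma partition_on_same:
  "partition_on A P \<Longrightarrow> V \<in> P \<Longrightarrow> W \<in> P \<Longrightarrow> x \<in> V \<Longrightarrow> x \<in> W \<Longrightarrow> V = W"
  by (auto simp: partition_on_def disjoint_def)

lemma equiv_cl_block_rel_class:
  assumes "partition_on A P" "V \<in> P" "x \<in> V"
  shows "equiv_cl (block_rel P) `` {x} = V"
proof -
  have "u \<in> V \<longleftrightarrow> v \<in> V" if "(u, v) \<in> block_rel P" for u v
    using that partition_on_same[OF assms(1,2)] unfolding block_rel_def by blast
  then have "y \<in> V" if "(x, y) \<in> equiv_cl (block_rel P)" for y
    using equiv_cl_closed[OF that, of V] assms(3) by blast
  moreover have "(x, y) \<in> equiv_cl (block_rel P)" if "y \<in> V" for y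
    using assms(2,3) that by (intro equiv_cl_base) (auto simp: block_rel_def)
  ultimately show ?thesis by blast
qed

lemma ncomp_block_rel:
  assumes "partition_on A P"
  shows "ncomp A (block_rel P) = card P"
proof -
  have "(\<lambda>x. equiv_cl (block_rel P) `` {x}) ` A = P"
  proof (intro set_eqI iffI)
    fix V assume "V \<in> (\<lambda>x. equiv_cl (block_rel P) `` {x}) ` A"
    then obtain x where x: "x \<in> A" "V = equiv_cl (block_rel P) `` {x}" by blast
    then obtain W where "W \<in> P" "x \<in> W" using partition_onD1[OF assms] by blast
    then show "V \<in> P" using equiv_cl_block_rel_class[OF assms] x(2) by simp
  next
    fix V assume V: "V \<in> P"
    then obtain x where x: "x \<in> V" using partition_onD3[OF assms] by (metis ex_in_conv)
    moreover have "x \<in> A" using x V partition_onD1[OF assms] by blast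
    ultimately show "V \<in> (\<lambda>x. equiv_cl (block_rel P) `` {x}) ` A"
      by (intro image_eqI[of _ _ x]) (simp_all add: equiv_cl_block_rel_class[OF assms V])
  qed
  then show ?thesis by (simp add: ncomp_def)
qed

lemma ncomp_block_rel_refines:
  assumes "refines A P J"
  shows "ncomp A (block_rel P \<union> block_rel J) = card J"
proof -
  have "block_rel P \<subseteq> block_rel J" using assms unfolding refines_def block_rel_def by blast
  then have "block_rel P \<union> block_rel J = block_rel J" by auto
  then show ?thesis using assms by (simp add: ncomp_block_rel refines_def)
qed

definition merge :: "'a set set \<Rightarrow> 'a set \<Rightarrow> 'a set \<Rightarrow> 'a set set" where
  "merge P V W = insert (V \<union> W) (P - {V, W})"

lemma merge_superset: "S \<in> P \<Longrightarrow> \<exists>T\<in>merge P V W. S \<subseteq> T"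
  unfolding merge_def by (cases "S = V \<or> S = W") auto

lemma partition_on_merge:
  assumes "partition_on A P" "V \<in> P" "W \<in> P"
  shows "partition_on A (merge P V W)"
proof (rule partition_onI)
  show "\<Union> (merge P V W) = A"
    using partition_onD1[OF assms(1)] assms(2,3) by (auto simp: merge_def)
  show "{} \<notin> merge P V W"
    using partition_onD3[OF assms(1)] assms(2,3) by (auto simp: merge_def)
  show "disjnt S T" if "S \<in> merge P V W" "T \<in> merge P V W" "S \<noteq> T" for S T
  proof -
    have "x \<notin> T" if "x \<in> S" for x
      using \<open>S \<in> _\<close> \<open>T \<in> _\<close> \<open>S \<noteq> T\<close> that assms(2,3) partition_on_same[OF assms(1), of _ _ x]
      unfolding merge_def by blast
    then show ?thesis by (auto simp: disjnt_iff)
  qed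
qed

lemma card_merge:
  assumes "finite A" "partition_on A P" "V \<in> P" "W \<in> P" "V \<noteq> W"
  shows "card P = Suc (card (merge P V W))"
proof -
  have fin: "finite P" using assms finite_elements by blast
  have "V \<union> W \<notin> P - {V, W}"
  proof
    assume *: "V \<union> W \<in> P - {V, W}"
    obtain v where "v \<in> V" using assms(3) partition_onD3[OF assms(2)] by (metis ex_in_conv)
    then show False using * partition_on_same[OF assms(2,3), of "V \<union> W" v] by blast
  qed
  then have "card (merge P V W) = Suc (card (P - {V, W}))"
    using fin by (simp add: merge_def)
  moreover have "card (P - {V, W}) = card P - 2"
    using assms fin by (subst card_Diff_subset) auto
  moreover have "card P \<ge> card {V, W}" by (rule card_mono) (use assms fin in auto)
  ultimately show ?thesis using assms(5) by simp
qed

lemma refines_merge: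
  assumes "partition_on A P" "V \<in> P" "W \<in> P"
  shows "refines A P (merge P V W)"
  unfolding refines_def using assms(1) partition_on_merge[OF assms] merge_superset by (intro conjI ballI)

text \<open>Since each block is already connected, one pair of representatives connects
  \<open>V\<close> with \<open>W\<close>. So \<open>ncomp_insert\<close> and its companions also
  control the effect of a merge.\<close>

lemma ncomp_merge:
  assumes "partition_on A P" "V \<in> P" "W \<in> P" "v \<in> V" "w \<in> W"
  shows "ncomp X (r \<union> block_rel (merge P V W)) = ncomp X (insert (v, w) (r \<union> block_rel P))"
proof -
  have "equiv_cl (r \<union> block_rel (merge P V W)) = equiv_cl (insert (v, w) (r \<union> block_rel P))" (is "_ = equiv_cl ?s")
  proof (rule equiv_cl_eqI)
    fix x y assume "(x, y) \<in> ?s"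
    then consider "(x, y) \<in> r" | "x = v" "y = w" | S where "S \<in> P" "x \<in> S" "y \<in> S"
      unfolding block_rel_def by blast
    then have "(x, y) \<in> r \<union> block_rel (merge P V W)"
    proof cases
      case 2
      then have "x \<in> V \<union> W" "y \<in> V \<union> W" using assms(4,5) by auto
      then have "(x, y) \<in> block_rel (merge P V W)" by (intro block_relI[of "V \<union> W"]) (simp_all add: merge_def)
      then show ?thesis by simp
    next
      case (3 S)
      then obtain T where "T \<in> merge P V W" "S \<subseteq> T" using merge_superset by blast
      then have "(x, y) \<in> block_rel (merge P V W)" using 3 by (intro block_relI[of T]) auto
      then show ?thesis by simp
    qed blast
    then show "(x, y) \<in> equiv_cl (r \<union> block_rel (merge P V W))" by (rule equiv_cl_base)
  next
    fix x y assume "(x, y) \<in> r \<union> block_rel (merge P V W)"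
    then consider "(x, y) \<in> r \<union> block_rel P" | "x \<in> V \<union> W" "y \<in> V \<union> W"
      by (auto simp: block_rel_def merge_def)
    then show "(x, y) \<in> equiv_cl ?s"
    proof cases
      case 1 then show ?thesis by (auto intro: equiv_cl_base)
    next
      case 2
      have vw: "(v, w) \<in> equiv_cl ?s" by (rule equiv_cl_base) simp
      have "(z, v) \<in> equiv_cl ?s" if "z \<in> V \<union> W" for z
      proof (cases "z \<in> V")
        case True
        then have "(z, v) \<in> ?s" using block_relI[OF assms(2) _ assms(4)] by simp
        then show ?thesis by (rule equiv_cl_base)
      next
        case False
        then have "(z, w) \<in> ?s" using that block_relI[OF assms(3) _ assms(5)] by simp
        then have "(z, w) \<in> equiv_cl ?s" by (rule equiv_cl_base)
        then show ?thesis using equiv_cl_trans[OF _ equiv_cl_sym[OF vw]] by blast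
      qed
      then show ?thesis using 2 equiv_cl_trans[of x v ?s y] equiv_cl_sym[of y v ?s] by blast
    qed
  qed
  then show ?thesis by (simp add: ncomp_def)
qed

section \<open>Non-crossing partitions: merges and covers\<close>

lemma NC_partition: "P \<in> NC n \<Longrightarrow> partition_on {1..n} P"
  by (simp add: NC_def)

lemma noncrossingD:
  assumes "noncrossing P" "V \<in> P" "W \<in> P" "V \<noteq> W" "a \<in> V" "b \<in> W" "c \<in> V" "d \<in> W"
    "a < b" "b < c"
  shows "\<not> c < d"
proof
  assume "c < d"
  then have "\<exists>a b c d. a < b \<and> b < c \<and> c < d \<and> a \<in> V \<and> c \<in> V \<and> b \<in> W \<and> d \<in> W"
    using assms by (intro exI[of _ a] exI[of _ b] exI[of _ c] exI[of _ d]) simp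
  then show False using assms(1-4) unfolding noncrossing_def by meson
qed

lemma noncrossing_subblocks:
  assumes "noncrossing R" "Y \<in> R" "Z \<in> R" "Y \<noteq> Z" "S \<subseteq> Y" "T \<subseteq> Z"
  shows "noncrossing {S, T}"
  unfolding noncrossing_def
proof (clarify)
  fix A B a b c d
  assume *: "A \<in> {S, T}" "B \<in> {S, T}" "A \<noteq> B" "a < b" "b < c" "c < d"
    "a \<in> A" "c \<in> A" "b \<in> B" "d \<in> B"
  then consider "A = S" "B = T" | "A = T" "B = S" by blast
  then show False
  proof cases
    case 1
    then have "a \<in> Y" "c \<in> Y" "b \<in> Z" "d \<in> Z" using * assms(5,6) by auto
    then show ?thesis using noncrossingD[OF assms(1-4), of a b c d] * by simp
  next
    case 2
    then have "a \<in> Z" "c \<in> Z" "b \<in> Y" "d \<in> Y" using * assms(5,6) by auto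
    then show ?thesis using noncrossingD[OF assms(1,3,2) assms(4)[symmetric], of a b c d] * by simp
  qed
qed

text \<open>A block \<open>U\<close> without points strictly between \<open>x\<close> and
  \<open>y\<close> does not separate \<open>x\<close> from \<open>y\<close>. A crossing of
  \<open>U\<close> with the union that uses points of both \<open>V\<close> and \<open>W\<close> can
  then be rerouted through \<open>x\<close> or \<open>y\<close> to a crossing of \<open>U\<close>
  with \<open>V\<close> or with \<open>W\<close> alone.\<close>

lemma noncrossing_merge:
  assumes "partition_on A P" "noncrossing P" "V \<in> P" "W \<in> P" "x \<in> V" "y \<in> W" "x < y"
    and U: "\<And>U. U \<in> P \<Longrightarrow> U \<noteq> V \<Longrightarrow> U \<noteq> W \<Longrightarrow>
      (\<forall>u\<in>U. \<not> (x < u \<and> u < y)) \<or> noncrossing {V \<union> W, U}"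
  shows "noncrossing (merge P V W)"
proof -
  have key: "noncrossing {V \<union> W, U}" if "U \<in> P" "U \<noteq> V" "U \<noteq> W" for U
  proof (cases "\<forall>u\<in>U. \<not> (x < u \<and> u < y)")
    case True
    have d: "u \<noteq> v" if "u \<in> U" "v \<in> V \<union> W" for u v
      using that partition_on_same[OF assms(1)] \<open>U \<in> P\<close> assms(3,4) \<open>U \<noteq> V\<close> \<open>U \<noteq> W\<close> by blast
    have sep: "\<not> (p < r \<and> r < q \<and> q < s) \<and> \<not> (r < p \<and> p < s \<and> s < q)"
      if "S \<in> {V, W}" "p \<in> S" "q \<in> S" "r \<in> U" "s \<in> U" for S p q r s
      using that noncrossingD[OF assms(2), of U S r p s q] noncrossingD[OF assms(2), of S U p r q s]
        \<open>U \<in> P\<close> \<open>U \<noteq> V\<close> \<open>U \<noteq> W\<close> assms(3,4) by blast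
    have out: "u < x \<or> y < u" if "u \<in> U" for u
      using True that d[of u x] d[of u y] assms(5,6) by (metis UnI1 UnI2 linorder_neqE_nat)
    have 1: False if "a < b" "b < c" "c < e" "a \<in> V \<union> W" "c \<in> V \<union> W" "b \<in> U" "e \<in> U" for a b c e
      using that(4,5)
    proof (elim UnE)
      assume "a \<in> V" "c \<in> W"
      then show False using that(1-3) out[OF that(6)] out[OF that(7)] assms(5-7)
          sep[of V a x b e] sep[of W y c b e] sep[of W c y b e] that(6,7) by auto
    next
      assume "a \<in> W" "c \<in> V"
      then show False using that(1-3) out[OF that(6)] out[OF that(7)] assms(5-7)
          sep[of V c x b e] sep[of V x c b e] sep[of W a y b e] that(6,7) by auto
    qed (use sep[of V a c b e] sep[of W a c b e] that in auto)
    have 2: False if "a < b" "b < c" "c < e" "a \<in> U" "c \<in> U" "b \<in> V \<union> W" "e \<in> V \<union> W" for a b c e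
      using that(6,7)
    proof (elim UnE)
      assume "b \<in> V" "e \<in> W"
      then show False using that(1-3) out[OF that(4)] out[OF that(5)] assms(5-7)
          sep[of V b x a c] sep[of V x b a c] sep[of W y e a c] sep[of W e y a c] that(4,5) by auto
    next
      assume "b \<in> W" "e \<in> V"
      then show False using that(1-3) out[OF that(4)] out[OF that(5)] assms(5-7)
          sep[of V e x a c] sep[of V x e a c] sep[of W y b a c] sep[of W b y a c] that(4,5) by auto
    qed (use sep[of V b e a c] sep[of W b e a c] that in auto)
    show ?thesis unfolding noncrossing_def using 1 2 by blast
  next
    case False
    then show ?thesis using U[OF that] by blast
  qed
  show ?thesis unfolding noncrossing_def merge_def
  proof (clarify)
    fix S T a b c d
    assume *: "S \<in> insert (V \<union> W) (P - {V, W})" "T \<in> insert (V \<union> W) (P - {V, W})" "S \<noteq> T"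
      "a < b" "b < c" "c < d" "a \<in> S" "c \<in> S" "b \<in> T" "d \<in> T"
    then consider "S \<in> P" "T \<in> P" | "S = V \<union> W" "T \<in> P" "T \<noteq> V" "T \<noteq> W"
      | "T = V \<union> W" "S \<in> P" "S \<noteq> V" "S \<noteq> W" by blast
    then show False
    proof cases
      case 1
      then show ?thesis using noncrossingD[OF assms(2), of S T a b c d] * by simp
    next
      case 2
      then show ?thesis using noncrossingD[OF key[of T], of S T a b c d] * by simp
    next
      case 3
      then show ?thesis using noncrossingD[OF key[of S], of S T a b c d] * by simp
    qed
  qed
qed

text \<open>Take a block \<open>Z\<close> of \<open>R\<close> that is not a block of
  \<open>Q\<close>, and merge two blocks of \<open>Q\<close> inside \<open>Z\<close> that face each
  other across a gap containing no element of \<open>Z\<close>. Other blocks of \<open>Q\<close>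
  inside \<open>Z\<close> avoid this gap; those inside another block of \<open>R\<close> cannot
  cross a subset of \<open>Z\<close>, because \<open>R\<close> is non-crossing.\<close>

lemma exists_merge_below:
  assumes "Q \<in> NC n" "R \<in> NC n" "refines {1..n} Q R" "Q \<noteq> R"
  shows "\<exists>V\<in>Q. \<exists>W\<in>Q. V \<noteq> W \<and> merge Q V W \<in> NC n \<and> refines {1..n} (merge Q V W) R"
proof -
  have pQ: "partition_on {1..n} Q" and pR: "partition_on {1..n} R"
    using assms NC_partition by auto
  have sub: "\<exists>Y\<in>R. X \<subseteq> Y" if "X \<in> Q" for X using assms(3) that by (auto simp: refines_def)
  have "\<not> R \<subseteq> Q"
  proof
    assume "R \<subseteq> Q"
    have "X \<in> R" if "X \<in> Q" for X
    proof -
      obtain Y where Y: "Y \<in> R" "X \<subseteq> Y" using sub \<open>X \<in> Q\<close> by blast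
      obtain x where "x \<in> X" using \<open>X \<in> Q\<close> partition_onD3[OF pQ] by (metis ex_in_conv)
      then have "X = Y" using partition_on_same[OF pQ that, of Y x] Y \<open>R \<subseteq> Q\<close> by blast
      then show ?thesis using Y by simp
    qed
    then show False using \<open>R \<subseteq> Q\<close> assms(4) by blast
  qed
  then obtain Z where Z: "Z \<in> R" "Z \<notin> Q" by blast
  have finZ: "finite Z" using finite_subset[OF Union_upper[OF Z(1)]] partition_onD1[OF pR] by (metis finite_atLeastAtMost)
  have neZ: "Z \<noteq> {}" using Z(1) partition_onD3[OF pR] by blast
  have blockin: "X \<subseteq> Z" if "X \<in> Q" "z \<in> X" "z \<in> Z" for X z
    using sub[OF that(1)] partition_on_same[OF pR Z(1)] that(2,3) by blast
  have inQ: "\<exists>X\<in>Q. z \<in> X" if "z \<in> Z" for z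
    using that Z(1) partition_onD1[OF pQ] partition_onD1[OF pR] by blast
  obtain V where V: "V \<in> Q" "Min Z \<in> V" using inQ Min_in[OF finZ neZ] by blast
  have VZ: "V \<subseteq> Z" using blockin[OF V] Min_in[OF finZ neZ] by blast
  \<comment> \<open>\<open>y\<close> is the first element of \<open>Z\<close> outside the block
    \<open>V\<close> of the minimum, and \<open>x\<close> below is its predecessor in
    \<open>Z\<close>; hence \<open>x\<close> still belongs to \<open>V\<close>.\<close>
  define y where "y = Min (Z - V)"
  have "Z - V \<noteq> {}" using VZ V(1) Z(2) by auto
  then have y: "y \<in> Z" "y \<notin> V" and ymin: "\<And>z. z \<in> Z \<Longrightarrow> z < y \<Longrightarrow> z \<in> V"
    using Min_in[of "Z - V"] Min_le[of "Z - V"] finZ unfolding y_def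
    by (blast, blast, metis DiffI finite_Diff leD)
  obtain W where W: "W \<in> Q" "y \<in> W" using inQ y(1) by blast
  have WZ: "W \<subseteq> Z" using blockin[OF W] y by blast
  have VW: "V \<noteq> W" using y W by blast
  have "Min Z < y" using y V(2) Min_le[OF finZ y(1)] by (metis le_neq_implies_less)
  define x where "x = Max {z\<in>Z. z < y}"
  have fin: "finite {z\<in>Z. z < y}" and ne: "{z\<in>Z. z < y} \<noteq> {}"
    using finZ \<open>Min Z < y\<close> Min_in[OF finZ neZ] by auto
  have x: "x \<in> Z" "x < y" using Max_in[OF fin ne] by (auto simp: x_def)
  have btw: "\<not> (x < z \<and> z < y)" if "z \<in> Z" for z
  proof
    assume "x < z \<and> z < y"
    with that have "z \<le> x" unfolding x_def by (intro Max_ge[OF fin]) simp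
    with \<open>x < z \<and> z < y\<close> show False by simp
  qed
  have xV: "x \<in> V" using ymin x by blast
  have "noncrossing (merge Q V W)"
  proof (rule noncrossing_merge[OF pQ _ V(1) W(1) xV W(2) x(2)])
    show "noncrossing Q" using assms(1) by (simp add: NC_def)
    fix U assume U: "U \<in> Q" "U \<noteq> V" "U \<noteq> W"
    obtain Y where Y: "Y \<in> R" "U \<subseteq> Y" using sub U by blast
    show "(\<forall>u\<in>U. \<not> (x < u \<and> u < y)) \<or> noncrossing {V \<union> W, U}"
    proof (cases "Y = Z")
      case True
      then show ?thesis using btw Y by blast
    next
      case False
      have "noncrossing R" using assms(2) by (simp add: NC_def)
      then have "noncrossing {V \<union> W, U}"
        using VZ WZ noncrossing_subblocks[OF _ Z(1) Y(1) False[symmetric] _ Y(2)] by simp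
      then show ?thesis by blast
    qed
  qed
  then have "merge Q V W \<in> NC n" using partition_on_merge[OF pQ V(1) W(1)] by (simp add: NC_def)
  moreover have "refines {1..n} (merge Q V W) R"
    unfolding refines_def
    using partition_on_merge[OF pQ V(1) W(1)] pR sub VZ WZ Z(1) by (auto simp: merge_def)
  ultimately show ?thesis using V W VW by blast
qed

lemma refines_card_less:
  assumes "Q \<in> NC n" "R \<in> NC n" "refines {1..n} Q R" "Q \<noteq> R"
  shows "card R < card Q"
  using assms
proof (induction "card Q" arbitrary: Q rule: less_induct)
  case less
  obtain V W where VW: "V \<in> Q" "W \<in> Q" "V \<noteq> W" "merge Q V W \<in> NC n" "refines {1..n} (merge Q V W) R"
    using exists_merge_below[OF less.prems] by blast
  have c: "card Q = Suc (card (merge Q V W))"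
    using card_merge[of "{1..n}" Q V W] VW less.prems NC_partition by auto
  show ?case
  proof (cases "merge Q V W = R")
    case False
    then show ?thesis using less.hyps[of "merge Q V W"] c VW less.prems by auto
  qed (use c in simp)
qed

lemma NC_covers_imp_merge:
  assumes "NC_covers n Q R"
  shows "\<exists>V\<in>Q. \<exists>W\<in>Q. V \<noteq> W \<and> R = merge Q V W"
proof -
  have less: "Q \<in> NC n" "R \<in> NC n" "refines {1..n} Q R" "Q \<noteq> R"
    using assms by (auto simp: NC_covers_def NC_less_def)
  obtain V W where VW: "V \<in> Q" "W \<in> Q" "V \<noteq> W" "merge Q V W \<in> NC n" "refines {1..n} (merge Q V W) R"
    using exists_merge_below[OF less] by blast
  have p: "partition_on {1..n} Q" using less NC_partition by auto
  have "card Q = Suc (card (merge Q V W))"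
    using card_merge[of "{1..n}" Q V W] VW p by auto
  then have "Q \<noteq> merge Q V W" by auto
  then have "NC_less n Q (merge Q V W)"
    using VW less refines_merge[OF p] by (auto simp: NC_less_def)
  then have "\<not> NC_less n (merge Q V W) R" using assms by (auto simp: NC_covers_def)
  then have "merge Q V W = R" using VW less by (auto simp: NC_less_def)
  then show ?thesis using VW by blast
qed

lemma NC_covers_merge:
  assumes "Q \<in> NC n" "V \<in> Q" "W \<in> Q" "V \<noteq> W" "merge Q V W \<in> NC n"
  shows "NC_covers n Q (merge Q V W)"
proof -
  have p: "partition_on {1..n} Q" using assms NC_partition by auto
  have c: "card Q = Suc (card (merge Q V W))"
    using card_merge[of "{1..n}" Q V W] assms p by auto
  have "\<not> (NC_less n Q S \<and> NC_less n S (merge Q V W))" for S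
    using refines_card_less[of Q n S] refines_card_less[of S n "merge Q V W"] c
    unfolding NC_less_def by linarith
  moreover have "NC_less n Q (merge Q V W)"
    using assms refines_merge[OF p] c by (auto simp: NC_less_def)
  ultimately show ?thesis by (auto simp: NC_covers_def)
qed

section \<open>Distances in the Hasse diagram\<close>

lemma Hasse_sym: "(P, R) \<in> Hasse n ^^ k \<Longrightarrow> (R, P) \<in> Hasse n ^^ k"
proof (induction k arbitrary: R)
  case (Suc k)
  then obtain Q where "(P, Q) \<in> Hasse n ^^ k" "(Q, R) \<in> Hasse n" by auto
  then have "(Q, P) \<in> Hasse n ^^ k" "(R, Q) \<in> Hasse n" using Suc.IH by (auto simp: Hasse_def)
  then show ?case by (rule relpow_Suc_I2[rotated])
qed simp

lemma Hasse_path_refines: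
  assumes "Q \<in> NC n" "R \<in> NC n" "refines {1..n} Q R"
  shows "card R \<le> card Q \<and> (Q, R) \<in> Hasse n ^^ (card Q - card R)"
  using assms
proof (induction "card Q" arbitrary: Q rule: less_induct)
  case less
  show ?case
  proof (cases "Q = R")
    case False
    obtain V W where VW: "V \<in> Q" "W \<in> Q" "V \<noteq> W" "merge Q V W \<in> NC n" "refines {1..n} (merge Q V W) R"
      using exists_merge_below[OF less.prems False] by blast
    have c: "card Q = Suc (card (merge Q V W))"
      using card_merge[of "{1..n}" Q V W] VW less.prems NC_partition by auto
    have IH: "card R \<le> card (merge Q V W)"
      "(merge Q V W, R) \<in> Hasse n ^^ (card (merge Q V W) - card R)"
      using less.hyps[of "merge Q V W"] c VW less.prems by auto
    have "(Q, merge Q V W) \<in> Hasse n"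
      using NC_covers_merge VW less.prems(1) by (auto simp: Hasse_def)
    then have "(Q, R) \<in> Hasse n ^^ Suc (card (merge Q V W) - card R)"
      using IH(2) by (rule relpow_Suc_I2)
    then show ?thesis using IH(1) c by (simp add: Suc_diff_le)
  qed simp
qed

text \<open>For partitions of \<open>{1..n}\<close> this is the number of blocks of the join in the
  lattice of all partitions, which may cross; \<open>exists_join\<close> realizes it by a
  non-crossing partition when one of the two is an interval partition.\<close>

abbreviation joins :: "nat \<Rightarrow> nat set set \<Rightarrow> nat set set \<Rightarrow> nat" where
  "joins n P Q \<equiv> ncomp {1..n} (block_rel P \<union> block_rel Q)"

lemma joins_merge:
  assumes "Q \<in> NC n" "V \<in> Q" "W \<in> Q"
  shows "joins n P (merge Q V W) \<le> joins n P Q" "joins n P Q \<le> Suc (joins n P (merge Q V W))"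
proof -
  have p: "partition_on {1..n} Q" using assms NC_partition by auto
  obtain v w where vw: "v \<in> V" "w \<in> W" using assms(2,3) partition_onD3[OF p] by (metis ex_in_conv)
  then have "v \<in> {1..n}" "w \<in> {1..n}" using assms(2,3) partition_onD1[OF p] by blast+
  then show "joins n P (merge Q V W) \<le> joins n P Q" "joins n P Q \<le> Suc (joins n P (merge Q V W))"
    using ncomp_insert[of "{1..n}" v w "block_rel P \<union> block_rel Q"]
    unfolding ncomp_merge[OF p assms(2,3) vw] by auto
qed

text \<open>Along a cover both \<open>card Q\<close> and the number of classes of the join drop, by 1 and by at most 1.\<close>

lemma Hasse_potential:
  assumes "(Q, Q') \<in> Hasse n"
  shows "\<bar>(int (card Q) - 2 * int (joins n P Q)) - (int (card Q') - 2 * int (joins n P Q'))\<bar> \<le> 1"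
proof -
  have *: "\<bar>(int (card Q) - 2 * int (joins n P Q)) - (int (card Q') - 2 * int (joins n P Q'))\<bar> \<le> 1"
    if c: "NC_covers n Q Q'" for Q Q'
  proof -
    have Q: "Q \<in> NC n" using c by (auto simp: NC_covers_def NC_less_def)
    obtain V W where VW: "V \<in> Q" "W \<in> Q" "V \<noteq> W" "Q' = merge Q V W"
      using NC_covers_imp_merge[OF c] by blast
    have "card Q = Suc (card Q')"
      using card_merge[of "{1..n}" Q V W] VW Q NC_partition by auto
    then show ?thesis using joins_merge[OF Q VW(1,2), of P] VW(4) by simp
  qed
  show ?thesis using assms *[of Q Q'] *[of Q' Q] by (auto simp: Hasse_def)
qed

text \<open>The potential \<open>card Q - 2 * joins n P Q\<close> is \<open>- card P\<close> at
  \<open>Q = P\<close>. So on the way to \<open>R\<close> it rises by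
  \<open>card P + card R - 2 * joins n P R\<close>, and each edge changes it by at most 1.\<close>

lemma Hasse_path_length:
  assumes "(P, R) \<in> Hasse n ^^ k" "P \<in> NC n"
  shows "card P + card R \<le> k + 2 * joins n P R"
proof -
  have "\<bar>(int (card P) - 2 * int (joins n P P)) - (int (card R) - 2 * int (joins n P R))\<bar> \<le> int k"
    using assms(1)
  proof (induction k arbitrary: R)
    case (Suc k)
    then obtain Q where "(P, Q) \<in> Hasse n ^^ k" "(Q, R) \<in> Hasse n" by auto
    with Suc.IH[of Q] Hasse_potential[of Q R n P] show ?case by linarith
  qed simp
  moreover have "joins n P P = card P"
    using ncomp_block_rel_refines[of "{1..n}" P P] assms(2) NC_partition refines_refl by auto
  ultimately show ?thesis by linarith
qed

text \<open>While some block of \<open>P\<close> contains neighbours \<open>i\<close> and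
  \<open>Suc i\<close> from different blocks of \<open>R\<close>, merge these two blocks;
  \<open>P\<close> connects them already, so the number of classes stays the same. When no such pair
  is left, every interval of \<open>P\<close> lies inside one block of \<open>R\<close>.\<close>

lemma exists_join:
  assumes "P \<in> Interval_partitions n" "R \<in> NC n"
  shows "\<exists>J\<in>NC n. refines {1..n} P J \<and> refines {1..n} R J \<and> card J = joins n P R"
  using assms(2)
proof (induction "card R" arbitrary: R rule: less_induct)
  case less
  have pP: "partition_on {1..n} P" and int: "\<And>V. V \<in> P \<Longrightarrow> \<exists>p q. V = {p..q}"
    using assms(1) NC_partition by (auto simp: Interval_partitions_def)
  have pR: "partition_on {1..n} R" using less NC_partition by auto
  show ?case
  proof (cases "\<exists>X\<in>P. \<exists>i V W. i \<in> X \<and> Suc i \<in> X \<and> V \<in> R \<and> W \<in> R \<and> i \<in> V \<and> Suc i \<in> W \<and> V \<noteq> W")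
    case True
    then obtain X i V W where X: "X \<in> P" "i \<in> X" "Suc i \<in> X" and
      VW: "V \<in> R" "W \<in> R" "i \<in> V" "Suc i \<in> W" "V \<noteq> W" by blast
    \<comment> \<open>No number lies strictly between \<open>i\<close> and \<open>Suc i\<close>, so
      the first alternative of \<open>noncrossing_merge\<close> holds for every other block.\<close>
    have "noncrossing (merge R V W)"
      by (rule noncrossing_merge[OF pR _ VW(1-4)]) (use less.prems in \<open>auto simp: NC_def\<close>)
    then have m: "merge R V W \<in> NC n" using partition_on_merge[OF pR VW(1,2)] by (simp add: NC_def)
    have c: "card R = Suc (card (merge R V W))"
      using card_merge[of "{1..n}" R V W] VW pR by auto
    obtain J where J: "J \<in> NC n" "refines {1..n} P J" "refines {1..n} (merge R V W) J"
      "card J = joins n P (merge R V W)"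
      using less.hyps[of "merge R V W"] c m by auto
    have "(i, Suc i) \<in> equiv_cl (block_rel P \<union> block_rel R)"
      using X by (auto simp: block_rel_def intro!: equiv_cl_base)
    then have "joins n P (merge R V W) = joins n P R"
      unfolding ncomp_merge[OF pR VW(1-4)] by (rule ncomp_insert_connected)
    then show ?thesis using J refines_trans[OF refines_merge[OF pR VW(1,2)] J(3)] by auto
  next
    case False
    have "\<exists>Y\<in>R. X \<subseteq> Y" if X: "X \<in> P" for X
    proof -
      obtain p q where pq: "X = {p..q}" using int X by blast
      then have "p \<le> q" using X partition_onD3[OF pP] by force
      then have "p \<in> X" using pq by simp
      then have "p \<in> {1..n}" using X partition_onD1[OF pP] by blast
      then obtain Y where Y: "Y \<in> R" "p \<in> Y" using partition_onD1[OF pR] by blast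
      have "j \<in> Y" if "p \<le> j" "j \<le> q" for j
        using that
      proof (induction rule: dec_induct)
        case (step j)
        have "Suc j \<in> X" using step pq by simp
        then have "Suc j \<in> {1..n}" using X partition_onD1[OF pP] by blast
        then obtain W where "W \<in> R" "Suc j \<in> W" using partition_onD1[OF pR] by blast
        have "j \<in> X" using step pq by simp
        then have "Y = W"
          using False X Y(1) step.IH \<open>Suc j \<in> X\<close> \<open>W \<in> R\<close> \<open>Suc j \<in> W\<close> step.prems
          by (meson Suc_leD)
        then show ?case using \<open>Suc j \<in> W\<close> by simp
      qed (use Y in simp)
      then have "X \<subseteq> Y" using pq by auto
      then show ?thesis using Y(1) by blast
    qed
    then have "refines {1..n} P R" using pP pR by (auto simp: refines_def)
    then show ?thesis using less.prems refines_refl[OF pR] ncomp_block_rel_refines[of "{1..n}" P R] by auto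
  qed
qed

lemma joins_pos: "n \<ge> 1 \<Longrightarrow> joins n P R \<ge> 1"
  by (rule ncomp_pos) auto

text \<open>Going up from \<open>P\<close> to the join and down to \<open>R\<close> attains the
  lower bound of \<open>Hasse_path_length\<close>.\<close>

lemma dH_interval:
  assumes "P \<in> Interval_partitions n" "R \<in> NC n"
  shows "dH n P R + 2 * joins n P R = card P + card R"
proof -
  have P: "P \<in> NC n" using assms by (simp add: Interval_partitions_def)
  obtain J where J: "J \<in> NC n" "refines {1..n} P J" "refines {1..n} R J" "card J = joins n P R"
    using exists_join[OF assms] by blast
  have p1: "card J \<le> card P" "(P, J) \<in> Hasse n ^^ (card P - card J)"
    using Hasse_path_refines[OF P J(1,2)] by auto
  have p2: "card J \<le> card R" "(R, J) \<in> Hasse n ^^ (card R - card J)"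
    using Hasse_path_refines[OF assms(2) J(1,3)] by auto
  have path: "(P, R) \<in> Hasse n ^^ ((card P - card J) + (card R - card J))"
    unfolding relpow_add using p1(2) Hasse_sym[OF p2(2)] by blast
  have "dH n P R \<le> (card P - card J) + (card R - card J)"
    unfolding dH_def using path by (rule Least_le)
  moreover have "(P, R) \<in> Hasse n ^^ dH n P R"
    unfolding dH_def using path by (rule LeastI)
  then have "card P + card R \<le> dH n P R + 2 * joins n P R" using Hasse_path_length P by blast
  ultimately show ?thesis using J(4) p1(1) p2(1) by linarith
qed

text \<open>This is the bound vertices \<le> edges + components for the graph of the pair. Build
  \<open>R\<close> from the singletons by merges: \<open>joins\<close> starts at
  \<open>card P\<close>, and while the number of blocks falls from \<open>n\<close> to
  \<open>card R\<close> one by one, each merge lowers \<open>joins\<close> by at most 1.\<close>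

lemma card_le_joins:
  assumes "P \<in> NC n" "R \<in> NC n"
  shows "card P + card R \<le> n + joins n P R"
proof -
  have *: "joins n P Q + card R \<le> joins n P R + card Q"
    if "Q \<in> NC n" "refines {1..n} Q R" for Q
    using that
  proof (induction "card Q" arbitrary: Q rule: less_induct)
    case less
    show ?case
    proof (cases "Q = R")
      case False
      obtain V W where VW: "V \<in> Q" "W \<in> Q" "V \<noteq> W" "merge Q V W \<in> NC n" "refines {1..n} (merge Q V W) R"
        using exists_merge_below[OF less.prems(1) assms(2) less.prems(2) False] by blast
      have c: "card Q = Suc (card (merge Q V W))"
        using card_merge[of "{1..n}" Q V W] VW less.prems NC_partition by auto
      show ?thesis
        using less.hyps[of "merge Q V W"] c VW joins_merge(2)[OF less.prems(1) VW(1,2), of P] by auto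
    qed simp
  qed
  let ?S = "(\<lambda>x. {x}) ` {1..n}"
  have pS: "partition_on {1..n} ?S" by (rule partition_on_singletons)
  then have S: "?S \<in> NC n" by (auto simp: NC_def noncrossing_def)
  have pP: "partition_on {1..n} P" and pR: "partition_on {1..n} R"
    using assms NC_partition by auto
  have "refines {1..n} ?S R"
    unfolding refines_def using pS pR partition_onD1[OF pR] by auto
  moreover have "refines {1..n} ?S P"
    unfolding refines_def using pS pP partition_onD1[OF pP] by auto
  then have "joins n P ?S = card P"
    using ncomp_block_rel_refines[of "{1..n}" ?S P] by (simp add: Un_commute)
  moreover have "card ?S = n" by (simp add: card_image)
  ultimately show ?thesis using *[OF S] by simp
qed

text \<open>Inserting distance \<open>n - 1\<close> into \<open>dH_interval\<close> and comparing
  with \<open>card_le_joins\<close> gives \<open>joins n P R\<close> \<le> 1, and it is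
  positive.\<close>

lemma shallow_meanders_of_order_iff:
  assumes "n \<ge> 1"
  shows "(P, R) \<in> shallow_meanders_of_order n \<longleftrightarrow>
     P \<in> Interval_partitions n \<and> R \<in> NC n \<and> joins n P R = 1 \<and> card P + card R = n + 1"
proof -
  have "dH n P R = n - 1 \<longleftrightarrow> joins n P R = 1 \<and> card P + card R = n + 1"
    if "P \<in> Interval_partitions n" "R \<in> NC n"
    using dH_interval[OF that] card_le_joins[OF _ that(2), of P] that(1) joins_pos[OF assms, of P R] assms
    by (auto simp: Interval_partitions_def)
  then show ?thesis by (auto simp: shallow_meanders_of_order_def)
qed

subsection \<open>Bridges and trees\<close>

definition links :: "('v, 'e, 'm) fat_graph_scheme \<Rightarrow> 'e set \<Rightarrow> ('v \<times> 'v) set" where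
  "links G F = {(x, y). \<exists>e\<in>F. ends G e = {x, y}}"

lemma links_rtrancl: "(links G F)\<^sup>* = equiv_cl (links G F)"
proof -
  have "links G F \<union> (links G F)\<inverse> = links G F" unfolding links_def by (auto simp: insert_commute)
  then show ?thesis by (simp add: equiv_cl_def)
qed

lemma connected_graph_iff:
  "connected_graph G \<longleftrightarrow> verts G \<noteq> {} \<and> (\<forall>u\<in>verts G. \<forall>v\<in>verts G. (u, v) \<in> equiv_cl (links G (edges G)))"
  by (simp only: connected_graph_def flip: links_rtrancl) (simp only: links_def)

lemma finite_graph_ends:
  assumes "finite_graph G" "e \<in> edges G"
  obtains a b where "a \<in> verts G" "b \<in> verts G" "ends G e = {a, b}"
proof -
  have "ends G e \<subseteq> verts G" "card (ends G e) = 1 \<or> card (ends G e) = 2"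
    using assms unfolding finite_graph_def by auto
  then show thesis using that
    by (elim conjE disjE) (auto simp: card_1_singleton_iff card_2_iff)
qed

lemma ncomp_links_insert:
  assumes "ends G e = {a, b}"
  shows "ncomp X (links G (insert e F)) = ncomp X (insert (a, b) (links G F))"
proof -
  have "equiv_cl (links G (insert e F)) = equiv_cl (insert (a, b) (links G F))"
  proof (rule equiv_cl_eqI)
    fix x y assume "(x, y) \<in> insert (a, b) (links G F)"
    then have "(x, y) \<in> links G (insert e F)" using assms by (auto simp: links_def)
    then show "(x, y) \<in> equiv_cl (links G (insert e F))" by (rule equiv_cl_base)
  next
    fix x y assume "(x, y) \<in> links G (insert e F)"
    then consider "(x, y) \<in> links G F" | "{a, b} = {x, y}" using assms by (auto simp: links_def)
    then show "(x, y) \<in> equiv_cl (insert (a, b) (links G F))"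
    proof cases
      case 1 then show ?thesis by (intro equiv_cl_base) simp
    next
      case 2
      then have "(x = a \<and> y = b) \<or> (x = b \<and> y = a)" by (auto simp: doubleton_eq_iff)
      moreover have "(a, b) \<in> equiv_cl (insert (a, b) (links G F))" by (intro equiv_cl_base) simp
      ultimately show ?thesis using equiv_cl_sym by metis
    qed
  qed
  then show ?thesis by (simp add: ncomp_def)
qed

lemma ncomp_links_empty: "ncomp X (links G {}) = card X"
proof -
  have "equiv_cl (links G {}) = Id" by (simp add: links_def equiv_cl_def)
  then have "(\<lambda>x. equiv_cl (links G {}) `` {x}) ` X = (\<lambda>x. {x}) ` X" by auto
  then show ?thesis by (simp add: ncomp_def card_image)
qed

lemma card_verts_le:
  assumes G: "finite_graph G" and F: "F \<subseteq> edges G"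
  shows "card (verts G) \<le> ncomp (verts G) (links G F) + card F"
proof -
  have fV: "finite (verts G)" and "finite F" using G F finite_subset by (auto simp: finite_graph_def)
  from this(2) F show ?thesis
  proof (induction F rule: finite_induct)
    case empty then show ?case by (simp add: ncomp_links_empty)
  next
    case (insert e F)
    obtain a b where ab: "a \<in> verts G" "b \<in> verts G" "ends G e = {a, b}"
      using finite_graph_ends[OF G] insert.prems by blast
    show ?case
      using insert ncomp_insert(2)[OF fV ab(1,2), of "links G F"] ncomp_links_insert[OF ab(3), of "verts G" F]
      by simp
  qed
qed

text \<open>A loop (\<open>a = b\<close>) is never a bridge, because \<open>equiv_cl\<close> is
  reflexive.\<close>

definition bridge :: "('v, 'e, 'm) fat_graph_scheme \<Rightarrow> 'e \<Rightarrow> bool" where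
  "bridge G e \<longleftrightarrow> (\<forall>a b. ends G e = {a, b} \<longrightarrow> (a, b) \<notin> equiv_cl (links G (edges G - {e})))"

lemma links_mono: "F \<subseteq> F' \<Longrightarrow> (x, y) \<in> equiv_cl (links G F) \<Longrightarrow> (x, y) \<in> equiv_cl (links G F')"
  by (erule equiv_cl_least) (auto simp: links_def intro!: equiv_cl_base)

lemma card_verts_bridges:
  assumes G: "finite_graph G" and br: "\<And>e. e \<in> edges G \<Longrightarrow> bridge G e" and F: "F \<subseteq> edges G"
  shows "card (verts G) = ncomp (verts G) (links G F) + card F"
proof -
  have fV: "finite (verts G)" and "finite F" using G F finite_subset by (auto simp: finite_graph_def)
  from this(2) F show ?thesis
  proof (induction F rule: finite_induct)
    case empty then show ?case by (simp add: ncomp_links_empty)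
  next
    case (insert e F)
    obtain a b where ab: "a \<in> verts G" "b \<in> verts G" "ends G e = {a, b}"
      using finite_graph_ends[OF G] insert.prems by blast
    have "F \<subseteq> edges G - {e}" using insert by blast
    then have "(a, b) \<notin> equiv_cl (links G F)"
      using br[of e] insert.prems ab(3) links_mono[of F "edges G - {e}" a b G] unfolding bridge_def by blast
    then show ?case
      using insert ncomp_insert_disconnected[OF fV ab(1,2)] ncomp_links_insert[OF ab(3), of "verts G" F]
      by simp
  qed
qed

lemma simple_path:
  assumes "(x, y) \<in> (links G F)\<^sup>*"
  shows "\<exists>vs es. length vs = Suc (length es) \<and> hd vs = x \<and> last vs = y \<and> distinct vs \<and>
    (\<forall>i<length es. es ! i \<in> F \<and> ends G (es ! i) = {vs ! i, vs ! Suc i})"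
  using assms
proof (induction rule: rtrancl_induct)
  case base
  show ?case by (intro exI[of _ "[x]"] exI[of _ "[]"]) simp
next
  case (step y z)
  then obtain vs es where p: "length vs = Suc (length es)" "hd vs = x" "last vs = y" "distinct vs"
    "\<And>i. i < length es \<Longrightarrow> es ! i \<in> F \<and> ends G (es ! i) = {vs ! i, vs ! Suc i}" by blast
  obtain e where e: "e \<in> F" "ends G e = {y, z}" using step(2) by (auto simp: links_def)
  show ?case
  proof (cases "z \<in> set vs")
    \<comment> \<open>If \<open>z\<close> has been visited before, the path is cut back to that
      visit.\<close>
    case True
    then obtain k where k: "k < length vs" "vs ! k = z" by (metis in_set_conv_nth)
    have ne: "vs \<noteq> []" using p(1) by auto
    have "last (take (Suc k) vs) = z" using k by (simp add: take_Suc_conv_app_nth)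
    moreover have "hd (take (Suc k) vs) = x" using p(2) ne by (simp add: hd_conv_nth)
    ultimately show ?thesis using p k
      by (intro exI[of _ "take (Suc k) vs"] exI[of _ "take k es"]) auto
  next
    case False
    have ne: "vs \<noteq> []" using p(1) by auto
    have y: "vs ! length es = y" using p(1,3) ne by (simp add: last_conv_nth)
    have "(es @ [e]) ! i \<in> F \<and> ends G ((es @ [e]) ! i) = {(vs @ [z]) ! i, (vs @ [z]) ! Suc i}"
      if "i < length (es @ [e])" for i
    proof (cases "i < length es")
      case True
      then show ?thesis using p(1) p(5)[OF True] by (simp add: nth_append)
    next
      case False
      then have "i = length es" using that by simp
      then show ?thesis using p(1) e y by (simp add: nth_append)
    qed
    then show ?thesis using p(1-4) False ne
      by (intro exI[of _ "vs @ [z]"] exI[of _ "es @ [e]"]) auto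
  qed
qed

text \<open>A simple path between the ends of \<open>e\<close> that avoids \<open>e\<close> closes
  up with \<open>e\<close> to a cycle. For a loop the path is trivial and the cycle has length
  1.\<close>

lemma acyclic_bridge:
  assumes G: "finite_graph G" and ac: "\<not> (\<exists>vs es. is_cycle G vs es)" and e: "e \<in> edges G"
  shows "bridge G e"
  unfolding bridge_def
proof (intro allI impI notI)
  fix a b assume ab: "ends G e = {a, b}" and conn: "(a, b) \<in> equiv_cl (links G (edges G - {e}))"
  have abV: "a \<in> verts G" "b \<in> verts G" using G e ab unfolding finite_graph_def by auto
  obtain vs es where p: "length vs = Suc (length es)" "hd vs = a" "last vs = b" "distinct vs"
    "\<And>i. i < length es \<Longrightarrow> es ! i \<in> edges G - {e} \<and> ends G (es ! i) = {vs ! i, vs ! Suc i}"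
    using simple_path[of a b G] conn unfolding links_rtrancl by blast
  have ne: "vs \<noteq> []" using p(1) by auto
  have a: "vs ! 0 = a" and b: "vs ! length es = b"
    using p(1-3) ne by (simp_all add: hd_conv_nth last_conv_nth)
  have sub: "set es \<subseteq> edges G - {e}" using p(5) by (metis in_set_conv_nth subsetI)
  \<comment> \<open>Equal edges would put the vertex at position \<open>i\<close> at the later
    position \<open>j\<close> or \<open>Suc j\<close> as well.\<close>
  have "es ! i \<noteq> es ! j" if "i < j" "j < length es" for i j
  proof
    assume "es ! i = es ! j"
    then have "{vs ! i, vs ! Suc i} = {vs ! j, vs ! Suc j}" using p(5) that by (metis less_trans)
    then have "vs ! i = vs ! j \<or> vs ! i = vs ! Suc j" by (auto simp: doubleton_eq_iff)
    then have "i = j \<or> i = Suc j" using that p(1) nth_eq_iff_index_eq[OF p(4)] by auto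
    then show False using that by simp
  qed
  then have dist: "distinct es"
    unfolding distinct_conv_nth by (metis linorder_neqE_nat)
  have vsub: "set vs \<subseteq> verts G"
  proof
    fix v assume "v \<in> set vs"
    then obtain k where k: "k < length vs" "v = vs ! k" by (metis in_set_conv_nth)
    show "v \<in> verts G"
    proof (cases "k < length es")
      case True
      then have "es ! k \<in> edges G" "v \<in> ends G (es ! k)" using p(5) k(2) by auto
      then show ?thesis using G unfolding finite_graph_def by blast
    next
      case False
      then have "v = b" using k p(1) b by (simp add: not_less less_Suc_eq_le)
      then show ?thesis using abV by simp
    qed
  qed
  have "ends G ((es @ [e]) ! i) = {vs ! i, vs ! (Suc i mod length vs)}" if "i < length (es @ [e])" for i
  proof (cases "i < length es")
    case True
    then show ?thesis using p(1) p(5)[OF True] by (simp add: nth_append)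
  next
    case False
    then have "i = length es" using that by simp
    then show ?thesis using p(1) ab a b by (simp add: insert_commute)
  qed
  then have "is_cycle G vs (es @ [e])"
    unfolding is_cycle_def using p(1,4) dist sub vsub e by auto
  then show False using ac by blast
qed

text \<open>The rest of the cycle joins the ends of its first edge; for a loop this rest is empty
  and the two ends coincide.\<close>

lemma cycle_not_bridge:
  assumes "is_cycle G vs es"
  shows "\<exists>e\<in>edges G. \<not> bridge G e"
proof -
  let ?k = "length es"
  have c: "?k > 0" "length vs = ?k" "distinct es" "set es \<subseteq> edges G"
    "\<And>i. i < ?k \<Longrightarrow> ends G (es ! i) = {vs ! i, vs ! (Suc i mod ?k)}"
    using assms unfolding is_cycle_def by auto
  let ?F = "edges G - {es ! 0}"
  have link: "(vs ! i, vs ! (Suc i mod ?k)) \<in> equiv_cl (links G ?F)" if "0 < i" "i < ?k" for i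
  proof -
    have "es ! i \<noteq> es ! 0" using that nth_eq_iff_index_eq[OF c(3), of i 0] by fastforce
    then have "es ! i \<in> ?F" using that c(4) by auto
    then have "(vs ! i, vs ! (Suc i mod ?k)) \<in> links G ?F" using c(5)[OF that(2)] by (auto simp: links_def)
    then show ?thesis by (rule equiv_cl_base)
  qed
  have path: "(vs ! 1, vs ! i) \<in> equiv_cl (links G ?F)" if "1 \<le> i" "i < ?k" for i
    using that
  proof (induction rule: dec_induct)
    case (step i)
    then have "(vs ! i, vs ! Suc i) \<in> equiv_cl (links G ?F)" using link[of i] by simp
    then show ?case using step equiv_cl_trans by fastforce
  qed simp
  have "(vs ! (Suc 0 mod ?k), vs ! 0) \<in> equiv_cl (links G ?F)"
  proof (cases "?k = 1")
    case False
    then have k: "?k > 1" using c(1) by linarith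
    have "Suc (?k - 1) mod ?k = 0" unfolding Suc_diff_1[OF c(1)] by simp
    then have "(vs ! (?k - 1), vs ! 0) \<in> equiv_cl (links G ?F)"
      using link[of "?k - 1"] k by (metis diff_less less_trans zero_less_diff zero_less_one)
    then show ?thesis using path[of "?k - 1"] k equiv_cl_trans[of "vs ! 1" "vs ! (?k - 1)"] by simp
  qed simp
  moreover have "ends G (es ! 0) = {vs ! (Suc 0 mod ?k), vs ! 0}" using c(5)[OF c(1)] by (simp add: insert_commute)
  ultimately have "\<not> bridge G (es ! 0)" unfolding bridge_def by blast
  moreover have "es ! 0 \<in> edges G" using c(1,4) by auto
  ultimately show ?thesis by blast
qed

lemma finite_tree_bridge: "finite_tree G \<Longrightarrow> e \<in> edges G \<Longrightarrow> bridge G e"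
  by (rule acyclic_bridge) (simp_all add: finite_tree_def)

text \<open>For the converse direction: deleting an edge that is not a bridge leaves the graph
  connected, so \<open>card_verts_le\<close> would bound the number of vertices by the number of
  edges.\<close>

lemma finite_tree_iff_card:
  assumes G: "finite_graph G" and con: "connected_graph G"
  shows "finite_tree G \<longleftrightarrow> card (verts G) = Suc (card (edges G))"
proof
  have one: "ncomp (verts G) (links G (edges G)) = 1"
    by (rule ncomp_eq_1I) (use con in \<open>auto simp: connected_graph_iff\<close>)
  {
    assume "finite_tree G"
    then show "card (verts G) = Suc (card (edges G))"
      using card_verts_bridges[OF G finite_tree_bridge, of "edges G"] one by simp
  next
    assume card: "card (verts G) = Suc (card (edges G))"
    have fE: "finite (edges G)" using G by (simp add: finite_graph_def)
    have "bridge G e" if e: "e \<in> edges G" for e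
    proof (rule ccontr)
      assume "\<not> bridge G e"
      then obtain a b where ab: "ends G e = {a, b}" "(a, b) \<in> equiv_cl (links G (edges G - {e}))"
        unfolding bridge_def by blast
      have "ncomp (verts G) (links G (edges G)) = ncomp (verts G) (links G (edges G - {e}))"
        using ncomp_links_insert[OF ab(1), of "verts G" "edges G - {e}"] ncomp_insert_connected[OF ab(2), of "verts G"]
          insert_Diff[OF e] by simp
      then have "card (verts G) \<le> 1 + card (edges G - {e})"
        using card_verts_le[OF G, of "edges G - {e}"] one by auto
      moreover have "card (edges G - {e}) < card (edges G)" using fE e by (rule card_Diff1_less)
      ultimately show False using card by simp
    qed
    then show "finite_tree G" using cycle_not_bridge G con unfolding finite_tree_def by blast
  }
qed

subsection \<open>Labelling the edges of a marked tree\<close>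

text \<open>Used throughout to pass from closure under one rotation step to closure under whole
  orbits.\<close>

lemma funpow_closed: "(\<And>e. e \<in> E \<Longrightarrow> f e \<in> E) \<Longrightarrow> x \<in> E \<Longrightarrow> (f ^^ k) x \<in> E"
  by (induction k) auto

text \<open>By finiteness two iterates agree, and injectivity cancels the common steps until one of
  them is \<open>x\<close> itself.\<close>

lemma finite_inj_returns:
  assumes "finite E" "inj_on f E" "\<And>e. e \<in> E \<Longrightarrow> f e \<in> E" "x \<in> E"
  shows "\<exists>m>0. (f ^^ m) x = x"
proof -
  have mem: "(f ^^ k) x \<in> E" for k using funpow_closed[of E f x k] assms(3,4) by blast
  have "\<not> inj (\<lambda>k. (f ^^ k) x)"
  proof
    assume "inj (\<lambda>k. (f ^^ k) x)"
    moreover have "range (\<lambda>k. (f ^^ k) x) \<subseteq> E" using mem by blast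
    ultimately show False using assms(1) by (meson finite_imageD finite_subset infinite_UNIV_nat)
  qed
  then obtain a b where "a < b" "(f ^^ a) x = (f ^^ b) x"
    unfolding inj_on_def by (metis linorder_neqE_nat)
  then show ?thesis
  proof (induction a arbitrary: b)
    case 0 then show ?case by (intro exI[of _ b]) simp
  next
    case (Suc a)
    then obtain c where c: "b = Suc c" by (cases b) auto
    have "(f ^^ a) x = (f ^^ c) x"
      using Suc.prems(2) inj_onD[OF assms(2) _ mem mem, of a c] unfolding c by simp
    then show ?case using Suc.IH[of c] Suc.prems(1) c by simp
  qed
qed

text \<open>\<open>D i\<close> stands for the edges beyond the white end of \<open>i\<close>: removing \<open>i\<close> disconnects them from its black end.\<close>

locale marked_tree_edges =
  fixes E :: "'e set" and \<sigma> \<alpha> :: "'e \<Rightarrow> 'e" and bl :: "'e \<Rightarrow> 'b" and wh :: "'e \<Rightarrow> 'w"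
    and spec :: "'b \<Rightarrow> 'e" and s0 :: 'e and D :: "'e \<Rightarrow> 'e set"
  assumes fin: "finite E"
    and sE: "e \<in> E \<Longrightarrow> \<sigma> e \<in> E" and s_bl: "e \<in> E \<Longrightarrow> bl (\<sigma> e) = bl e"
    and aE: "e \<in> E \<Longrightarrow> \<alpha> e \<in> E" and a_wh: "e \<in> E \<Longrightarrow> wh (\<alpha> e) = wh e"
    and s_orb: "e \<in> E \<Longrightarrow> f \<in> E \<Longrightarrow> bl e = bl f \<Longrightarrow> \<exists>k. (\<sigma> ^^ k) e = f"
    and a_orb: "e \<in> E \<Longrightarrow> f \<in> E \<Longrightarrow> wh e = wh f \<Longrightarrow> \<exists>k. (\<alpha> ^^ k) e = f"
    and conn: "C \<subseteq> E \<Longrightarrow> C \<noteq> {} \<Longrightarrow> (\<And>e. e \<in> C \<Longrightarrow> \<sigma> e \<in> C) \<Longrightarrow> (\<And>e. e \<in> C \<Longrightarrow> \<alpha> e \<in> C) \<Longrightarrow> C = E"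
    and DE: "i \<in> E \<Longrightarrow> D i \<subseteq> E" and D_irrefl: "i \<in> E \<Longrightarrow> i \<notin> D i"
    and D_s: "i \<in> E \<Longrightarrow> e \<in> D i \<Longrightarrow> \<sigma> e \<in> D i"
    and D_a: "i \<in> E \<Longrightarrow> e \<in> insert i (D i) \<Longrightarrow> \<alpha> e \<in> insert i (D i)"
    and spec_E: "e \<in> E \<Longrightarrow> spec (bl e) \<in> E" and bl_spec: "e \<in> E \<Longrightarrow> bl (spec (bl e)) = bl e"
    and s0E: "s0 \<in> E" and s0_spec: "spec (bl s0) = s0"
begin

text \<open>Turning around the black vertex leads from \<open>\<sigma> f\<close> back to
  \<open>f\<close>. So \<open>\<sigma>\<close> maps onto the finite set \<open>E\<close>, and is
  injective.\<close>

lemma s_inj: "inj_on \<sigma> E"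
proof -
  have "f \<in> \<sigma> ` E" if f: "f \<in> E" for f
  proof -
    obtain k where "(\<sigma> ^^ k) (\<sigma> f) = f" using s_orb[OF sE[OF f] f s_bl[OF f]] by blast
    then have "\<sigma> ((\<sigma> ^^ k) f) = f" by (simp add: funpow_swap1)
    then show ?thesis using funpow_closed[of E \<sigma> f k, OF sE f] by (metis imageI)
  qed
  then have "\<sigma> ` E = E" using sE by blast
  then show ?thesis using fin by (simp add: eq_card_imp_inj_on)
qed

lemma a_inj: "inj_on \<alpha> E"
proof -
  have "f \<in> \<alpha> ` E" if f: "f \<in> E" for f
  proof -
    obtain k where "(\<alpha> ^^ k) (\<alpha> f) = f" using a_orb[OF aE[OF f] f a_wh[OF f]] by blast
    then have "\<alpha> ((\<alpha> ^^ k) f) = f" by (simp add: funpow_swap1)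
    then show ?thesis using funpow_closed[of E \<alpha> f k, OF aE f] by (metis imageI)
  qed
  then have "\<alpha> ` E = E" using aE by blast
  then show ?thesis using fin by (simp add: eq_card_imp_inj_on)
qed

text \<open>A branch \<open>D i\<close> is closed under \<open>\<sigma>\<close>, so with one edge it
  contains all edges at the same black vertex. In the same way, \<open>K_wh\<close> says that adding
  \<open>i\<close> turns it into a union of full white vertices.\<close>

lemma D_bl:
  assumes "i \<in> E" "e \<in> D i" "f \<in> E" "bl f = bl e"
  shows "f \<in> D i"
proof -
  have "e \<in> E" using assms DE by blast
  then obtain k where "(\<sigma> ^^ k) e = f" using s_orb[of e f] assms(3,4) by auto
  then show ?thesis using funpow_closed[of "D i" \<sigma> e k] D_s assms(1,2) by blast
qed

lemma K_wh:
  assumes "i \<in> E" "e \<in> insert i (D i)" "f \<in> E" "wh f = wh e"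
  shows "f \<in> insert i (D i)"
proof -
  have "e \<in> E" using assms DE by blast
  then obtain k where "(\<alpha> ^^ k) e = f" using a_orb[of e f] assms(3,4) by auto
  then show ?thesis using funpow_closed[of "insert i (D i)" \<alpha> e k] D_a assms(1,2) by blast
qed

section \<open>Positions of the edges around a black vertex\<close>

definition idx :: "'e \<Rightarrow> nat" where "idx e = (LEAST k. (\<sigma> ^^ k) (spec (bl e)) = e)"

lemma idx: assumes "e \<in> E" shows "(\<sigma> ^^ idx e) (spec (bl e)) = e"
proof -
  obtain k where "(\<sigma> ^^ k) (spec (bl e)) = e"
    using s_orb[OF spec_E[OF assms] assms bl_spec[OF assms]] by blast
  then show ?thesis unfolding idx_def by (rule LeastI)
qed

lemma idx_le: "(\<sigma> ^^ k) (spec (bl e)) = e \<Longrightarrow> idx e \<le> k"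
  unfolding idx_def by (rule Least_le)

lemma idx_inj: "e \<in> E \<Longrightarrow> f \<in> E \<Longrightarrow> bl e = bl f \<Longrightarrow> idx e = idx f \<Longrightarrow> e = f"
  using idx by metis

lemma idx_spec: "e \<in> E \<Longrightarrow> idx (spec (bl e)) = 0"
  using idx_le[of 0 "spec (bl e)"] bl_spec by simp

lemma idx_s:
  assumes "e \<in> E" "\<sigma> e \<noteq> spec (bl e)"
  shows "idx (\<sigma> e) = Suc (idx e)"
proof (rule antisym)
  have "(\<sigma> ^^ Suc (idx e)) (spec (bl (\<sigma> e))) = \<sigma> e" using idx assms s_bl by simp
  then show "idx (\<sigma> e) \<le> Suc (idx e)" by (rule idx_le)
  have *: "(\<sigma> ^^ idx (\<sigma> e)) (spec (bl e)) = \<sigma> e" using idx[OF sE] assms s_bl by metis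
  with assms(2) obtain m where m: "idx (\<sigma> e) = Suc m" by (cases "idx (\<sigma> e)") auto
  have "(\<sigma> ^^ m) (spec (bl e)) \<in> E" using funpow_closed[of E \<sigma>, OF sE spec_E] assms(1) by blast
  then have "(\<sigma> ^^ m) (spec (bl e)) = e" using * m assms(1) inj_onD[OF s_inj] by simp
  then show "Suc (idx e) \<le> idx (\<sigma> e)" using idx_le m by simp
qed

text \<open>If \<open>\<sigma>\<close> leads from \<open>e\<close> to the special edge, the rotation
  closes up after \<open>Suc (idx e)\<close> steps, so a larger position could be reduced by this
  period.\<close>

lemma idx_last:
  assumes "e \<in> E" "\<sigma> e = spec (bl e)" "f \<in> E" "bl f = bl e"
  shows "idx f \<le> idx e"
proof (rule ccontr)
  assume "\<not> idx f \<le> idx e"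
  then obtain d where d: "idx f = d + Suc (idx e)" by (metis add.commute add_Suc_right less_iff_Suc_add not_le)
  have "(\<sigma> ^^ Suc (idx e)) (spec (bl e)) = spec (bl e)" using idx assms by simp
  then have "(\<sigma> ^^ idx f) (spec (bl e)) = (\<sigma> ^^ d) (spec (bl e))"
    unfolding d funpow_add by simp
  then have "(\<sigma> ^^ d) (spec (bl f)) = f" using idx[OF assms(3)] assms(4) by simp
  then have "idx f \<le> d" by (rule idx_le)
  with d show False by simp
qed

section \<open>The contour walk is a single cycle\<close>

definition \<theta> :: "'e \<Rightarrow> 'e" where "\<theta> e = \<sigma> (\<alpha> e)"

lemma tE: "e \<in> E \<Longrightarrow> \<theta> e \<in> E" by (simp add: \<theta>_def sE aE)

lemma t_inj: "inj_on \<theta> E"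
  unfolding \<theta>_def inj_on_def using inj_onD[OF s_inj] inj_onD[OF a_inj] aE by blast

text \<open>The contour runs around the branch behind \<open>i\<close> and comes back. From
  \<open>insert i (D i)\<close> a step of \<open>\<alpha>\<close> stays in this set, and if it lands
  on \<open>i\<close>, the following \<open>\<sigma>\<close> gives \<open>\<sigma> i\<close>. A walk
  that never meets \<open>\<sigma> i\<close> is therefore trapped in \<open>D i\<close> after its
  first step, whereas \<open>\<theta>\<close>, a permutation of a finite set, has to bring it back
  to \<open>i\<close>.\<close>

lemma t_reach_s:
  assumes i: "i \<in> E"
  shows "\<exists>k. (\<theta> ^^ k) i = \<sigma> i"
proof (rule ccontr)
  assume no: "\<nexists>k. (\<theta> ^^ k) i = \<sigma> i"
  have "(\<theta> ^^ Suc k) i \<in> D i" for k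
  proof (induction k)
    case 0
    have "\<alpha> i \<noteq> i" using no[simplified, rule_format, of 1] by (auto simp: \<theta>_def)
    then have "\<alpha> i \<in> D i" using D_a[OF i, of i] by simp
    then show ?case using D_s[OF i] by (simp add: \<theta>_def)
  next
    case (Suc k)
    let ?e = "(\<theta> ^^ Suc k) i"
    have "\<alpha> ?e \<noteq> i" using no[simplified, rule_format, of "Suc (Suc k)"] by (auto simp: \<theta>_def)
    then have "\<alpha> ?e \<in> D i" using D_a[OF i, of ?e] Suc.IH by blast
    then have "\<sigma> (\<alpha> ?e) \<in> D i" using D_s[OF i] by blast
    then show ?case by (metis \<theta>_def funpow.simps(2) o_apply)
  qed
  moreover obtain m where "m > 0" "(\<theta> ^^ m) i = i"
    using finite_inj_returns[OF fin t_inj tE i] by blast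
  ultimately have "i \<in> D i" by (metis Suc_pred)
  then show False using D_irrefl i by blast
qed

text \<open>The edges met by the walk form a set closed under \<open>\<sigma>\<close> by
  \<open>t_reach_s\<close>. It is closed under \<open>\<alpha>\<close> too: it contains
  \<open>\<sigma> (\<alpha> g)\<close>, and further turns at that black vertex arrive at
  \<open>\<alpha> g\<close>. Connectedness does the rest.\<close>

lemma t_transitive:
  assumes e: "e \<in> E" and f: "f \<in> E"
  shows "\<exists>k. (\<theta> ^^ k) e = f"
proof -
  define C where "C = {g. \<exists>k. (\<theta> ^^ k) e = g}"
  have CE: "C \<subseteq> E" unfolding C_def using funpow_closed[of E \<theta>, OF tE e] by blast
  have s: "\<sigma> g \<in> C" if g: "g \<in> C" for g
  proof -
    obtain k where k: "(\<theta> ^^ k) e = g" using g C_def by blast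
    obtain l where l: "(\<theta> ^^ l) g = \<sigma> g" using t_reach_s CE g by blast
    have "(\<theta> ^^ (l + k)) e = \<sigma> g" using k l by (simp add: funpow_add)
    then show ?thesis unfolding C_def by blast
  qed
  have a: "\<alpha> g \<in> C" if g: "g \<in> C" for g
  proof -
    have gE: "g \<in> E" using g CE by blast
    obtain k where k: "(\<theta> ^^ k) e = g" using g C_def by blast
    then have "(\<theta> ^^ Suc k) e = \<sigma> (\<alpha> g)" by (simp add: \<theta>_def)
    then have tg: "\<sigma> (\<alpha> g) \<in> C" unfolding C_def by blast
    obtain l where "(\<sigma> ^^ l) (\<sigma> (\<alpha> g)) = \<alpha> g"
      using s_orb[OF sE[OF aE[OF gE]] aE[OF gE] s_bl[OF aE[OF gE]]] by blast
    then show ?thesis using funpow_closed[of C \<sigma>, OF s tg, of l] by simp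
  qed
  have "e \<in> C" unfolding C_def by (auto intro: exI[of _ 0])
  then have "C = E" using conn[OF CE _ s a] by blast
  then show ?thesis using f C_def by blast
qed

text \<open>The number of steps still to go to the special edge of the root. It grows against the
  direction of \<open>\<theta>\<close>, so numbering by \<open>\<tau>\<close> starts at the root and
  runs backwards along the contour; this is the direction in which clockwise steps at a white vertex
  increase the labels.\<close>

definition \<tau> :: "'e \<Rightarrow> nat" where "\<tau> e = (LEAST k. (\<theta> ^^ k) e = s0)"

lemma \<tau>: "e \<in> E \<Longrightarrow> (\<theta> ^^ \<tau> e) e = s0"
  unfolding \<tau>_def using t_transitive[OF _ s0E] by (rule LeastI_ex)

lemma \<tau>_s0: "\<tau> s0 = 0"
  unfolding \<tau>_def by (rule Least_eq_0) simp

lemma \<tau>_t: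
  assumes "e \<in> E" "e \<noteq> s0"
  shows "\<tau> e = Suc (\<tau> (\<theta> e))"
proof -
  have "\<tau> e = Suc (LEAST k. (\<theta> ^^ Suc k) e = s0)"
    unfolding \<tau>_def by (rule Least_Suc[of _ "\<tau> e"]) (use \<tau> assms in auto)
  then show ?thesis unfolding \<tau>_def by (simp add: funpow_swap1)
qed

lemma \<tau>_inj:
  assumes "e \<in> E" "f \<in> E" "\<tau> e = \<tau> f"
  shows "e = f"
  using assms
proof (induction "\<tau> e" arbitrary: e f)
  case 0
  then show ?case using \<tau>[of e] \<tau>[of f] by simp
next
  case (Suc k)
  then have ne: "e \<noteq> s0" "f \<noteq> s0" using \<tau>_s0 by auto
  then have "\<tau> (\<theta> e) = k" "\<tau> (\<theta> e) = \<tau> (\<theta> f)" using \<tau>_t Suc by auto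
  then have "\<theta> e = \<theta> f" using Suc tE by blast
  then show ?case using inj_onD[OF t_inj] Suc by blast
qed

section \<open>The order of the edges\<close>

abbreviation sp :: "'e \<Rightarrow> 'e" where "sp e \<equiv> spec (bl e)"

text \<open>The lexicographic order by \<open>\<tau> (sp e)\<close> and then \<open>idx e\<close>,
  packed into one number: the factor exceeds every value of \<open>idx\<close>. The contour arrives
  at \<open>sp e\<close> through the corner in front of it, so the first component tells when the
  ray of the black vertex is met.\<close>

definition key :: "'e \<Rightarrow> nat" where "key e = \<tau> (sp e) * Suc (Max (idx ` E)) + idx e"

lemma sp_eq_iff: "e \<in> E \<Longrightarrow> f \<in> E \<Longrightarrow> sp e = sp f \<longleftrightarrow> bl e = bl f"
  using bl_spec by metis

lemma key_less:
  assumes "e \<in> E" "f \<in> E"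
  shows "key e < key f \<longleftrightarrow> \<tau> (sp e) < \<tau> (sp f) \<or> bl e = bl f \<and> idx e < idx f"
proof -
  let ?N = "Suc (Max (idx ` E))"
  have lt: "idx e < ?N" "idx f < ?N" using fin assms by (simp_all add: less_Suc_eq_le)
  have *: "a * ?N + i < b * ?N + j" if "a < b" "i < ?N" for a b i j
  proof -
    have "a * ?N + i < Suc a * ?N" using that(2) by simp
    also have "\<dots> \<le> b * ?N" using that(1) by (intro mult_right_mono) auto
    finally show ?thesis by simp
  qed
  have eq: "\<tau> (sp e) = \<tau> (sp f) \<longleftrightarrow> bl e = bl f"
    using \<tau>_inj[OF spec_E spec_E, OF assms] sp_eq_iff[OF assms] by auto
  consider "\<tau> (sp e) < \<tau> (sp f)" | "\<tau> (sp e) = \<tau> (sp f)" | "\<tau> (sp f) < \<tau> (sp e)" by linarith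
  then show ?thesis
  proof cases
    case 1 then show ?thesis using *[OF 1 lt(1)] by (simp add: key_def)
  next
    case 2 then show ?thesis using eq by (simp add: key_def)
  next
    case 3 then show ?thesis using *[OF 3 lt(2), of "idx e"] eq by (auto simp: key_def)
  qed
qed

lemma key_inj: assumes "e \<in> E" "f \<in> E" "key e = key f" shows "e = f"
proof -
  have "\<not> key e < key f" "\<not> key f < key e" using assms(3) by auto
  then have "\<tau> (sp e) = \<tau> (sp f)" and n: "\<not> (bl e = bl f \<and> idx e < idx f)" "\<not> (bl f = bl e \<and> idx f < idx e)"
    unfolding key_less[OF assms(1,2)] key_less[OF assms(2,1)] by auto
  then have "bl e = bl f" using \<tau>_inj[OF spec_E spec_E, OF assms(1,2)] sp_eq_iff[OF assms(1,2)] by auto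
  then show ?thesis using n idx_inj[OF assms(1,2)] by (metis linorder_neqE_nat)
qed

text \<open>The open cyclic interval from \<open>x\<close> to \<open>y\<close>; unless
  \<open>key x < key y\<close>, it wraps around the end of the order.\<close>

definition between :: "'e \<Rightarrow> 'e \<Rightarrow> 'e \<Rightarrow> bool" where
  "between x y e \<longleftrightarrow> (if key x < key y then key x < key e \<and> key e < key y
     else key e < key y \<or> key x < key e)"

text \<open>
  Let \<open>p\<close> and \<open>q\<close> be the special edges at the black ends of \<open>x = \<alpha> y\<close> and of \<open>y\<close>.  The contour
  from \<open>p\<close> to \<open>q\<close> consists of \<open>y\<close> and the set \<open>F\<close> of the branches \<open>insert i (D i)\<close>, where \<open>i\<close>
  comes after \<open>x\<close> or before \<open>y\<close> in its block.  So \<open>F\<close> is what the labels put cyclically between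
  \<open>x\<close> and \<open>y\<close>, and each branch is a union of white blocks.
\<close>

lemma between_closed:
  assumes y: "y \<in> E" and x: "x = \<alpha> y" and ne: "x \<noteq> y" and e: "e \<in> E" "f \<in> E" "wh f = wh e"
    and btw: "between x y e"
  shows "between x y f"
proof -
  have xE: "x \<in> E" using x y aE by simp
  have wxy: "wh x = wh y" using x y a_wh by simp
  \<comment> \<open>With two common ends \<open>x\<close> and \<open>y\<close> would form a cycle:
    the white end puts \<open>y\<close> into the branch \<open>D x\<close>, and the black end then
    puts \<open>x\<close> there as well.\<close>
  have bne: "bl x \<noteq> bl y"
  proof
    assume b: "bl x = bl y"
    have "y \<in> D x" using K_wh[OF xE, of x y] y wxy ne by auto
    then have "x \<in> D x" using D_bl[OF xE, of y x] xE b by simp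
    then show False using D_irrefl xE by blast
  qed
  define I where "I = {i\<in>E. bl i = bl x \<and> idx x < idx i} \<union> {i\<in>E. bl i = bl y \<and> idx i < idx y}"
  define F where "F = (\<Union>i\<in>I. insert i (D i))"
  define M where "M = (\<Union>i\<in>I. D i)"
  have IE: "I \<subseteq> E" by (auto simp: I_def)
  \<comment> \<open>A branch that returned to the black end of \<open>x\<close> or \<open>y\<close>
    could pass through the white vertex shared by \<open>x\<close> and \<open>y\<close> if
    necessary, and would contain its own root edge \<open>i\<close>.\<close>
  have D_xy: "bl g \<noteq> bl x \<and> bl g \<noteq> bl y" if "i \<in> I" "g \<in> D i" for i g
  proof -
    have iE: "i \<in> E" and gE: "g \<in> E" using that IE DE by auto
    have own: "bl g \<noteq> bl i" using D_bl[OF iE that(2) iE] D_irrefl[OF iE] by auto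
    from that(1) consider "bl i = bl x" "idx x < idx i" | "bl i = bl y" "idx i < idx y"
      by (auto simp: I_def)
    then show ?thesis
    proof cases
      case 1
      have "bl g \<noteq> bl y"
      proof
        assume "bl g = bl y"
        then have "y \<in> D i" using D_bl[OF iE that(2) y] by simp
        then have "x \<in> insert i (D i)" using K_wh[OF iE _ xE wxy] by simp
        then have "x \<in> D i" using 1 by auto
        then show False using D_bl[OF iE _ iE 1(1)] D_irrefl[OF iE] by blast
      qed
      then show ?thesis using own 1 by simp
    next
      case 2
      have "bl g \<noteq> bl x"
      proof
        assume "bl g = bl x"
        then have "x \<in> D i" using D_bl[OF iE that(2) xE] by simp
        then have "y \<in> insert i (D i)" using K_wh[OF iE _ y wxy[symmetric]] by simp
        then have "y \<in> D i" using 2 by auto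
        then show False using D_bl[OF iE _ iE 2(1)] D_irrefl[OF iE] by blast
      qed
      then show ?thesis using own 2 by simp
    qed
  qed
  have M_bl: "h \<in> M" if "g \<in> M" "h \<in> E" "bl h = bl g" for g h
    using that D_bl IE unfolding M_def by blast
  have F_wh: "h \<in> F" if "g \<in> F" "h \<in> E" "wh h = wh g" for g h
    using that K_wh IE unfolding F_def by blast
  have F_x: "g \<in> F \<longleftrightarrow> idx x < idx g" if "g \<in> E" "bl g = bl x" for g
  proof -
    have "g \<in> F \<longleftrightarrow> g \<in> I" using D_xy[of _ g] that unfolding F_def by blast
    also have "\<dots> \<longleftrightarrow> idx x < idx g" using that bne by (auto simp: I_def)
    finally show ?thesis .
  qed
  have F_y: "g \<in> F \<longleftrightarrow> idx g < idx y" if "g \<in> E" "bl g = bl y" for g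
  proof -
    have "g \<in> F \<longleftrightarrow> g \<in> I" using D_xy[of _ g] that unfolding F_def by blast
    also have "\<dots> \<longleftrightarrow> idx g < idx y" using that bne by (auto simp: I_def)
    finally show ?thesis .
  qed
  have F_M: "g \<in> F \<longleftrightarrow> g \<in> M" if "bl g \<noteq> bl x" "bl g \<noteq> bl y" for g
  proof -
    have "g \<notin> I" using that by (auto simp: I_def)
    then show ?thesis unfolding F_def M_def by blast
  qed
  let ?p = "sp x" and ?q = "sp y"
  have pE: "?p \<in> E" and qE: "?q \<in> E" and blp: "bl ?p = bl x" and blq: "bl ?q = bl y"
    using spec_E bl_spec xE y by auto
  have pq: "?p \<noteq> ?q" using blp blq bne by metis
  \<comment> \<open>In walking direction, \<open>F\<close> together with \<open>y\<close> is entered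
    on arrival at \<open>?q\<close> and left on arrival at \<open>?p\<close>, and membership changes
    nowhere else. The passage between the two black vertices is at \<open>g = y\<close>, where
    \<open>\<alpha> g = x\<close>.\<close>
  have step: "(\<theta> g \<noteq> ?p \<longrightarrow> \<theta> g \<noteq> ?q \<longrightarrow> (\<theta> g \<in> F \<or> \<theta> g = y \<longleftrightarrow> g \<in> F \<or> g = y)) \<and>
      (\<theta> g = ?p \<longrightarrow> g \<in> F \<or> g = y) \<and> (\<theta> g = ?q \<longrightarrow> \<not> (g \<in> F \<or> g = y))" if g: "g \<in> E" for g
  proof -
    let ?z = "\<alpha> g"
    have z: "?z \<in> E" "\<sigma> ?z \<in> E" "bl (\<sigma> ?z) = bl ?z" "wh ?z = wh g" "\<theta> g = \<sigma> ?z"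
      using g aE sE s_bl a_wh by (auto simp: \<theta>_def)
    have gz: "g \<in> F \<longleftrightarrow> ?z \<in> F" "g = y \<longleftrightarrow> ?z = x"
      using F_wh[of g ?z] F_wh[of ?z g] z g x y inj_onD[OF a_inj] by auto
    consider "bl ?z = bl x" | "bl ?z = bl y" | "bl ?z \<noteq> bl x" "bl ?z \<noteq> bl y" by blast
    then show ?thesis
    proof cases
      case 1
      have nx: "?z = x \<longleftrightarrow> idx ?z = idx x" using idx_inj[OF z(1) xE 1] by auto
      have neq: "\<sigma> ?z \<noteq> ?q" "\<sigma> ?z \<noteq> y" using 1 z(3) blq bne by metis+
      show ?thesis
      proof (cases "\<sigma> ?z = ?p")
        case True
        then have "idx x \<le> idx ?z" using idx_last[OF z(1) _ xE 1[symmetric]] unfolding 1 by blast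
        then have "?z \<in> F \<or> ?z = x" using F_x[OF z(1) 1] nx by (metis le_neq_implies_less)
        then show ?thesis using True neq gz z(5) pq by simp
      next
        case False
        then have "idx (\<sigma> ?z) = Suc (idx ?z)" using idx_s[OF z(1)] 1 by simp
        then have "\<sigma> ?z \<in> F \<longleftrightarrow> ?z \<in> F \<or> ?z = x"
          using F_x[OF z(1) 1] F_x[OF z(2)] 1 nx z(3) by auto
        then show ?thesis using False neq gz z(5) by simp
      qed
    next
      case 2
      have ny: "\<sigma> ?z = y \<longleftrightarrow> idx (\<sigma> ?z) = idx y" using idx_inj[OF z(2) y] 2 z(3) by auto
      have neq: "\<sigma> ?z \<noteq> ?p" "?z \<noteq> x" using 2 z(3) blp bne by metis+
      show ?thesis
      proof (cases "\<sigma> ?z = ?q")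
        case True
        then have "idx y \<le> idx ?z" using idx_last[OF z(1) _ y 2[symmetric]] unfolding 2 by blast
        then have "?z \<notin> F" using F_y[OF z(1) 2] by simp
        then show ?thesis using True neq gz z(5) pq by simp
      next
        case False
        then have "idx (\<sigma> ?z) = Suc (idx ?z)" using idx_s[OF z(1)] 2 by simp
        then have "\<sigma> ?z \<in> F \<or> \<sigma> ?z = y \<longleftrightarrow> ?z \<in> F"
          using F_y[OF z(1) 2] F_y[OF z(2)] 2 ny z(3) by auto
        then show ?thesis using False neq gz z(5) by simp
      qed
    next
      case 3
      have "\<sigma> ?z \<noteq> ?p" "\<sigma> ?z \<noteq> ?q" "\<sigma> ?z \<noteq> y" "?z \<noteq> x" using 3 z(3) blp blq by metis+
      moreover have "\<sigma> ?z \<in> F \<longleftrightarrow> ?z \<in> F"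
        using F_M[of ?z] F_M[of "\<sigma> ?z"] M_bl[of ?z "\<sigma> ?z"] M_bl[of "\<sigma> ?z" ?z] 3 z(1-3) by metis
      ultimately show ?thesis using gz z(5) by simp
    qed
  qed
  \<comment> \<open>Membership as an integer, so that leaving and entering can be counted with
    opposite signs.\<close>
  let ?m = "\<lambda>g. of_bool (g \<in> F \<or> g = y) :: int"
  \<comment> \<open>Induction on the distance to \<open>s0\<close>, that is, against the walk:
    crossing \<open>?p\<close> adds 1 and crossing \<open>?q\<close> subtracts 1.\<close>
  have count: "?m g = ?m s0 + of_bool (\<tau> ?p < \<tau> g) - of_bool (\<tau> ?q < \<tau> g)" if "g \<in> E" for g
    using that
  proof (induction "\<tau> g" arbitrary: g)
    case 0
    then have "g = s0" using \<tau>[of g] by simp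
    then show ?case using \<tau>_s0 by simp
  next
    case (Suc k)
    have "g \<noteq> s0" using Suc.hyps(2) \<tau>_s0 by auto
    then have t: "\<tau> g = Suc (\<tau> (\<theta> g))" using \<tau>_t Suc.prems by blast
    have tg: "\<theta> g \<in> E" using tE Suc.prems by blast
    have IH: "?m (\<theta> g) = ?m s0 + of_bool (\<tau> ?p < \<tau> (\<theta> g)) - of_bool (\<tau> ?q < \<tau> (\<theta> g))"
      using Suc.hyps(1)[of "\<theta> g"] t Suc.hyps(2) tg by simp
    have eq: "\<tau> ?p = \<tau> (\<theta> g) \<longleftrightarrow> \<theta> g = ?p" "\<tau> ?q = \<tau> (\<theta> g) \<longleftrightarrow> \<theta> g = ?q"
      using \<tau>_inj[OF pE tg] \<tau>_inj[OF qE tg] by auto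
    have lt: "\<tau> ?p < \<tau> g \<longleftrightarrow> \<tau> ?p < \<tau> (\<theta> g) \<or> \<theta> g = ?p" "\<tau> ?q < \<tau> g \<longleftrightarrow> \<tau> ?q < \<tau> (\<theta> g) \<or> \<theta> g = ?q"
      unfolding t less_Suc_eq eq by (rule refl)+
    have pm: "\<not> (?p \<in> F \<or> ?p = y)" using F_x[OF pE blp] idx_spec[OF xE] blp bne by auto
    have qm: "?q \<in> F \<or> ?q = y"
      using F_y[OF qE blq] idx_spec[OF y] idx_inj[OF qE y blq] by auto
    consider "\<theta> g = ?p" | "\<theta> g = ?q" | "\<theta> g \<noteq> ?p" "\<theta> g \<noteq> ?q" by blast
    then show ?case
    proof cases
      case 1
      then show ?thesis using IH step[OF Suc.prems] pm lt pq by simp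
    next
      case 2
      then show ?thesis using IH step[OF Suc.prems] qm lt pq by simp
    next
      case 3
      then show ?thesis using IH step[OF Suc.prems] lt by simp
    qed
  qed
  have pm: "?m ?p = 0" using F_x[OF pE blp] idx_spec[OF xE] blp bne by auto
  \<comment> \<open>The starting value is still unknown; evaluating \<open>count\<close> at
    \<open>?p\<close>, which lies outside, determines it.\<close>
  have m0: "?m s0 = of_bool (\<tau> ?q < \<tau> ?p)" using count[OF pE] pm by simp
  have tpq: "\<tau> ?p \<noteq> \<tau> ?q" using pq \<tau>_inj pE qE by blast
  have F_btw: "g \<in> F \<longleftrightarrow> between x y g" if g: "g \<in> E" for g
  proof -
    note kl = key_less[OF xE g] key_less[OF g y] key_less[OF xE y]
    consider "bl g = bl x" | "bl g = bl y" | "bl g \<noteq> bl x" "bl g \<noteq> bl y" by blast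
    then show ?thesis
    proof cases
      case 1
      then show ?thesis using F_x[OF g 1] bne tpq unfolding between_def kl by auto
    next
      case 2
      then show ?thesis using F_y[OF g 2] bne tpq unfolding between_def kl by auto
    next
      case 3
      have spg: "sp g \<in> E" "bl (sp g) = bl g" using spec_E bl_spec g by auto
      have ne: "sp g \<noteq> ?p" "sp g \<noteq> ?q" "sp g \<noteq> y" using 3 spg blp blq by metis+
      have tne: "\<tau> (sp g) \<noteq> \<tau> ?p" "\<tau> (sp g) \<noteq> \<tau> ?q" using ne \<tau>_inj spg pE qE by blast+
      \<comment> \<open>Away from the black ends of \<open>x\<close> and \<open>y\<close>, the set
        \<open>F\<close> consists of full black vertices. So membership can be tested at the special
        edge, where \<open>count\<close> compares exactly the leading components of the
        keys.\<close>
      have "g \<in> F \<longleftrightarrow> sp g \<in> F"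
        using F_M[of g] F_M[of "sp g"] M_bl[of g "sp g"] M_bl[of "sp g" g] 3 spg g by auto
      also have "\<dots> \<longleftrightarrow> ?m (sp g) = 1" using ne by auto
      also have "\<dots> \<longleftrightarrow> between x y g"
        unfolding count[OF spg(1)] m0 between_def kl using 3 tne bne tpq by auto
      finally show ?thesis .
    qed
  qed
  show ?thesis using F_btw F_wh e btw by blast
qed

end

lemma partition_on_fibres:
  assumes "bij_betw l E X"
  shows "partition_on X ((\<lambda>e. l ` {f\<in>E. h f = h e}) ` E)"
proof (rule partition_onI)
  show "\<Union> ((\<lambda>e. l ` {f\<in>E. h f = h e}) ` E) = X"
    using bij_betw_imp_surj_on[OF assms] by blast
  show "{} \<notin> (\<lambda>e. l ` {f\<in>E. h f = h e}) ` E" by blast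
  fix p q
  assume *: "p \<in> (\<lambda>e. l ` {f\<in>E. h f = h e}) ` E" "q \<in> (\<lambda>e. l ` {f\<in>E. h f = h e}) ` E" "p \<noteq> q"
  then obtain e e' where e: "p = l ` {f\<in>E. h f = h e}" "q = l ` {f\<in>E. h f = h e'}" by blast
  then have "h e \<noteq> h e'" using *(3) by metis
  then have "{f\<in>E. h f = h e} \<inter> {f\<in>E. h f = h e'} = {}" by auto
  then show "disjnt p q"
    unfolding e disjnt_def
    using inj_on_image_Int[OF bij_betw_imp_inj_on[OF assms], of "{f\<in>E. h f = h e}" "{f\<in>E. h f = h e'}"]
    by auto
qed

lemma next_in_eqI:
  assumes "finite S" "j \<in> S" "i < j" "\<And>k. k \<in> S \<Longrightarrow> i < k \<Longrightarrow> j \<le> k"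
  shows "next_in S i = j"
proof -
  have "Min {k\<in>S. i < k} = j" by (rule Min_eqI) (use assms in auto)
  moreover have "\<exists>k\<in>S. i < k" using assms by blast
  ultimately show ?thesis by (simp add: next_in_def)
qed

lemma next_in_last:
  assumes "\<And>k. k \<in> S \<Longrightarrow> k \<le> i"
  shows "next_in S i = Min S"
proof -
  have "\<not> (\<exists>k\<in>S. i < k)" using assms by (meson leD)
  then show ?thesis by (simp add: next_in_def)
qed

lemma prev_in_eqI:
  assumes "finite S" "j \<in> S" "j < i" "\<And>k. k \<in> S \<Longrightarrow> k < i \<Longrightarrow> k \<le> j"
  shows "prev_in S i = j"
proof -
  have "Max {k\<in>S. k < i} = j" by (rule Max_eqI) (use assms in auto)
  moreover have "\<exists>k\<in>S. k < i" using assms by blast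
  ultimately show ?thesis by (simp add: prev_in_def)
qed

lemma prev_in_first:
  assumes "\<And>k. k \<in> S \<Longrightarrow> i \<le> k"
  shows "prev_in S i = Max S"
proof -
  have "\<not> (\<exists>k\<in>S. k < i)" using assms by (meson leD)
  then show ?thesis by (simp add: prev_in_def)
qed

section \<open>The labels and the two partitions they define\<close>

context marked_tree_edges
begin

definition label :: "'e \<Rightarrow> nat" where "label e = card {f\<in>E. key f \<le> key e}"

lemma label_mono:
  assumes "e \<in> E" "f \<in> E" "key e < key f"
  shows "label e < label f"
  unfolding label_def
proof (rule psubset_card_mono)
  have "f \<notin> {g\<in>E. key g \<le> key e}" "f \<in> {g\<in>E. key g \<le> key f}" using assms by auto
  moreover have "{g\<in>E. key g \<le> key e} \<subseteq> {g\<in>E. key g \<le> key f}" using assms(3) by auto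
  ultimately show "{g\<in>E. key g \<le> key e} \<subset> {g\<in>E. key g \<le> key f}" by blast
qed (use fin in simp)

lemma label_less:
  assumes "e \<in> E" "f \<in> E"
  shows "label e < label f \<longleftrightarrow> key e < key f"
proof (cases "key e" "key f" rule: linorder_cases)
  case equal
  then show ?thesis using key_inj[OF assms] by simp
next
  case greater
  then show ?thesis using label_mono[OF assms(2,1)] by simp
qed (use label_mono[OF assms] in simp)

lemma label_le: "e \<in> E \<Longrightarrow> f \<in> E \<Longrightarrow> label e \<le> label f \<longleftrightarrow> key e \<le> key f"
  using label_less[of f e] by (simp add: not_less[symmetric])

lemma label_inj: "inj_on label E"
proof (rule inj_onI)
  fix e f assume ef: "e \<in> E" "f \<in> E" "label e = label f"
  then have "\<not> key e < key f" "\<not> key f < key e" using label_mono[of e f] label_mono[of f e] by auto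
  then show "e = f" using key_inj ef by simp
qed

lemma label_bij: "bij_betw label E {1..card E}"
proof -
  have "label ` E \<subseteq> {1..card E}"
  proof
    fix k assume "k \<in> label ` E"
    then obtain e where e: "e \<in> E" "k = label e" by blast
    then have "card {e} \<le> k" "k \<le> card E"
      unfolding label_def by (simp_all only:) (rule card_mono; use fin e in auto)+
    then show "k \<in> {1..card E}" by simp
  qed
  moreover have "card (label ` E) = card {1..card E}" using card_image[OF label_inj] by simp
  ultimately have "label ` E = {1..card E}" by (intro card_subset_eq) auto
  then show ?thesis using label_inj by (simp add: bij_betw_def)
qed

abbreviation bblock :: "'e \<Rightarrow> 'e set" where "bblock e \<equiv> {f\<in>E. bl f = bl e}"
abbreviation wblock :: "'e \<Rightarrow> 'e set" where "wblock e \<equiv> {f\<in>E. wh f = wh e}"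

definition black_partition :: "nat set set" where "black_partition = (\<lambda>e. label ` bblock e) ` E"
definition white_partition :: "nat set set" where "white_partition = (\<lambda>e. label ` wblock e) ` E"

lemma partition_on_black_partition: "partition_on {1..card E} black_partition"
  unfolding black_partition_def by (rule partition_on_fibres[OF label_bij])

lemma partition_on_white_partition: "partition_on {1..card E} white_partition"
  unfolding white_partition_def by (rule partition_on_fibres[OF label_bij])

lemma label_spec_le: "e \<in> E \<Longrightarrow> label (sp e) \<le> label e"
  using label_less[of e "sp e"] key_less[of e "sp e"] spec_E idx_spec bl_spec by (metis less_irrefl not_less not_less_zero)

lemma Min_bblock: assumes "e \<in> E" shows "Min (label ` bblock e) = label (sp e)"
proof (rule Min_eqI)
  show "finite (label ` bblock e)" using fin by simp
  show "label (sp e) \<in> label ` bblock e" using spec_E bl_spec assms by blast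
  fix k assume "k \<in> label ` bblock e"
  then obtain f where "f \<in> E" "bl f = bl e" "k = label f" by blast
  then show "label (sp e) \<le> k" using label_spec_le[of f] by simp
qed

lemma next_in_bblock:
  assumes e: "e \<in> E"
  shows "next_in (label ` bblock e) (label e) = label (\<sigma> e)"
proof (cases "\<sigma> e = sp e")
  case True
  have "next_in (label ` bblock e) (label e) = Min (label ` bblock e)"
  proof (rule next_in_last)
    fix k assume "k \<in> label ` bblock e"
    then obtain f where f: "f \<in> E" "bl f = bl e" "k = label f" by blast
    then show "k \<le> label e"
      using idx_last[OF e True] label_less[OF e f(1)] key_less[OF e f(1)] by (metis less_irrefl not_less)
  qed
  then show ?thesis using Min_bblock[OF e] True by simp
next
  case False
  have i: "idx (\<sigma> e) = Suc (idx e)" using idx_s[OF e False] .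
  show ?thesis
  proof (rule next_in_eqI)
    show "finite (label ` bblock e)" using fin by simp
    show "label (\<sigma> e) \<in> label ` bblock e" using sE s_bl e by blast
    show "label e < label (\<sigma> e)"
      using label_less[OF e sE[OF e]] key_less[OF e sE[OF e]] i s_bl[OF e] by simp
    fix k assume "k \<in> label ` bblock e" "label e < k"
    then obtain f where f: "f \<in> E" "bl f = bl e" "k = label f" "key e < key f"
      using label_less[OF e] by blast
    then have "idx e < idx f" using key_less[OF e f(1)] by auto
    then have "\<not> key f < key (\<sigma> e)" using key_less[OF f(1) sE[OF e]] i f(2) s_bl[OF e] by auto
    then show "label (\<sigma> e) \<le> k" using label_le[OF sE[OF e] f(1)] f(3) by simp
  qed
qed

lemma label_s0: "label s0 = 1"
proof -
  have "{f\<in>E. key f \<le> key s0} = {s0}"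
  proof (intro set_eqI iffI)
    fix f assume "f \<in> {f\<in>E. key f \<le> key s0}"
    then have "f \<in> E" "key f \<le> key s0" by auto
    moreover have "key s0 = 0" using idx_spec[OF s0E] \<tau>_s0 s0_spec by (simp add: key_def)
    ultimately show "f \<in> {s0}" using key_inj[of f s0] s0E by simp
  qed (use s0E in simp)
  then show ?thesis by (simp add: label_def)
qed

text \<open>All edges of a black vertex share the leading component of \<open>key\<close>, so an
  edge squeezed between two of them has this component too, and \<open>\<tau>\<close> is
  injective.\<close>

lemma bblock_convex:
  assumes "e \<in> E" "f \<in> E" "g \<in> E" "bl g = bl e" "label e \<le> label f" "label f \<le> label g"
  shows "bl f = bl e"
proof -
  have "\<tau> (sp e) \<le> \<tau> (sp f)"
    using assms(5) label_le[OF assms(1,2)] key_less[OF assms(2,1)] by (meson not_less)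
  moreover have "\<tau> (sp f) \<le> \<tau> (sp e)"
    using assms(4,6) label_le[OF assms(2,3)] key_less[OF assms(3,2)] by (metis not_less)
  ultimately have "sp e = sp f" using \<tau>_inj spec_E assms(1,2) by (metis antisym)
  then show ?thesis using sp_eq_iff assms by metis
qed

lemma black_partition_Interval: "black_partition \<in> Interval_partitions (card E)"
proof -
  have int: "label ` bblock e = {Min (label ` bblock e)..Max (label ` bblock e)}" if e: "e \<in> E" for e
  proof
    let ?S = "label ` bblock e"
    have fS: "finite ?S" and nS: "?S \<noteq> {}" using fin e by auto
    show "?S \<subseteq> {Min ?S..Max ?S}" using fS by auto
    show "{Min ?S..Max ?S} \<subseteq> ?S"
    proof
      fix k assume k: "k \<in> {Min ?S..Max ?S}"
      obtain f where f: "f \<in> E" "bl f = bl e" "Min ?S = label f" using Min_in[OF fS nS] by blast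
      obtain g where g: "g \<in> E" "bl g = bl e" "Max ?S = label g" using Max_in[OF fS nS] by blast
      have "label f \<in> {1..card E}" "label g \<in> {1..card E}" using f(1) g(1) bij_betwE[OF label_bij] by auto
      then have "k \<in> {1..card E}" using k f(3) g(3) by auto
      then obtain h where h: "h \<in> E" "k = label h" using label_bij by (metis bij_betw_imp_surj_on imageE)
      then have "bl h = bl f" using bblock_convex[OF f(1) h(1) g(1)] f g k by simp
      then show "k \<in> ?S" using h f(2) by auto
    qed
  qed
  have "noncrossing black_partition" unfolding noncrossing_def
  proof (clarify)
    fix V W a b c d
    assume *: "V \<in> black_partition" "W \<in> black_partition" "V \<noteq> W" "a < b" "b < c" "a \<in> V" "c \<in> V" "b \<in> W"
    obtain e where "e \<in> E" "V = label ` bblock e" using *(1) unfolding black_partition_def by blast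
    then have "V = {Min V..Max V}" using int by simp
    moreover have "a \<in> {Min V..Max V}" "c \<in> {Min V..Max V}" using *(6,7) calculation by blast+
    then have "b \<in> {Min V..Max V}" using *(4,5) by simp
    ultimately have "b \<in> V" by blast
    then show False using disjointD[OF partition_onD2[OF partition_on_black_partition] *(1-3)] *(8) by blast
  qed
  then have "black_partition \<in> NC (card E)" using partition_on_black_partition by (simp add: NC_def)
  moreover have "\<forall>V\<in>black_partition. \<exists>p q. V = {p..q}" using int unfolding black_partition_def by blast
  ultimately show ?thesis by (simp add: Interval_partitions_def)
qed

text \<open>By \<open>between_closed\<close> the open interval would contain every edge at this
  white vertex, among them its own end points.\<close>

lemma not_between_white:
  assumes "y \<in> E" "\<alpha> y \<noteq> y" "f \<in> E" "wh f = wh y"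
  shows "\<not> between (\<alpha> y) y f"
proof
  assume "between (\<alpha> y) y f"
  then have "between (\<alpha> y) y y"
    using between_closed[OF assms(1) refl assms(2,3) assms(1)] assms(4) by simp
  moreover have "between (\<alpha> y) y (\<alpha> y)"
    using between_closed[OF assms(1) refl assms(2,3) aE[OF assms(1)]] assms(4) a_wh[OF assms(1)]
      \<open>between (\<alpha> y) y f\<close> by simp
  moreover have "key y \<noteq> key (\<alpha> y)" using key_inj[OF assms(1) aE[OF assms(1)]] assms(2) by metis
  ultimately show False by (auto simp: between_def split: if_splits)
qed

lemma white_fixed:
  assumes "y \<in> E" "\<alpha> y = y" "f \<in> E" "wh f = wh y"
  shows "f = y"
proof -
  obtain k where "(\<alpha> ^^ k) y = f" using a_orb[OF assms(1,3)] assms(4) by auto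
  moreover have "(\<alpha> ^^ k) y = y" by (induction k) (use assms(2) in auto)
  ultimately show ?thesis by simp
qed

text \<open>By \<open>not_between_white\<close> there are two possibilities:
  \<open>\<alpha> y\<close> directly precedes \<open>y\<close> among the edges of the white vertex,
  or the interval wraps around and \<open>y\<close> is the first and \<open>\<alpha> y\<close> the
  last of them.\<close>

lemma prev_in_wblock:
  assumes y: "y \<in> E"
  shows "prev_in (label ` wblock y) (label y) = label (\<alpha> y)"
proof (cases "\<alpha> y = y")
  case True
  have "wblock y = {y}" using white_fixed[OF y True] y by blast
  then show ?thesis using True by (simp add: prev_in_def)
next
  case False
  let ?x = "\<alpha> y"
  have x: "?x \<in> E" "wh ?x = wh y" using aE a_wh y by auto
  have fS: "finite (label ` wblock y)" using fin by simp
  have xS: "label ?x \<in> label ` wblock y" using x by blast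
  have ne: "key ?x \<noteq> key y" using key_inj[OF x(1) y] False by metis
  show ?thesis
  proof (cases "key ?x < key y")
    case True
    show ?thesis
    proof (rule prev_in_eqI[OF fS xS])
      show "label ?x < label y" using label_less[OF x(1) y] True by simp
      fix k assume "k \<in> label ` wblock y" "k < label y"
      then obtain f where f: "f \<in> E" "wh f = wh y" "k = label f" "key f < key y"
        using label_less[OF _ y] by blast
      then have "\<not> key ?x < key f" using not_between_white[OF y False f(1,2)] True by (auto simp: between_def)
      then show "k \<le> label ?x" using label_le[OF f(1) x(1)] f(3) by simp
    qed
  next
    case less: False
    have nb: "key y \<le> key f \<and> key f \<le> key ?x" if "f \<in> E" "wh f = wh y" for f
      using not_between_white[OF y False that] less by (auto simp: between_def)
    have "prev_in (label ` wblock y) (label y) = Max (label ` wblock y)"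
    proof (rule prev_in_first)
      fix k assume "k \<in> label ` wblock y"
      then show "label y \<le> k" using nb label_le[OF y] by blast
    qed
    also have "\<dots> = label ?x"
    proof (rule Max_eqI[OF fS _ xS])
      fix k assume "k \<in> label ` wblock y"
      then show "k \<le> label ?x" using nb label_le[OF _ x(1)] by blast
    qed
    finally show ?thesis .
  qed
qed

text \<open>Let \<open>y\<close> be the first edge of the block of \<open>a'\<close> after
  \<open>b'\<close>. Its predecessor \<open>\<alpha> y\<close> in that block comes before
  \<open>b'\<close>, so \<open>b'\<close> lies between the two, and by \<open>between_closed\<close>
  so does \<open>d'\<close>. Then \<open>d'\<close> comes before \<open>y\<close> and hence before
  \<open>c'\<close>.\<close>

lemma white_partition_noncrossing: "noncrossing white_partition"
  unfolding noncrossing_def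
proof (clarify)
  fix V W a b c d
  assume *: "V \<in> white_partition" "W \<in> white_partition" "V \<noteq> W" "a < b" "b < c" "c < d" "a \<in> V" "c \<in> V" "b \<in> W" "d \<in> W"
  obtain v w where v: "v \<in> E" "V = label ` wblock v" and w: "w \<in> E" "W = label ` wblock w"
    using *(1,2) unfolding white_partition_def by blast
  have vw: "wh v \<noteq> wh w" using v w *(3) by metis
  obtain a' c' where a': "a' \<in> E" "wh a' = wh v" "a = label a'" and c': "c' \<in> E" "wh c' = wh v" "c = label c'"
    using *(7,8) v(2) by blast
  obtain b' d' where b': "b' \<in> E" "wh b' = wh w" "b = label b'" and d': "d' \<in> E" "wh d' = wh w" "d = label d'"
    using *(9,10) w(2) by blast
  have ord: "key a' < key b'" "key b' < key c'" "key c' < key d'"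
    using *(4-6) a'(1,3) b'(1,3) c'(1,3) d'(1,3) label_less by metis+
  define y where "y = arg_min key (\<lambda>f. f \<in> E \<and> wh f = wh v \<and> key b' < key f)"
  have "y \<in> E \<and> wh y = wh v \<and> key b' < key y"
    unfolding y_def by (rule arg_min_natI[of _ c']) (use c' ord in simp)
  then have y: "y \<in> E" "wh y = wh v" "key b' < key y" by auto
  have ymin: "key y \<le> key f" if "f \<in> E" "wh f = wh v" "key b' < key f" for f
    unfolding y_def by (rule arg_min_nat_le) (use that in simp)
  let ?x = "\<alpha> y"
  have x: "?x \<in> E" "wh ?x = wh v" using aE a_wh y by auto
  have ne: "?x \<noteq> y" using white_fixed[OF y(1) _ a'(1)] a'(2) y(2,3) ord(1) by auto
  have "key ?x < key y"
    using not_between_white[OF y(1) ne a'(1)] a'(2) y(2,3) ord(1)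
    by (auto simp: between_def split: if_splits)
  moreover have "key ?x \<noteq> key b'" using key_inj[OF x(1) b'(1)] x(2) b'(2) vw by metis
  ultimately have "key ?x < key b'" using ymin[OF x] by (meson leD linorder_neqE_nat)
  then have "between ?x y b'" using \<open>key ?x < key y\<close> y(3) by (simp add: between_def)
  then have "between ?x y d'"
    using between_closed[OF y(1) refl ne b'(1) d'(1)] b'(2) d'(2) by simp
  then have "key d' < key y" using \<open>key ?x < key y\<close> by (simp add: between_def)
  moreover have "key y \<le> key c'" using ymin c' ord by simp
  ultimately show False using ord by simp
qed

lemma white_partition_NC: "white_partition \<in> NC (card E)"
  using partition_on_white_partition white_partition_noncrossing by (simp add: NC_def)

end

subsection \<open>The graph of a shallow meander is a tree\<close>

lemma equiv_cl_map:
  assumes "(x, y) \<in> equiv_cl r" and "\<And>u v. (u, v) \<in> r \<Longrightarrow> (h u, h v) \<in> equiv_cl s"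
  shows "(h x, h y) \<in> equiv_cl s"
  using assms(1) unfolding equiv_cl_def[of r]
proof (induction rule: rtrancl_induct)
  case (step u v)
  then have "(h u, h v) \<in> equiv_cl s"
    using assms(2)[of u v] assms(2)[of v u] equiv_cl_commute[of "h u" "h v" s] by blast
  with step.IH show ?case by (rule equiv_cl_trans)
qed simp

lemma block_of_eq: "partition_on A P \<Longrightarrow> V \<in> P \<Longrightarrow> i \<in> V \<Longrightarrow> block_of P i = V"
  unfolding block_of_def by (rule the_equality) (use partition_on_same in fast)+

lemma block_of_in:
  assumes "partition_on A P" "i \<in> A"
  shows "block_of P i \<in> P" "i \<in> block_of P i"
proof -
  obtain V where V: "V \<in> P" "i \<in> V" using assms partition_onD1 by blast
  then show "block_of P i \<in> P" "i \<in> block_of P i" using block_of_eq[OF assms(1) V] by auto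
qed

lemma prev_in_props:
  assumes "finite W" "i \<in> W"
  shows "prev_in W i \<in> W" "next_in W (prev_in W i) = i" "i \<noteq> Min W \<Longrightarrow> prev_in W i < i"
proof -
  have "prev_in W i \<in> W \<and> next_in W (prev_in W i) = i \<and> (i \<noteq> Min W \<longrightarrow> prev_in W i < i)"
  proof (cases "\<exists>j\<in>W. j < i")
    case True
    let ?A = "{j\<in>W. j < i}"
    have A: "finite ?A" "?A \<noteq> {}" using True assms by auto
    have p: "prev_in W i = Max ?A" using True by (simp add: prev_in_def)
    have m: "Max ?A \<in> W" "Max ?A < i" using Max_in[OF A] by auto
    have "next_in W (Max ?A) = i"
    proof (rule next_in_eqI[OF assms m(2)])
      fix k assume k: "k \<in> W" "Max ?A < k"
      show "i \<le> k"
      proof (rule ccontr)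
        assume "\<not> i \<le> k"
        then have "k \<le> Max ?A" using k by (intro Max_ge[OF A(1)]) simp
        then show False using k by simp
      qed
    qed
    then show ?thesis using p m by simp
  next
    case False
    have nW: "W \<noteq> {}" using assms by auto
    have p: "prev_in W i = Max W" using False by (simp add: prev_in_def)
    have i: "i = Min W" using False assms by (metis Min_eqI not_less)
    have "next_in W (Max W) = Min W" by (rule next_in_last) (use assms in simp)
    then show ?thesis using p i Max_in[OF assms(1) nW] by simp
  qed
  then show "prev_in W i \<in> W" "next_in W (prev_in W i) = i" "i \<noteq> Min W \<Longrightarrow> prev_in W i < i"
    by blast+
qed

lemma next_in_props:
  assumes "finite W" "i \<in> W"
  shows "next_in W i \<in> W" "prev_in W (next_in W i) = i" "i \<noteq> Max W \<Longrightarrow> i < next_in W i"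
proof -
  have "next_in W i \<in> W \<and> prev_in W (next_in W i) = i \<and> (i \<noteq> Max W \<longrightarrow> i < next_in W i)"
  proof (cases "\<exists>j\<in>W. i < j")
    case True
    let ?A = "{j\<in>W. i < j}"
    have A: "finite ?A" "?A \<noteq> {}" using True assms by auto
    have p: "next_in W i = Min ?A" using True by (simp add: next_in_def)
    have m: "Min ?A \<in> W" "i < Min ?A" using Min_in[OF A] by auto
    have "prev_in W (Min ?A) = i"
    proof (rule prev_in_eqI[OF assms m(2)])
      fix k assume k: "k \<in> W" "k < Min ?A"
      show "k \<le> i"
      proof (rule ccontr)
        assume "\<not> k \<le> i"
        then have "Min ?A \<le> k" using k by (intro Min_le[OF A(1)]) simp
        then show False using k by simp
      qed
    qed
    then show ?thesis using p m by simp
  next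
    case False
    have nW: "W \<noteq> {}" using assms by auto
    have p: "next_in W i = Min W" using False by (simp add: next_in_def)
    have i: "i = Max W" using False assms by (metis Max_eqI not_less)
    have "prev_in W (Min W) = Max W" by (rule prev_in_first) (use assms in simp)
    then show ?thesis using p i Min_in[OF assms(1) nW] by simp
  qed
  then show "next_in W i \<in> W" "prev_in W (next_in W i) = i" "i \<noteq> Max W \<Longrightarrow> i < next_in W i"
    by blast+
qed

text \<open>Passing to preimages of smaller rank ends at \<open>s\<close>, which shows that all of
  \<open>W\<close> is reached from \<open>s\<close>. The preimage of \<open>s\<close> itself closes
  the orbit.\<close>

lemma cyclic_on_rankI:
  fixes rank :: "'a \<Rightarrow> nat"
  assumes s: "s \<in> W" and cl: "\<And>x. x \<in> W \<Longrightarrow> f x \<in> W"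
    and pre: "\<And>x. x \<in> W \<Longrightarrow> \<exists>y\<in>W. f y = x \<and> (x \<noteq> s \<longrightarrow> rank y < rank x)"
  shows "cyclic_on f W"
proof -
  have "x \<in> orbit f s" if "x \<in> W" "x \<noteq> s" for x
    using that
  proof (induction "rank x" arbitrary: x rule: less_induct)
    case less
    obtain y where y: "y \<in> W" "f y = x" "rank y < rank x" using pre[OF less.prems(1)] less.prems(2) by blast
    then show ?case using less.hyps[OF y(3) y(1)] orbit.base[of f s] orbit.step[of y f s] by (cases "y = s") auto
  qed
  note ns = this
  obtain z where z: "z \<in> W" "f z = s" using pre[OF s] by blast
  then have "s \<in> orbit f s" using ns[OF z(1)] orbit.base[of f s] orbit.step[of z f s] by (cases "z = s") auto
  then have "W \<subseteq> orbit f s" using ns by blast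
  moreover have "x \<in> W" if "x \<in> orbit f s" for x
    using that by (induction rule: orbit.induct) (use s cl in auto)
  ultimately have "W = orbit f s" by blast
  then show ?thesis using s unfolding cyclic_on_def by blast
qed

lemma cyclic_next_in:
  assumes "finite W" "W \<noteq> {}"
  shows "cyclic_on (next_in W) W"
proof (rule cyclic_on_rankI[of "Min W" _ _ "\<lambda>x. x"])
  fix x assume x: "x \<in> W"
  show "\<exists>y\<in>W. next_in W y = x \<and> (x \<noteq> Min W \<longrightarrow> y < x)"
    using prev_in_props[OF assms(1) x] by blast
qed (use assms next_in_props(1)[OF assms(1)] in auto)

lemma cyclic_prev_in:
  assumes "finite W" "W \<noteq> {}"
  shows "cyclic_on (prev_in W) W"
\<comment> \<open>\<open>prev_in\<close> runs downwards, so the rank counts from the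
  maximum.\<close>
proof (rule cyclic_on_rankI[of "Max W" _ _ "\<lambda>x. Max W - x"])
  fix x assume x: "x \<in> W"
  have "next_in W x \<le> Max W" using Max_ge[OF assms(1) next_in_props(1)[OF assms(1) x]] .
  then have "x \<noteq> Max W \<longrightarrow> Max W - next_in W x < Max W - x"
    using next_in_props(3)[OF assms(1) x] by auto
  then show "\<exists>y\<in>W. prev_in W y = x \<and> (x \<noteq> Max W \<longrightarrow> Max W - y < Max W - x)"
    using next_in_props[OF assms(1) x] by blast
qed (use assms prev_in_props(1)[OF assms(1)] in auto)

lemma Gamma_sel:
  "verts (Gamma P R) = Inl ` P \<union> Inr ` R"
  "edges (Gamma P R) = \<Union>P"
  "ends (Gamma P R) i = {Inl (block_of P i), Inr (block_of R i)}"
  "ccw (Gamma P R) = case_sum next_in prev_in"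
  by (simp_all add: Gamma_def)

lemma marked_Gamma_sel:
  "verts (marked_Gamma P R) = Inl ` P \<union> Inr ` R"
  "edges (marked_Gamma P R) = \<Union>P"
  "ends (marked_Gamma P R) i = {Inl (block_of P i), Inr (block_of R i)}"
  "ccw (marked_Gamma P R) = case_sum next_in prev_in"
  "root_vertex (marked_Gamma P R) = Inl (block_of P 1)"
  "black (marked_Gamma P R) = Inl ` P"
  "special (marked_Gamma P R) v = Min (edges_at (Gamma P R) v)"
  by (simp_all add: marked_Gamma_def Gamma_def fat_graph.defs marked_fat_graph.defs)

lemma edges_at_Gamma:
  assumes "partition_on A P" "partition_on A R"
  shows "V \<in> P \<Longrightarrow> edges_at (Gamma P R) (Inl V) = V" "W \<in> R \<Longrightarrow> edges_at (Gamma P R) (Inr W) = W"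
proof -
  assume V: "V \<in> P"
  have "e \<in> \<Union>P \<and> V = block_of P e \<longleftrightarrow> e \<in> V" for e
    using block_of_eq[OF assms(1) V] block_of_in(2)[OF assms(1)] partition_onD1[OF assms(1)] V by blast
  then show "edges_at (Gamma P R) (Inl V) = V" by (auto simp: edges_at_def Gamma_sel)
next
  assume W: "W \<in> R"
  have "e \<in> \<Union>P \<and> W = block_of R e \<longleftrightarrow> e \<in> W" for e
    using block_of_eq[OF assms(2) W] block_of_in(2)[OF assms(2)] partition_onD1[OF assms(1)]
      partition_onD1[OF assms(2)] W by blast
  then show "edges_at (Gamma P R) (Inr W) = W" by (auto simp: edges_at_def Gamma_sel)
qed

lemma edges_at_marked_Gamma: "edges_at (marked_Gamma P R) v = edges_at (Gamma P R) v"
  by (simp add: edges_at_def Gamma_sel marked_Gamma_sel)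

text \<open>\<open>joins n P R = 1\<close> makes the graph connected, and
  \<open>card P + card R = n + 1\<close> is then the vertex count of a tree.\<close>

lemma marked_fat_tree_Gamma:
  assumes n: "n \<ge> 1" and sm: "(P, R) \<in> shallow_meanders_of_order n"
  shows "marked_fat_tree (marked_Gamma P R)"
proof -
  let ?G = "marked_Gamma P R"
  have P: "P \<in> Interval_partitions n" and R: "R \<in> NC n" and j1: "joins n P R = 1"
    and card: "card P + card R = n + 1"
    using sm unfolding shallow_meanders_of_order_iff[OF n] by auto
  have pP: "partition_on {1..n} P" and pR: "partition_on {1..n} R"
    using P R NC_partition by (auto simp: Interval_partitions_def)
  have UP: "\<Union>P = {1..n}" using partition_onD1[OF pP] by simp
  have fP: "finite P" and fR: "finite R" using pP pR finite_elements by blast+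
  have V: "finite V \<and> V \<noteq> {}" if "V \<in> P \<union> R" for V
  proof -
    have "V \<subseteq> {1..n}" using that partition_onD1[OF pP] partition_onD1[OF pR] by blast
    then show ?thesis using finite_subset that partition_onD3[OF pP] partition_onD3[OF pR] by blast
  qed
  have bP: "block_of P i \<in> P" and bR: "block_of R i \<in> R" if "i \<in> {1..n}" for i
    using block_of_in(1)[OF pP that] block_of_in(1)[OF pR that] by auto
  have fin: "finite_graph ?G"
    unfolding finite_graph_def marked_Gamma_sel UP using fP fR bP bR by simp
  let ?L = "equiv_cl (links ?G (edges ?G))"
  have edge: "(Inl (block_of P i), Inr (block_of R i)) \<in> ?L" if "i \<in> {1..n}" for i
    using that UP by (intro equiv_cl_base) (auto simp: links_def marked_Gamma_sel)
  \<comment> \<open>A chain of labels is mapped to a chain of black vertices: a step inside a block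
    of \<open>P\<close> does not move, and a step inside a block of \<open>R\<close> passes through
    the white vertex of that block.\<close>
  have bl_conn: "(Inl (block_of P i), Inl (block_of P k)) \<in> ?L" if ik: "i \<in> {1..n}" "k \<in> {1..n}" for i k
  proof (rule equiv_cl_map[of _ _ "block_rel P \<union> block_rel R"])
    show "(i, k) \<in> equiv_cl (block_rel P \<union> block_rel R)" using ncomp_eq_1D[OF j1 ik] .
    fix u v assume "(u, v) \<in> block_rel P \<union> block_rel R"
    then consider V where "V \<in> P" "u \<in> V" "v \<in> V" | W where "W \<in> R" "u \<in> W" "v \<in> W"
      by (auto simp: block_rel_def)
    then show "(Inl (block_of P u), Inl (block_of P v)) \<in> ?L"
    proof cases
      case 1
      then show ?thesis using block_of_eq[OF pP] by simp
    next
      case 2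
      then have "u \<in> {1..n}" "v \<in> {1..n}" using partition_onD1[OF pR] by blast+
      moreover have "block_of R u = block_of R v" using block_of_eq[OF pR] 2 by simp
      ultimately show ?thesis using edge[of u] edge[of v] equiv_cl_trans equiv_cl_sym by metis
    qed
  qed
  have to1: "(v, Inl (block_of P 1)) \<in> ?L" if v: "v \<in> verts ?G" for v
  proof -
    from v consider V where "V \<in> P" "v = Inl V" | W where "W \<in> R" "v = Inr W"
      by (auto simp: marked_Gamma_sel)
    then show ?thesis
    proof cases
      case 1
      then obtain i where i: "i \<in> V" using V by blast
      then have "i \<in> {1..n}" "block_of P i = V" using 1 UP block_of_eq[OF pP] by auto
      then show ?thesis using bl_conn[of i 1] n 1 by simp
    next
      case 2
      then obtain i where i: "i \<in> W" using V by blast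
      then have i: "i \<in> {1..n}" "block_of R i = W" using 2 partition_onD1[OF pR] block_of_eq[OF pR] by blast+
      then show ?thesis
        using equiv_cl_trans[OF equiv_cl_sym[OF edge[OF i(1)]] bl_conn[OF i(1), of 1]] n 2 by simp
    qed
  qed
  have "(u, v) \<in> ?L" if "u \<in> verts ?G" "v \<in> verts ?G" for u v
    using equiv_cl_trans[OF to1[OF that(1)] equiv_cl_sym[OF to1[OF that(2)]]] .
  moreover have 1: "(1::nat) \<in> {1..n}" using n by simp
  then have "verts ?G \<noteq> {}" using bP[OF 1] by (auto simp: marked_Gamma_sel)
  ultimately have con: "connected_graph ?G" by (simp add: connected_graph_iff)
  have "card (verts ?G) = card P + card R"
    unfolding marked_Gamma_sel using fP fR by (subst card_Un_disjoint) (auto simp: card_image)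
  then have tree: "finite_tree ?G"
    unfolding finite_tree_iff_card[OF fin con] using card UP by (simp add: marked_Gamma_sel)
  have "cyclic_on (ccw ?G v) (edges_at ?G v)" if v: "v \<in> verts ?G" for v
  proof -
    from v consider V where "V \<in> P" "v = Inl V" | W where "W \<in> R" "v = Inr W"
      by (auto simp: marked_Gamma_sel)
    then show ?thesis
    proof cases
      case 1
      then show ?thesis using cyclic_next_in[of V] V[of V]
        by (simp add: edges_at_marked_Gamma edges_at_Gamma[OF pP pR] marked_Gamma_sel)
    next
      case 2
      then show ?thesis using cyclic_prev_in[of W] V[of W]
        by (simp add: edges_at_marked_Gamma edges_at_Gamma[OF pP pR] marked_Gamma_sel)
    qed
  qed
  then have fat: "fat_tree ?G" using tree by (simp add: fat_tree_def)
  have "\<exists>b\<in>black ?G. \<exists>w\<in>verts ?G - black ?G. ends ?G e = {b, w}" if e: "e \<in> edges ?G" for e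
  proof (intro bexI)
    have e: "e \<in> {1..n}" using e UP by (simp add: marked_Gamma_sel)
    show "ends ?G e = {Inl (block_of P e), Inr (block_of R e)}" by (simp add: marked_Gamma_sel)
    show "Inl (block_of P e) \<in> black ?G" using bP[OF e] by (simp add: marked_Gamma_sel)
    show "Inr (block_of R e) \<in> verts ?G - black ?G" using bR[OF e] by (auto simp: marked_Gamma_sel)
  qed
  moreover have "special ?G v \<in> edges_at ?G v" if "v \<in> black ?G" for v
  proof -
    obtain V' where "V' \<in> P" "v = Inl V'" using \<open>v \<in> black ?G\<close> by (auto simp: marked_Gamma_sel)
    then show ?thesis using V[of V'] Min_in[of V']
      by (simp add: edges_at_marked_Gamma edges_at_Gamma[OF pP pR] marked_Gamma_sel)
  qed
  moreover have "root_vertex ?G \<in> black ?G" using bP[OF 1] by (simp add: marked_Gamma_sel)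
  moreover have "black ?G \<subseteq> verts ?G" by (auto simp: marked_Gamma_sel)
  ultimately show ?thesis using fat unfolding marked_fat_tree_def by blast
qed

subsection \<open>Rigidity of shallow meanders\<close>

locale shallow_pair =
  fixes n :: nat and P R :: "nat set set"
  assumes n: "n \<ge> 1" and P: "P \<in> Interval_partitions n" and R: "R \<in> NC n" and j1: "joins n P R = 1"
begin

text \<open>On the labels of a meander, \<open>black_next\<close>, \<open>white_prev\<close> and
  \<open>contour\<close> take the places of \<open>\<sigma>\<close>, \<open>\<alpha>\<close> and
  \<open>\<theta>\<close>, and \<open>S\<close> collects the labels of the special edges.
  \<open>cyc_pred\<close> is what has to be expressed by them.\<close>

definition black_next :: "nat \<Rightarrow> nat" where "black_next i = next_in (block_of P i) i"
definition white_prev :: "nat \<Rightarrow> nat" where "white_prev i = prev_in (block_of R i) i"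
definition contour :: "nat \<Rightarrow> nat" where "contour i = black_next (white_prev i)"
definition S :: "nat set" where "S = {i\<in>{1..n}. Min (block_of P i) = i}"
definition cyc_pred :: "nat \<Rightarrow> nat" where "cyc_pred i = (if i = 1 then n else i - 1)"

lemma pP: "partition_on {1..n} P" and pR: "partition_on {1..n} R" and ncR: "noncrossing R"
  using P R NC_partition by (auto simp: Interval_partitions_def NC_def)

lemma bP: "i \<in> {1..n} \<Longrightarrow> block_of P i \<in> P \<and> i \<in> block_of P i \<and> block_of P i \<subseteq> {1..n}"
  using block_of_in[OF pP] partition_onD1[OF pP] by blast

lemma bR: "i \<in> {1..n} \<Longrightarrow> block_of R i \<in> R \<and> i \<in> block_of R i \<and> block_of R i \<subseteq> {1..n}"
  using block_of_in[OF pR] partition_onD1[OF pR] by blast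

lemma fin: "i \<in> {1..n} \<Longrightarrow> finite (block_of P i)" "i \<in> {1..n} \<Longrightarrow> finite (block_of R i)"
  using bP[of i] bR[of i] finite_subset[of "block_of P i" "{1..n}"] finite_subset[of "block_of R i" "{1..n}"]
  by auto

lemma interval: "i \<in> {1..n} \<Longrightarrow> \<exists>p q. block_of P i = {p..q}"
  using bP P unfolding Interval_partitions_def by blast

lemma same_block: "i \<in> {1..n} \<Longrightarrow> j \<in> block_of P i \<Longrightarrow> block_of P j = block_of P i"
  using block_of_eq[OF pP] bP by blast

lemma same_blockR: "i \<in> {1..n} \<Longrightarrow> j \<in> block_of R i \<Longrightarrow> block_of R j = block_of R i"
  using block_of_eq[OF pR] bR by blast

lemma black_next_in: "i \<in> {1..n} \<Longrightarrow> black_next i \<in> block_of P i \<and> black_next i \<in> {1..n}"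
  using next_in_props(1)[OF fin(1)] bP unfolding black_next_def by blast

lemma white_prev_in: "i \<in> {1..n} \<Longrightarrow> white_prev i \<in> block_of R i \<and> white_prev i \<in> {1..n}"
  using prev_in_props(1)[OF fin(2)] bR unfolding white_prev_def by blast

lemma contour_in: "i \<in> {1..n} \<Longrightarrow> contour i \<in> {1..n}"
  using black_next_in white_prev_in by (simp add: contour_def)

lemma black_next_inj: "inj_on black_next {1..n}"
proof (rule inj_on_inverseI[of _ "\<lambda>i. prev_in (block_of P i) i"])
  fix i assume i: "i \<in> {1..n}"
  show "prev_in (block_of P (black_next i)) (black_next i) = i"
    unfolding same_block[OF i conjunct1[OF black_next_in[OF i]]] unfolding black_next_def
    using next_in_props(2)[OF fin(1)[OF i]] bP[OF i] by blast
qed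

lemma white_prev_inj: "inj_on white_prev {1..n}"
proof (rule inj_on_inverseI[of _ "\<lambda>i. next_in (block_of R i) i"])
  fix i assume i: "i \<in> {1..n}"
  show "next_in (block_of R (white_prev i)) (white_prev i) = i"
    unfolding same_blockR[OF i conjunct1[OF white_prev_in[OF i]]] unfolding white_prev_def
    using prev_in_props(2)[OF fin(2)[OF i]] bR[OF i] by blast
qed

lemma one_S: "1 \<in> S"
proof -
  have 1: "1 \<in> {1..n}" using n by simp
  have "Min (block_of P 1) = 1"
    by (rule Min_eqI) (use fin(1)[OF 1] bP[OF 1] in auto)
  then show ?thesis using 1 by (simp add: S_def)
qed

lemma cyc_pred_in: "i \<in> {1..n} \<Longrightarrow> cyc_pred i \<in> {1..n}"
  using n by (auto simp: cyc_pred_def)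

lemma black_next_cyc_pred_nonspecial:
  assumes "i \<in> {1..n}" "i \<notin> S"
  shows "black_next (cyc_pred i) = i"
proof -
  have i1: "i \<noteq> 1" using one_S assms by metis
  obtain p q where pq: "block_of P i = {p..q}" using interval assms(1) by blast
  have i: "i \<in> {p..q}" using bP[OF assms(1)] pq by blast
  then have "Min (block_of P i) = p" unfolding pq by (intro Min_eqI) auto
  then have "p < i" using assms i by (auto simp: S_def)
  then have m: "i - 1 \<in> {p..q}" using i by auto
  then have "block_of P (i - 1) = {p..q}" using same_block[OF assms(1), of "i - 1"] unfolding pq by blast
  then have "black_next (i - 1) = next_in {p..q} (i - 1)" by (simp add: black_next_def)
  also have "\<dots> = i" by (rule next_in_eqI) (use i \<open>p < i\<close> in auto)
  finally show ?thesis using i1 by (simp add: cyc_pred_def)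
qed

text \<open>The label before the start of a block is the last one of its own block, so
  \<open>black_next\<close> leads to the minimum of that block. For \<open>i = 1\<close> it is
  \<open>n\<close>, after which no label follows.\<close>

lemma black_next_cyc_pred_special:
  assumes "i \<in> S"
  shows "black_next (cyc_pred i) \<in> S"
proof -
  have i: "i \<in> {1..n}" "Min (block_of P i) = i" using assms by (auto simp: S_def)
  let ?z = "cyc_pred i"
  have z: "?z \<in> {1..n}" using cyc_pred_in i by blast
  obtain p q where pq: "block_of P ?z = {p..q}" using interval z by blast
  have zin: "?z \<in> {p..q}" using bP[OF z] pq by blast
  have "black_next ?z = Min (block_of P ?z)" unfolding black_next_def
  proof (rule next_in_last, rule ccontr)
    fix k assume k: "k \<in> block_of P ?z" "\<not> k \<le> ?z"
    have "k \<le> n" using k(1) bP[OF z] by auto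
    then have "i \<noteq> 1" using k(2) by (auto simp: cyc_pred_def)
    then have iz: "i = Suc ?z" using i by (auto simp: cyc_pred_def)
    then have "i \<in> block_of P ?z" using k zin pq by auto
    then have "block_of P i = block_of P ?z" using same_block[OF z] by simp
    then have "i \<le> ?z" using i Min_le[OF fin(1)[OF z]] bP[OF z] by metis
    then show False using iz by simp
  qed
  moreover have m: "Min (block_of P ?z) \<in> block_of P ?z"
    using Min_in[OF fin(1)[OF z]] bP[OF z] by blast
  moreover have "block_of P (Min (block_of P ?z)) = block_of P ?z" using same_block[OF z m] .
  ultimately show ?thesis using bP[OF z] unfolding S_def by auto
qed

text \<open>
  The gaps before \<open>h\<close> and \<open>t\<close> lie in one block of the Kreweras complement of \<open>R\<close> iff they cut the
  same pairs of \<open>R\<close>.  As \<open>P\<close> and \<open>R\<close> together connect everything, each such block contains at most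
  one gap between blocks of \<open>P\<close>.
\<close>

definition cut :: "nat \<Rightarrow> (nat \<times> nat) set" where
  "cut h = {(x, y). (x, y) \<in> block_rel R \<and> x < h \<and> h \<le> y}"

lemma special_cut_inj:
  assumes "h \<in> S" "t \<in> S" "cut h = cut t"
  shows "h = t"
proof -
  have *: False if ht: "h \<in> S" "t \<in> S" "cut h = cut t" "h < t" for h t
  proof -
    have in': "h \<in> {1..n}" "t \<in> {1..n}" using ht by (auto simp: S_def)
    have noP: "\<not> (u < s \<and> s \<le> v)" if s: "s \<in> S" and uv: "V \<in> P" "u \<in> V" "v \<in> V" for s u v V
    proof
      assume a: "u < s \<and> s \<le> v"
      obtain p q where pq: "V = {p..q}" using P uv(1) unfolding Interval_partitions_def by blast
      then have "s \<in> V" using a uv by auto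
      then have "block_of P s = V" using block_of_eq[OF pP uv(1)] by simp
      moreover have "finite V" using pq by simp
      ultimately have "s \<le> u" using s Min_le[of V u] uv(2) by (auto simp: S_def)
      then show False using a by simp
    qed
    \<comment> \<open>Equal cuts make \<open>{h..<t}\<close> a union of blocks of \<open>R\<close>,
      and its ends being starts of blocks make it a union of blocks of \<open>P\<close>. It contains
      \<open>h\<close> but not \<open>t\<close>, which contradicts
      \<open>joins n P R = 1\<close>.\<close>
    have "u \<in> {h..<t} \<longleftrightarrow> v \<in> {h..<t}" if uv: "(u, v) \<in> block_rel P \<union> block_rel R" for u v
    proof (cases "(u, v) \<in> block_rel P")
      case True
      then obtain V where V: "V \<in> P" "u \<in> V" "v \<in> V" by (auto simp: block_rel_def)
      show ?thesis
        using noP[OF ht(1) V] noP[OF ht(2) V] noP[OF ht(1) V(1,3,2)] noP[OF ht(2) V(1,3,2)] by auto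
    next
      case False
      then have "(u, v) \<in> block_rel R" "(v, u) \<in> block_rel R" using uv by (auto simp: block_rel_def)
      then have "u < h \<and> h \<le> v \<longleftrightarrow> u < t \<and> t \<le> v" "v < h \<and> h \<le> u \<longleftrightarrow> v < t \<and> t \<le> u"
        using ht(3) unfolding cut_def by blast+
      then show ?thesis using ht(4) by auto
    qed
    from equiv_cl_closed[OF ncomp_eq_1D[OF j1 in'], of "{h..<t}", OF this] show False using ht(4) by simp
  qed
  show ?thesis using *[OF assms] *[OF assms(2,1) assms(3)[symmetric]] by (metis linorder_neqE_nat)
qed

definition cyc_suc :: "nat \<Rightarrow> nat" where "cyc_suc z = (if z = n then 1 else Suc z)"

lemma cyc_suc_in: "z \<in> {1..n} \<Longrightarrow> cyc_suc z \<in> {1..n}" using n by (auto simp: cyc_suc_def)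
lemma cyc_pred_cyc_suc: "z \<in> {1..n} \<Longrightarrow> cyc_pred (cyc_suc z) = z" by (auto simp: cyc_suc_def cyc_pred_def)

text \<open>The gap before 1 and the gap after \<open>n\<close> are one and the same outer gap:
  neither cuts any pair.\<close>

lemma cut_cyc_suc: "z \<in> {1..n} \<Longrightarrow> cut (cyc_suc z) = cut (Suc z)"
proof -
  have "x \<in> {1..n} \<and> y \<in> {1..n}" if xy: "(x, y) \<in> block_rel R" for x y
  proof -
    obtain V where "V \<in> R" "x \<in> V" "y \<in> V" using xy by (auto simp: block_rel_def)
    then show ?thesis using partition_onD1[OF pR] by blast
  qed
  then have "(x, y) \<notin> cut 1" "(x, y) \<notin> cut (Suc n)" for x y
    by (fastforce simp: cut_def)+
  then have "cut 1 = cut (Suc n)" by auto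
  then show ?thesis by (simp add: cyc_suc_def)
qed

text \<open>\<open>white_prev h\<close> and \<open>h\<close> are cyclic neighbours in their block. A
  pair inside that block is cut by both gaps or by neither, and a pair of another block that is cut
  by only one of them would cross the pair formed by these neighbours.\<close>

lemma cut_white_prev:
  assumes h: "h \<in> {1..n}"
  shows "cut (Suc (white_prev h)) = cut h"
proof -
  let ?W = "block_of R h" and ?z = "white_prev h"
  have z: "?z \<in> ?W" using white_prev_in[OF h] by blast
  have cross: False if ac: "a < b" "b < c" "c < d" "(a, c) \<in> block_rel R" "(b, d) \<in> block_rel R" "(a, b) \<notin> block_rel R" for a b c d
  proof -
    obtain V U where V: "V \<in> R" "a \<in> V" "c \<in> V" and U: "U \<in> R" "b \<in> U" "d \<in> U"
      using ac(4,5) by (auto simp: block_rel_def)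
    have "V \<noteq> U" using ac(6) V U by (auto simp: block_rel_def)
    then show False using noncrossingD[OF ncR V(1) U(1) _ V(2) U(2) V(3) U(3)] ac(1-3) by simp
  qed
  have zh: "(?z, h) \<in> block_rel R" "(h, ?z) \<in> block_rel R" using bR[OF h] z by (auto simp: block_rel_def)
  have tr: "(u, w) \<in> block_rel R" if uv: "(u, v) \<in> block_rel R" "(v, w) \<in> block_rel R" for u v w
  proof -
    obtain V U where "V \<in> R" "u \<in> V" "v \<in> V" "U \<in> R" "v \<in> U" "w \<in> U"
      using uv by (auto simp: block_rel_def)
    then show ?thesis using partition_on_same[OF pR, of V U v] by (auto simp: block_rel_def)
  qed
  have sy: "(v, u) \<in> block_rel R" if "(u, v) \<in> block_rel R" for u v using that by (auto simp: block_rel_def)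
  have W: "x \<in> ?W" if "(h, x) \<in> block_rel R" for x
    using that block_of_eq[OF pR] by (auto simp: block_rel_def)
  \<comment> \<open>Either \<open>white_prev h\<close> is the predecessor of \<open>h\<close>, or
    \<open>h\<close> is the first and \<open>white_prev h\<close> the last element of the block; the
    two coincide in a block with one element.\<close>
  consider (lt) "?z < h" "\<And>k. k \<in> ?W \<Longrightarrow> k < h \<Longrightarrow> k \<le> ?z"
    | (ge) "h \<le> ?z" "\<And>k. k \<in> ?W \<Longrightarrow> h \<le> k \<and> k \<le> ?z"
  proof (cases "\<exists>j\<in>?W. j < h")
    case True
    let ?A = "{j\<in>?W. j < h}"
    have A: "finite ?A" "?A \<noteq> {}" using True fin(2)[OF h] by auto
    have "?z = Max ?A" using True by (simp add: white_prev_def prev_in_def)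
    then show thesis using Max_in[OF A] Max_ge[OF A(1)] by (intro lt) auto
  next
    case False
    then have "?z = Max ?W" by (simp add: white_prev_def prev_in_def)
    then show thesis using False Max_ge[OF fin(2)[OF h]] bR[OF h] by (intro ge) (auto simp: not_less)
  qed
  then have "x < Suc ?z \<and> Suc ?z \<le> y \<longleftrightarrow> x < h \<and> h \<le> y" if xy: "(x, y) \<in> block_rel R" for x y
  proof cases
    case lt
    show ?thesis
    proof
      assume a: "x < Suc ?z \<and> Suc ?z \<le> y"
      show "x < h \<and> h \<le> y"
      proof (rule ccontr)
        assume "\<not> (x < h \<and> h \<le> y)"
        then have b: "x \<le> ?z" "?z < y" "y < h" using a lt(1) by auto
        have "y \<notin> ?W" using lt(2) b by force
        then have n: "(h, y) \<notin> block_rel R" using W by blast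
        then have "x \<noteq> ?z" using xy zh tr by blast
        moreover have "(x, ?z) \<notin> block_rel R" using n xy zh tr sy by blast
        ultimately show False using cross[of x ?z y h] b xy zh by simp
      qed
    next
      assume a: "x < h \<and> h \<le> y"
      show "x < Suc ?z \<and> Suc ?z \<le> y"
      proof (rule ccontr)
        assume "\<not> (x < Suc ?z \<and> Suc ?z \<le> y)"
        then have b: "?z < x" "x < h" using a lt(1) by auto
        have "x \<notin> ?W" using lt(2) b by force
        then have n: "(h, x) \<notin> block_rel R" using W by blast
        then have "y \<noteq> h" using xy sy by blast
        moreover have "(?z, x) \<notin> block_rel R" using n zh tr by blast
        ultimately show False using cross[of ?z x h y] b a xy zh by simp
      qed
    qed
  next
    case ge
    have inW: "x \<in> ?W \<longleftrightarrow> y \<in> ?W"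
      using W[of x] W[of y] tr[of h x y] tr[of h y x] sy[OF xy] xy
        block_relI[of ?W R h x] block_relI[of ?W R h y] bR[OF h] by blast
    show ?thesis
    proof
      assume a: "x < Suc ?z \<and> Suc ?z \<le> y"
      show "x < h \<and> h \<le> y"
      proof (rule ccontr)
        assume "\<not> (x < h \<and> h \<le> y)"
        then have b: "h \<le> x" "x \<le> ?z" "?z < y" using a ge(1) by auto
        have "y \<notin> ?W" using ge(2) b by force
        then have "x \<notin> ?W" using inW by simp
        then have "x \<noteq> h" "x \<noteq> ?z" "(h, x) \<notin> block_rel R" using bR[OF h] z W by auto
        then show False using cross[of h x ?z y] b xy zh by simp
      qed
    next
      assume a: "x < h \<and> h \<le> y"
      show "x < Suc ?z \<and> Suc ?z \<le> y"
      proof (rule ccontr)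
        assume "\<not> (x < Suc ?z \<and> Suc ?z \<le> y)"
        then have b: "x < h" "h \<le> y" "y \<le> ?z" using a ge(1) by auto
        have "x \<notin> ?W" using ge(2) b by force
        then have "y \<notin> ?W" using inW by simp
        then have "y \<noteq> h" "y \<noteq> ?z" "(h, y) \<notin> block_rel R" using bR[OF h] z W by auto
        then have "(x, h) \<notin> block_rel R" using xy tr sy by blast
        then show False using cross[of x h y ?z] b xy zh \<open>y \<noteq> h\<close> \<open>y \<noteq> ?z\<close> by simp
      qed
    qed
  qed
  then show ?thesis unfolding cut_def by blast
qed

text \<open>The contour from \<open>t\<close> goes once around the block of the Kreweras complement
  that contains the gap before \<open>t\<close>. By \<open>special_cut_inj\<close> this is the only
  gap of that block between blocks of \<open>P\<close>; as long as the gap reached is not of this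
  kind, \<open>black_next\<close> merely steps to the next label.\<close>

lemma first_special:
  assumes t: "t \<in> S"
  shows "\<exists>k>0. (contour ^^ k) t = black_next (cyc_pred t) \<and> (\<forall>j. 0 < j \<and> j < k \<longrightarrow> (contour ^^ j) t \<notin> S)"
proof -
  \<comment> \<open>From the gap before \<open>h\<close> to the gap after
    \<open>white_prev h\<close>, each gap being named by the label that follows it
    cyclically.\<close>
  define kp where "kp h = cyc_suc (white_prev h)" for h
  have tn: "t \<in> {1..n}" using t by (simp add: S_def)
  have kp_in: "kp h \<in> {1..n}" if "h \<in> {1..n}" for h using cyc_suc_in white_prev_in that by (simp add: kp_def)
  have cyc_pred_kp: "cyc_pred (kp h) = white_prev h" if "h \<in> {1..n}" for h using cyc_pred_cyc_suc white_prev_in that by (simp add: kp_def)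
  have "inj_on kp {1..n}"
    by (rule inj_onI) (metis cyc_pred_kp inj_onD[OF white_prev_inj])
  then obtain m where m: "m > 0" "(kp ^^ m) t = t"
    using finite_inj_returns[of "{1..n}" kp t] kp_in tn by auto
  define k where "k = (LEAST k. 0 < k \<and> (kp ^^ k) t \<in> S)"
  have k: "0 < k" "(kp ^^ k) t \<in> S"
    using LeastI[of "\<lambda>k. 0 < k \<and> (kp ^^ k) t \<in> S" m] m t unfolding k_def by auto
  have before: "(kp ^^ j) t \<notin> S" if "0 < j" "j < k" for j
    using not_less_Least[of j "\<lambda>k. 0 < k \<and> (kp ^^ k) t \<in> S"] that unfolding k_def by blast
  have mem: "(kp ^^ j) t \<in> {1..n}" for j using funpow_closed[of "{1..n}" kp] kp_in tn by blast
  have "cut ((kp ^^ j) t) = cut t" for j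
  proof (induction j)
    case (Suc j)
    have "cut (kp ((kp ^^ j) t)) = cut ((kp ^^ j) t)"
      unfolding kp_def using cut_cyc_suc white_prev_in cut_white_prev mem[unfolded kp_def] by metis
    then show ?case using Suc by simp
  qed simp
  then have kt: "(kp ^^ k) t = t" using special_cut_inj[OF k(2) t] by blast
  have eq: "(contour ^^ j) t = (kp ^^ j) t" if "j < k" for j
    using that
  proof (induction j)
    case (Suc j)
    let ?i = "(kp ^^ Suc j) t"
    have "black_next (cyc_pred ?i) = ?i" by (rule black_next_cyc_pred_nonspecial[OF mem before[OF _ Suc.prems]]) simp
    moreover have "cyc_pred ?i = white_prev ((kp ^^ j) t)" using cyc_pred_kp[OF mem[of j]] by simp
    ultimately have "contour ((kp ^^ j) t) = ?i" unfolding contour_def by metis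
    then show ?case using Suc by simp
  qed simp
  obtain l where l: "k = Suc l" using k(1) by (cases k) auto
  have "(contour ^^ k) t = contour ((kp ^^ l) t)" using eq[of l] l by simp
  also have "\<dots> = black_next (cyc_pred ((kp ^^ k) t))" using cyc_pred_kp[OF mem[of l]] l by (simp add: contour_def)
  finally have "(contour ^^ k) t = black_next (cyc_pred t)" using kt by simp
  then show ?thesis using k(1) eq before by (intro exI[of _ k]) auto
qed

end

text \<open>If \<open>g\<close> fixes \<open>i\<close>, it fixes \<open>cyc_pred i\<close>: this
  label is determined by \<open>black_next\<close>, the contour and \<open>S\<close>, all of which
  \<open>g\<close> respects. From 1 this leads to \<open>n\<close> and then down through all
  labels.\<close>

lemma shallow_pair_rigid:
  assumes "shallow_pair n P R" "shallow_pair n P' R'"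
    and gE: "\<And>i. i \<in> {1..n} \<Longrightarrow> g i \<in> {1..n}"
    and gs: "\<And>i. i \<in> {1..n} \<Longrightarrow> g (shallow_pair.black_next P i) = shallow_pair.black_next P' (g i)"
    and ga: "\<And>i. i \<in> {1..n} \<Longrightarrow> g (shallow_pair.white_prev R i) = shallow_pair.white_prev R' (g i)"
    and gS: "\<And>i. i \<in> {1..n} \<Longrightarrow> i \<in> shallow_pair.S n P \<longleftrightarrow> g i \<in> shallow_pair.S n P'"
    and g1: "g 1 = 1" and i: "i \<in> {1..n}"
  shows "g i = i"
proof -
  interpret A: shallow_pair n P R by fact
  interpret B: shallow_pair n P' R' by fact
  have pdAB: "A.cyc_pred i = B.cyc_pred i" for i by (simp add: A.cyc_pred_def B.cyc_pred_def)
  have step: "g (A.cyc_pred i) = A.cyc_pred i" if i: "i \<in> {1..n}" and gi: "g i = i" for i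
  proof (cases "i \<in> A.S")
    case False
    then have "i \<notin> B.S" using gS[OF i] gi by simp
    then have "B.black_next (A.cyc_pred i) = i" using B.black_next_cyc_pred_nonspecial[OF i] pdAB by simp
    moreover have "B.black_next (g (A.cyc_pred i)) = i"
      using A.black_next_cyc_pred_nonspecial[OF i False] gs[OF A.cyc_pred_in[OF i]] gi by simp
    ultimately show ?thesis using inj_onD[OF B.black_next_inj] gE[OF A.cyc_pred_in[OF i]] A.cyc_pred_in[OF i] by metis
  next
    case True
    then have TB: "i \<in> B.S" using gS[OF i] gi by simp
    obtain k where k: "k > 0" "(A.contour ^^ k) i = A.black_next (A.cyc_pred i)"
      "\<And>j. 0 < j \<Longrightarrow> j < k \<Longrightarrow> (A.contour ^^ j) i \<notin> A.S" using A.first_special[OF True] by blast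
    obtain l where l: "l > 0" "(B.contour ^^ l) i = B.black_next (B.cyc_pred i)"
      "\<And>j. 0 < j \<Longrightarrow> j < l \<Longrightarrow> (B.contour ^^ j) i \<notin> B.S" using B.first_special[OF TB] by blast
    have mem: "(A.contour ^^ j) i \<in> {1..n}" for j using funpow_closed[of "{1..n}" A.contour] A.contour_in i by blast
    have gth: "g (A.contour j) = B.contour (g j)" if "j \<in> {1..n}" for j
      using gs[OF conjunct2[OF A.white_prev_in[OF that]]] ga[OF that] by (simp add: A.contour_def B.contour_def)
    have pow: "g ((A.contour ^^ j) i) = (B.contour ^^ j) i" for j
    proof (induction j)
      case (Suc j)
      then show ?case using gth[OF mem[of j]] by simp
    qed (simp add: gi)
    have SA: "(A.contour ^^ k) i \<in> A.S" using k(2) A.black_next_cyc_pred_special[OF True] by simp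
    have SB: "(B.contour ^^ l) i \<in> B.S" using l(2) B.black_next_cyc_pred_special[OF TB] by simp
    have iff: "(A.contour ^^ j) i \<in> A.S \<longleftrightarrow> (B.contour ^^ j) i \<in> B.S" for j using gS[OF mem] pow by simp
    have "k = l"
    proof (rule linorder_cases[of k l])
      assume "k < l" then show ?thesis using l(3)[OF k(1)] SA iff by blast
    next
      assume "l < k" then show ?thesis using k(3)[OF l(1)] SB iff by blast
    qed
    \<comment> \<open>Both contours meet \<open>S\<close> for the first time after equally many
      steps, so the labels found by \<open>first_special\<close> correspond under
      \<open>g\<close>.\<close>
    then have "B.black_next (g (A.cyc_pred i)) = B.black_next (A.cyc_pred i)"
      using pow[of k] k(2) l(2) gs[OF A.cyc_pred_in[OF i]] pdAB by simp
    then show ?thesis using inj_onD[OF B.black_next_inj] gE[OF A.cyc_pred_in[OF i]] A.cyc_pred_in[OF i] by metis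
  qed
  have "g (n - d) = n - d" if "d < n" for d
    using that
  proof (induction d)
    case 0
    then show ?case using step[of 1] g1 A.n by (simp add: A.cyc_pred_def)
  next
    case (Suc d)
    then have "g (A.cyc_pred (n - d)) = A.cyc_pred (n - d)" by (intro step) auto
    moreover have "A.cyc_pred (n - d) = n - Suc d" using Suc.prems by (simp add: A.cyc_pred_def)
    ultimately show ?case by simp
  qed
  from this[of "n - i"] show ?thesis using i by simp
qed

subsection \<open>Isomorphisms\<close>

lemma orbit_transfer:
  assumes A: "\<And>e. e \<in> A \<Longrightarrow> c e \<in> A \<and> d (g e) = g (c e)" and s: "s \<in> A"
  shows "orbit d (g s) = g ` orbit c s"
proof -
  have "(d ^^ k) (g s) = g ((c ^^ k) s) \<and> (c ^^ k) s \<in> A" for k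
    by (induction k) (use A s in auto)
  then have "(d ^^ k) (g s) = g ((c ^^ k) s)" for k by blast
  then show ?thesis unfolding orbit_altdef by auto
qed

lemma cyclic_on_closed: "cyclic_on c A \<Longrightarrow> e \<in> A \<Longrightarrow> c e \<in> A"
  unfolding cyclic_on_def by (auto intro: orbit.step)

lemma cyclic_on_transfer:
  assumes "cyclic_on c A" "\<And>e. e \<in> A \<Longrightarrow> d (g e) = g (c e)"
  shows "cyclic_on d (g ` A)"
proof -
  obtain s where s: "s \<in> A" "A = orbit c s" using assms(1) unfolding cyclic_on_def by blast
  have "orbit d (g s) = g ` orbit c s"
    by (rule orbit_transfer[of A]) (use assms s(1) cyclic_on_closed[OF assms(1)] in auto)
  then show ?thesis using s unfolding cyclic_on_def by auto
qed

definition iso_maps ::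
  "('v \<Rightarrow> 'w) \<Rightarrow> ('e \<Rightarrow> 'f) \<Rightarrow> ('v, 'e) marked_fat_graph \<Rightarrow> ('w, 'f) marked_fat_graph \<Rightarrow> bool" where
  "iso_maps f g G H \<longleftrightarrow>
     bij_betw f (verts G) (verts H) \<and> bij_betw g (edges G) (edges H) \<and>
     (\<forall>e\<in>edges G. ends H (g e) = f ` ends G e) \<and>
     (\<forall>v\<in>verts G. \<forall>e\<in>edges_at G v. ccw H (f v) (g e) = g (ccw G v e)) \<and>
     f (root_vertex G) = root_vertex H \<and>
     (\<forall>v\<in>verts G. v \<in> black G \<longleftrightarrow> f v \<in> black H) \<and>
     (\<forall>v\<in>black G. special H (f v) = g (special G v))"

lemma isomorphic_iff: "isomorphic G H \<longleftrightarrow> (\<exists>f g. iso_maps f g G H)"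
  by (simp add: isomorphic_def iso_maps_def)

lemma iso_mapsD:
  assumes "iso_maps f g G H"
  shows "bij_betw f (verts G) (verts H)" "bij_betw g (edges G) (edges H)"
    "e \<in> edges G \<Longrightarrow> ends H (g e) = f ` ends G e"
    "v \<in> verts G \<Longrightarrow> e \<in> edges_at G v \<Longrightarrow> ccw H (f v) (g e) = g (ccw G v e)"
    "f (root_vertex G) = root_vertex H"
    "v \<in> verts G \<Longrightarrow> v \<in> black G \<longleftrightarrow> f v \<in> black H"
    "v \<in> black G \<Longrightarrow> special H (f v) = g (special G v)"
  using assms unfolding iso_maps_def by blast+

lemma marked_fat_treeD:
  assumes "marked_fat_tree G"
  shows "finite_tree G" "finite_graph G" "connected_graph G"
    "e \<in> edges G \<Longrightarrow> ends G e \<subseteq> verts G"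
    "v \<in> verts G \<Longrightarrow> edges_at G v \<noteq> {} \<Longrightarrow> cyclic_on (ccw G v) (edges_at G v)"
    "black G \<subseteq> verts G" "root_vertex G \<in> black G" "root_vertex G \<in> verts G"
    "e \<in> edges G \<Longrightarrow> \<exists>b\<in>black G. \<exists>w\<in>verts G - black G. ends G e = {b, w}"
    "v \<in> black G \<Longrightarrow> special G v \<in> edges_at G v"
  using assms unfolding marked_fat_tree_def fat_tree_def finite_tree_def finite_graph_def by blast+

lemma edges_at_iso:
  assumes G: "marked_fat_tree G" and iso: "iso_maps f g G H" and v: "v \<in> verts G"
  shows "edges_at H (f v) = g ` edges_at G v"
proof -
  note D = iso_mapsD[OF iso]
  have "f v \<in> ends H (g e) \<longleftrightarrow> v \<in> ends G e" if e: "e \<in> edges G" for e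
    using D(3)[OF e] inj_on_image_mem_iff[OF bij_betw_imp_inj_on[OF D(1)] v marked_fat_treeD(4)[OF G e]]
    by simp
  moreover have "edges H = g ` edges G" using bij_betw_imp_surj_on[OF D(2)] by simp
  ultimately show ?thesis unfolding edges_at_def by auto
qed

lemma ccw_closed:
  assumes G: "marked_fat_tree G" and v: "v \<in> verts G" and e: "e \<in> edges_at G v"
  shows "ccw G v e \<in> edges_at G v"
proof -
  have "cyclic_on (ccw G v) (edges_at G v)" using marked_fat_treeD(5)[OF G v] e by blast
  then show ?thesis using e by (rule cyclic_on_closed)
qed

text \<open>\<open>isomorphic\<close> compares the colours only at images of vertices. The inclusion
  for \<open>H\<close> excludes black points outside \<open>verts H\<close>, about whose special
  edges nothing would be known.\<close>

lemma isomorphic_sym: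
  assumes G: "marked_fat_tree G" and "isomorphic G H" and bH: "black H \<subseteq> verts H"
  shows "isomorphic H G"
proof -
  obtain f g where iso: "iso_maps f g G H" using assms(2) unfolding isomorphic_iff by blast
  note D = iso_mapsD[OF iso] and T = marked_fat_treeD[OF G]
  let ?f = "inv_into (verts G) f" and ?g = "inv_into (edges G) g"
  have f: "?f (f v) = v" if "v \<in> verts G" for v using bij_betw_inv_into_left[OF D(1) that] .
  have g: "?g (g e) = e" if "e \<in> edges G" for e using bij_betw_inv_into_left[OF D(2) that] .
  have V: "verts H = f ` verts G" and E: "edges H = g ` edges G"
    using D(1,2) by (simp_all add: bij_betw_def)
  have "iso_maps ?f ?g H G"
    unfolding iso_maps_def
  proof (intro conjI ballI)
    show "bij_betw ?f (verts H) (verts G)" "bij_betw ?g (edges H) (edges G)"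
      using bij_betw_inv_into D(1,2) by blast+
  next
    fix e' assume "e' \<in> edges H"
    then obtain e where e: "e \<in> edges G" "e' = g e" using E by blast
    have "?f ` f ` ends G e = ends G e" using f T(4)[OF e(1)] by (force simp: image_image)
    then show "ends G (?g e') = ?f ` ends H e'" using e g D(3) by simp
  next
    fix v' e' assume "v' \<in> verts H" "e' \<in> edges_at H v'"
    then obtain v where v: "v \<in> verts G" "v' = f v" using V by blast
    then obtain e where e: "e \<in> edges_at G v" "e' = g e"
      using \<open>e' \<in> edges_at H v'\<close> edges_at_iso[OF G iso v(1)] by auto
    have "e \<in> edges G" "ccw G v e \<in> edges G"
      using e ccw_closed[OF G v(1) e(1)] by (auto simp: edges_at_def)
    then show "ccw G (?f v') (?g e') = ?g (ccw H v' e')" using v e f g D(4) by simp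
  next
    show "?f (root_vertex H) = root_vertex G" using D(5) f[OF T(8)] by metis
  next
    fix v' assume "v' \<in> verts H"
    then obtain v where v: "v \<in> verts G" "v' = f v" using V by blast
    then show "v' \<in> black H \<longleftrightarrow> ?f v' \<in> black G" using D(6) f by simp
  next
    fix v' assume b: "v' \<in> black H"
    then have "v' \<in> verts H" using bH by blast
    then obtain v where v: "v \<in> verts G" "v' = f v" using V by blast
    then have vb: "v \<in> black G" using b D(6) by simp
    then have "special G v \<in> edges G" using T(10) by (simp add: edges_at_def)
    then show "special G (?f v') = ?g (special H v')" using v f g D(7)[OF vb] by simp
  qed
  then show ?thesis unfolding isomorphic_iff by blast
qed

lemma isomorphic_trans:
  assumes G: "marked_fat_tree G" and "isomorphic G H" "isomorphic H K"
  shows "isomorphic G K"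
proof -
  obtain f g where iso: "iso_maps f g G H" using assms(2) unfolding isomorphic_iff by blast
  obtain f' g' where iso': "iso_maps f' g' H K" using assms(3) unfolding isomorphic_iff by blast
  note D = iso_mapsD[OF iso] and D' = iso_mapsD[OF iso'] and T = marked_fat_treeD[OF G]
  have fv: "f v \<in> verts H" if "v \<in> verts G" for v using bij_betwE[OF D(1)] that by blast
  have ge: "g e \<in> edges H" if "e \<in> edges G" for e using bij_betwE[OF D(2)] that by blast
  have "iso_maps (f' \<circ> f) (g' \<circ> g) G K"
    unfolding iso_maps_def
  proof (intro conjI ballI)
    show "bij_betw (f' \<circ> f) (verts G) (verts K)" "bij_betw (g' \<circ> g) (edges G) (edges K)"
      using bij_betw_trans D(1,2) D'(1,2) by blast+
  next
    fix e assume "e \<in> edges G"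
    then show "ends K ((g' \<circ> g) e) = (f' \<circ> f) ` ends G e"
      using D(3) D'(3)[OF ge] by (simp add: image_comp)
  next
    fix v e assume v: "v \<in> verts G" and e: "e \<in> edges_at G v"
    have "g e \<in> edges_at H (f v)" using edges_at_iso[OF G iso v] e by blast
    then show "ccw K ((f' \<circ> f) v) ((g' \<circ> g) e) = (g' \<circ> g) (ccw G v e)"
      using D(4)[OF v e] D'(4)[OF fv[OF v]] by simp
  next
    show "(f' \<circ> f) (root_vertex G) = root_vertex K" using D(5) D'(5) by simp
  next
    fix v assume "v \<in> verts G"
    then show "v \<in> black G \<longleftrightarrow> (f' \<circ> f) v \<in> black K" using D(6) D'(6)[OF fv] by simp
  next
    fix v assume v: "v \<in> black G"
    then have "f v \<in> black H" using D(6) T(6) by blast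
    then show "special K ((f' \<circ> f) v) = (g' \<circ> g) (special G v)" using D(7)[OF v] D'(7) by simp
  qed
  then show ?thesis unfolding isomorphic_iff by blast
qed

text \<open>Acyclicity is not transported cycle by cycle: connectedness and the two cardinalities
  carry over, and they characterize trees.\<close>

lemma marked_fat_tree_iso:
  assumes G: "marked_fat_tree G" and iso: "iso_maps f g G H" and bH: "black H \<subseteq> verts H"
  shows "marked_fat_tree H"
proof -
  note D = iso_mapsD[OF iso] and T = marked_fat_treeD[OF G]
  have V: "verts H = f ` verts G" and E: "edges H = g ` edges G"
    using D(1,2) by (simp_all add: bij_betw_def)
  have finV: "finite (verts H)" and finE: "finite (edges H)"
    using T(2) unfolding V E finite_graph_def by auto
  have col: "\<exists>b\<in>black H. \<exists>w\<in>verts H - black H. ends H e' = {b, w}" if "e' \<in> edges H" for e'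
  proof -
    obtain e where e: "e \<in> edges G" "e' = g e" using \<open>e' \<in> edges H\<close> E by blast
    obtain b w where bw: "b \<in> black G" "w \<in> verts G" "w \<notin> black G" "ends G e = {b, w}"
      using T(9)[OF e(1)] by blast
    have "f b \<in> black H" "f w \<in> verts H - black H" using bw(1-3) D(6) T(6) V by auto
    moreover have "ends H e' = {f b, f w}" using D(3)[OF e(1)] e(2) bw(4) by simp
    ultimately show ?thesis by blast
  qed
  have fin: "finite_graph H"
    unfolding finite_graph_def
  proof (intro conjI ballI)
    fix e assume "e \<in> edges H"
    then obtain b w where bw: "b \<in> black H" "w \<in> verts H - black H" "ends H e = {b, w}" using col by blast
    show "ends H e \<subseteq> verts H" unfolding bw(3) using bw(1,2) bH by auto
    have "b \<noteq> w" using bw by blast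
    then show "card (ends H e) \<in> {1, 2}" using bw(3) by simp
  qed (use finV finE in auto)
  have "(f x, f y) \<in> equiv_cl (links H (edges H))" if "x \<in> verts G" "y \<in> verts G" for x y
  proof (rule equiv_cl_map[where h = f])
    show "(x, y) \<in> equiv_cl (links G (edges G))" using T(3) that unfolding connected_graph_iff by blast
    fix u v assume "(u, v) \<in> links G (edges G)"
    then obtain e where "e \<in> edges G" "ends G e = {u, v}" by (auto simp: links_def)
    then have "g e \<in> edges H" "ends H (g e) = {f u, f v}" using D(3) E by auto
    then show "(f u, f v) \<in> equiv_cl (links H (edges H))" by (intro equiv_cl_base) (auto simp: links_def)
  qed
  then have con: "connected_graph H" using T(3) unfolding connected_graph_iff V by auto
  have "card (verts G) = Suc (card (edges G))" using T(1) finite_tree_iff_card[OF T(2,3)] by blast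
  then have "finite_tree H"
    unfolding finite_tree_iff_card[OF fin con] using bij_betw_same_card[OF D(1)] bij_betw_same_card[OF D(2)] by simp
  moreover have "cyclic_on (ccw H v') (edges_at H v')" if v': "v' \<in> verts H" "edges_at H v' \<noteq> {}" for v'
  proof -
    obtain v where v: "v \<in> verts G" "v' = f v" using v' V by blast
    have e: "edges_at H v' = g ` edges_at G v" using edges_at_iso[OF G iso v(1)] v(2) by simp
    have "edges_at G v \<noteq> {}" using v'(2) e by auto
    then have c: "cyclic_on (ccw G v) (edges_at G v)" by (rule T(5)[OF v(1)])
    show ?thesis unfolding e
      by (rule cyclic_on_transfer[OF c]) (use D(4)[OF v(1)] v(2) in simp)
  qed
  moreover have "special H v' \<in> edges_at H v'" if v': "v' \<in> black H" for v'
  proof -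
    obtain v where v: "v \<in> verts G" "v' = f v" using v' V bH by blast
    then have "v \<in> black G" using v' D(6) by simp
    then show ?thesis using T(10) D(7) edges_at_iso[OF G iso v(1)] v(2) by auto
  qed
  moreover have "root_vertex H \<in> black H" using D(5,6) T(7,8) by metis
  ultimately show ?thesis using col bH unfolding marked_fat_tree_def fat_tree_def by blast
qed

lemma exists_nat_copy:
  assumes G: "marked_fat_tree G"
  shows "\<exists>T\<in>nat_trees. isomorphic G T"
proof -
  have "finite (verts G)" "finite (edges G)" using marked_fat_treeD(2)[OF G] by (auto simp: finite_graph_def)
  then obtain f :: "'a \<Rightarrow> nat" and g :: "'b \<Rightarrow> nat" where f: "inj_on f (verts G)" and g: "inj_on g (edges G)"
    using finite_imp_inj_to_nat_seg by metis
  note T = marked_fat_treeD[OF G]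
  let ?f = "inv_into (verts G) f" and ?g = "inv_into (edges G) g"
  have f': "?f (f v) = v" if "v \<in> verts G" for v using inv_into_f_f[OF f that] .
  have g': "?g (g e) = e" if "e \<in> edges G" for e using inv_into_f_f[OF g that] .
  define H :: "(nat, nat) marked_fat_graph" where "H =
    \<lparr> verts = f ` verts G, edges = g ` edges G, ends = (\<lambda>e. f ` ends G (?g e)),
      ccw = (\<lambda>v e. g (ccw G (?f v) (?g e))), root_vertex = f (root_vertex G),
      black = f ` black G, special = (\<lambda>v. g (special G (?f v))) \<rparr>"
  have "iso_maps f g G H"
    unfolding iso_maps_def
  proof (intro conjI ballI)
    show "bij_betw f (verts G) (verts H)" "bij_betw g (edges G) (edges H)"
      using f g by (simp_all add: H_def bij_betw_def)
    fix v assume v: "v \<in> verts G"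
    show "v \<in> black G \<longleftrightarrow> f v \<in> black H"
      using inj_on_image_mem_iff[OF f v T(6)] by (simp add: H_def)
    fix e assume e: "e \<in> edges_at G v"
    then show "ccw H (f v) (g e) = g (ccw G v e)"
      using f'[OF v] g' by (simp add: H_def edges_at_def)
  next
    fix v assume "v \<in> black G"
    then show "special H (f v) = g (special G v)" using f' T(6) by (simp add: H_def subset_iff)
  qed (use g' in \<open>simp_all add: H_def\<close>)
  moreover have "black H \<subseteq> verts H" using T(6) by (auto simp: H_def)
  ultimately show ?thesis using marked_fat_tree_iso[OF G] unfolding isomorphic_iff nat_trees_def by blast
qed

subsection \<open>The bijection\<close>

lemma partition_eqI:
  assumes "partition_on A P" "partition_on A Q"
    and "\<And>i j. i \<in> A \<Longrightarrow> j \<in> A \<Longrightarrow> block_of P i = block_of P j \<longleftrightarrow> block_of Q i = block_of Q j"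
  shows "P = Q"
proof -
  have *: "P \<subseteq> Q" if P: "partition_on A P" and Q: "partition_on A Q"
    and eq: "\<And>i j. i \<in> A \<Longrightarrow> j \<in> A \<Longrightarrow> block_of P i = block_of P j \<longleftrightarrow> block_of Q i = block_of Q j" for P Q
  proof
    fix V assume V: "V \<in> P"
    then obtain i where iV: "i \<in> V" using partition_onD3[OF P] by (metis ex_in_conv)
    have sub: "V \<subseteq> A" using V partition_onD1[OF P] by blast
    have i: "i \<in> A" using iV sub by blast
    let ?W = "block_of Q i"
    have W: "?W \<in> Q" "?W \<subseteq> A" using block_of_in(1)[OF Q i] partition_onD1[OF Q] by blast+
    have "j \<in> V \<longleftrightarrow> j \<in> ?W" if j: "j \<in> A" for j
    proof -
      have "j \<in> V \<longleftrightarrow> block_of P j = block_of P i"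
        using block_of_eq[OF P V] block_of_in(2)[OF P j] block_of_eq[OF P V iV] by metis
      also have "block_of P j = block_of P i \<longleftrightarrow> block_of Q j = ?W" using eq[OF j i] .
      also have "\<dots> \<longleftrightarrow> j \<in> ?W"
        using block_of_eq[OF Q W(1)] block_of_in(2)[OF Q j] by blast
      finally show ?thesis .
    qed
    then have "V = ?W" using sub W(2) by blast
    then show "V \<in> Q" using W(1) by simp
  qed
  show ?thesis using *[OF assms] *[OF assms(2,1)] assms(3) by blast
qed

lemma shallow_pairI:
  assumes "n \<ge> 1" "(P, R) \<in> shallow_meanders_of_order n"
  shows "shallow_pair n P R"
  using assms(2) unfolding shallow_meanders_of_order_iff[OF assms(1)]
  by unfold_locales (use assms(1) in auto)

lemma shallow_meanders_iff: "(P, R) \<in> shallow_meanders \<longleftrightarrow> (\<exists>n\<ge>1. (P, R) \<in> shallow_meanders_of_order n)"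
  by (auto simp: shallow_meanders_def)

text \<open>The edges are the labels, so counting them gives \<open>n' = n\<close>, and the edge map
  satisfies the hypotheses of \<open>shallow_pair_rigid\<close>. Once it is the identity, two labels
  share a block on one side iff they do on the other.\<close>

lemma marked_Gamma_inj:
  assumes n: "n \<ge> 1" and sm: "(P, R) \<in> shallow_meanders_of_order n"
    and n': "n' \<ge> 1" and sm': "(P', R') \<in> shallow_meanders_of_order n'"
    and "isomorphic (marked_Gamma P R) (marked_Gamma P' R')"
  shows "P = P' \<and> R = R'"
proof -
  let ?G = "marked_Gamma P R" and ?H = "marked_Gamma P' R'"
  obtain f g where iso: "iso_maps f g ?G ?H" using assms(5) unfolding isomorphic_iff by blast
  interpret A: shallow_pair n P R using shallow_pairI[OF n sm] .
  interpret B: shallow_pair n' P' R' using shallow_pairI[OF n' sm'] .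
  note D = iso_mapsD[OF iso]
  have EG: "edges ?G = {1..n}" and EH: "edges ?H = {1..n'}"
    using partition_onD1[OF A.pP] partition_onD1[OF B.pP] by (simp_all add: marked_Gamma_sel)
  have nn: "n' = n" using bij_betw_same_card[OF D(2)] unfolding EG EH by simp
  have gE: "g i \<in> {1..n}" if "i \<in> {1..n}" for i
    using bij_betwE[OF D(2)] that unfolding EG EH nn by blast
  have g_inj: "g i = g j \<longleftrightarrow> i = j" if "i \<in> {1..n}" "j \<in> {1..n}" for i j
    using inj_on_eq_iff[OF bij_betw_imp_inj_on[OF D(2)]] that unfolding EG by blast
  have eG: "edges_at ?G (Inl V) = V" if "V \<in> P" for V
    using that by (simp add: edges_at_marked_Gamma edges_at_Gamma[OF A.pP A.pR])
  have eGR: "edges_at ?G (Inr V) = V" if "V \<in> R" for V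
    using that by (simp add: edges_at_marked_Gamma edges_at_Gamma[OF A.pP A.pR])
  have eH: "edges_at ?H (Inl V) = V" if "V \<in> P'" for V
    using that by (simp add: edges_at_marked_Gamma edges_at_Gamma[OF B.pP B.pR])
  have ends: "{f (Inl (block_of P i)), f (Inr (block_of R i))} =
      {Inl (block_of P' (g i)), Inr (block_of R' (g i))}" if "i \<in> {1..n}" for i
    using D(3)[of i] that unfolding EG by (simp add: marked_Gamma_sel)
  \<comment> \<open>The ends of an edge correspond only as unordered pairs; the colours tell which
    end goes where.\<close>
  have f_black: "f (Inl (block_of P i)) = Inl (block_of P' (g i))"
    and f_white: "f (Inr (block_of R i)) = Inr (block_of R' (g i))" if i: "i \<in> {1..n}" for i
  proof -
    have "Inl (block_of P i) \<in> verts ?G" "Inl (block_of P i) \<in> black ?G"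
      using A.bP[OF i] by (simp_all add: marked_Gamma_sel)
    then have "f (Inl (block_of P i)) \<in> black ?H" using D(6) by blast
    then have b: "f (Inl (block_of P i)) \<noteq> Inr (block_of R' (g i))" by (auto simp: marked_Gamma_sel)
    then show 1: "f (Inl (block_of P i)) = Inl (block_of P' (g i))"
      using ends[OF i] by (auto simp: doubleton_eq_iff)
    show "f (Inr (block_of R i)) = Inr (block_of R' (g i))"
      using ends[OF i] b 1 by (auto simp: doubleton_eq_iff)
  qed
  have vP: "Inl (block_of P i) \<in> verts ?G" and vR: "Inr (block_of R i) \<in> verts ?G" if "i \<in> {1..n}" for i
    using A.bP[OF that] A.bR[OF that] by (simp_all add: marked_Gamma_sel)
  have gs: "g (A.black_next i) = B.black_next (g i)" if i: "i \<in> {1..n}" for i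
  proof -
    have "i \<in> edges_at ?G (Inl (block_of P i))" using eG A.bP[OF i] by simp
    from D(4)[OF vP[OF i] this] show ?thesis
      by (simp add: f_black[OF i] A.black_next_def B.black_next_def marked_Gamma_sel)
  qed
  have ga: "g (A.white_prev i) = B.white_prev (g i)" if i: "i \<in> {1..n}" for i
  proof -
    have "i \<in> edges_at ?G (Inr (block_of R i))" using eGR A.bR[OF i] by simp
    from D(4)[OF vR[OF i] this] show ?thesis
      by (simp add: f_white[OF i] A.white_prev_def B.white_prev_def marked_Gamma_sel)
  qed
  have gMin: "g (Min (block_of P i)) = Min (block_of P' (g i))" if i: "i \<in> {1..n}" for i
  proof -
    have "Inl (block_of P i) \<in> black ?G" using A.bP[OF i] by (simp add: marked_Gamma_sel)
    from D(7)[OF this] have "Min (edges_at ?H (f (Inl (block_of P i)))) = g (Min (edges_at ?G (Inl (block_of P i))))"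
      by (simp add: marked_Gamma_sel edges_at_marked_Gamma)
    moreover have "g i \<in> {1..n'}" using gE[OF i] nn by simp
    ultimately show ?thesis using eG A.bP[OF i] eH B.bP by (simp add: f_black[OF i])
  qed
  have Min_in': "Min (block_of P i) \<in> {1..n}" if "i \<in> {1..n}" for i
    using Min_in[OF A.fin(1)[OF that]] A.bP[OF that] by blast
  have gS: "i \<in> A.S \<longleftrightarrow> g i \<in> B.S" if i: "i \<in> {1..n}" for i
  proof -
    have "g i \<in> {1..n'}" using gE[OF i] nn by simp
    then have "g i \<in> B.S \<longleftrightarrow> Min (block_of P' (g i)) = g i" by (simp add: B.S_def)
    also have "\<dots> \<longleftrightarrow> g (Min (block_of P i)) = g i" using gMin[OF i] by simp
    also have "\<dots> \<longleftrightarrow> Min (block_of P i) = i" using g_inj[OF Min_in'[OF i] i] .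
    also have "\<dots> \<longleftrightarrow> i \<in> A.S" using i by (simp add: A.S_def)
    finally show ?thesis by simp
  qed
  have 1: "1 \<in> {1..n}" using n by simp
  have "f (Inl (block_of P 1)) = Inl (block_of P' 1)" using D(5) by (simp add: marked_Gamma_sel)
  then have "block_of P' (g 1) = block_of P' 1" using f_black[OF 1] by simp
  moreover have "Min (block_of P 1) = 1" "Min (block_of P' 1) = 1"
    using A.one_S B.one_S by (simp_all add: A.S_def B.S_def)
  \<comment> \<open>Root goes to root and special edge to special edge, and at both roots the
    special edge has label 1.\<close>
  ultimately have g1: "g 1 = 1" using gMin[OF 1] by simp
  have sB: "shallow_pair n P' R'" using B.shallow_pair_axioms nn by simp
  have gid: "g i = i" if "i \<in> {1..n}" for i
    using shallow_pair_rigid[OF A.shallow_pair_axioms sB gE gs ga gS[unfolded nn] g1 that] by blast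
  have f_inj: "f u = f v \<longleftrightarrow> u = v" if "u \<in> verts ?G" "v \<in> verts ?G" for u v
    using inj_on_eq_iff[OF bij_betw_imp_inj_on[OF D(1)]] that by blast
  have "P = P'"
  proof (rule partition_eqI[OF A.pP B.pP[unfolded nn]])
    fix i j assume ij: "i \<in> {1..n}" "j \<in> {1..n}"
    show "block_of P i = block_of P j \<longleftrightarrow> block_of P' i = block_of P' j"
      using f_inj[OF vP[OF ij(1)] vP[OF ij(2)]] f_black[OF ij(1)] f_black[OF ij(2)] gid[OF ij(1)] gid[OF ij(2)]
      by simp
  qed
  moreover have "R = R'"
  proof (rule partition_eqI[OF A.pR B.pR[unfolded nn]])
    fix i j assume ij: "i \<in> {1..n}" "j \<in> {1..n}"
    show "block_of R i = block_of R j \<longleftrightarrow> block_of R' i = block_of R' j"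
      using f_inj[OF vR[OF ij(1)] vR[OF ij(2)]] f_white[OF ij(1)] f_white[OF ij(2)] gid[OF ij(1)] gid[OF ij(2)]
      by simp
  qed
  ultimately show ?thesis by blast
qed

section \<open>Every marked tree comes from its labels\<close>

context marked_tree_edges
begin

lemma block_of_black_partition: "e \<in> E \<Longrightarrow> block_of black_partition (label e) = label ` bblock e"
  by (rule block_of_eq[OF partition_on_black_partition]) (auto simp: black_partition_def)

lemma block_of_white_partition: "e \<in> E \<Longrightarrow> block_of white_partition (label e) = label ` wblock e"
  by (rule block_of_eq[OF partition_on_white_partition]) (auto simp: white_partition_def)

lemma card_fibres: "card ((\<lambda>e. label ` {f\<in>E. h f = h e}) ` E) = card (h ` E)"
proof -
  have eq: "(\<lambda>e. label ` {f\<in>E. h f = h e}) ` E = (\<lambda>b. label ` {f\<in>E. h f = b}) ` h ` E" by (simp add: image_comp)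
  have "inj_on (\<lambda>b. label ` {f\<in>E. h f = b}) (h ` E)"
  proof (rule inj_onI, clarify)
    fix e e' assume e: "e \<in> E" "e' \<in> E" and "label ` {f\<in>E. h f = h e} = label ` {f\<in>E. h f = h e'}"
    then have "{f\<in>E. h f = h e} = {f\<in>E. h f = h e'}"
      using inj_on_image_eq_iff[OF label_inj, of "{f\<in>E. h f = h e}" "{f\<in>E. h f = h e'}"] by blast
    then show "h e = h e'" using e by blast
  qed
  then show ?thesis unfolding eq by (rule card_image)
qed

lemma card_black_partition: "card black_partition = card (bl ` E)" and card_white_partition: "card white_partition = card (wh ` E)"
  unfolding black_partition_def white_partition_def by (rule card_fibres)+

text \<open>The edges whose labels are connected to that of \<open>e\<close> form a set closed under
  \<open>\<sigma>\<close> and \<open>\<alpha>\<close>, which by connectedness is all of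
  \<open>E\<close>.\<close>

lemma joins_colour_partitions: "joins (card E) black_partition white_partition = 1"
proof (rule ncomp_eq_1I)
  show "{1..card E} \<noteq> {}" using bij_betwE[OF label_bij] s0E by blast
  fix x y assume "x \<in> {1..card E}" "y \<in> {1..card E}"
  then obtain e f where e: "e \<in> E" "x = label e" and f: "f \<in> E" "y = label f"
    using bij_betw_imp_surj_on[OF label_bij] by (metis imageE)
  let ?r = "block_rel black_partition \<union> block_rel white_partition"
  define C where "C = {g\<in>E. (label e, label g) \<in> equiv_cl ?r}"
  have s: "\<sigma> g \<in> C" if "g \<in> C" for g
  proof -
    have g: "g \<in> E" "(label e, label g) \<in> equiv_cl ?r" using that by (auto simp: C_def)
    have "(label g, label (\<sigma> g)) \<in> block_rel black_partition"
      by (rule block_relI[of "label ` bblock g"]) (use g sE s_bl in \<open>auto simp: black_partition_def\<close>)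
    then have "(label g, label (\<sigma> g)) \<in> equiv_cl ?r" by (intro equiv_cl_base) simp
    then show ?thesis using equiv_cl_trans[OF g(2)] sE[OF g(1)] by (simp add: C_def)
  qed
  have a: "\<alpha> g \<in> C" if "g \<in> C" for g
  proof -
    have g: "g \<in> E" "(label e, label g) \<in> equiv_cl ?r" using that by (auto simp: C_def)
    have "(label g, label (\<alpha> g)) \<in> block_rel white_partition"
      by (rule block_relI[of "label ` wblock g"]) (use g aE a_wh in \<open>auto simp: white_partition_def\<close>)
    then have "(label g, label (\<alpha> g)) \<in> equiv_cl ?r" by (intro equiv_cl_base) simp
    then show ?thesis using equiv_cl_trans[OF g(2)] aE[OF g(1)] by (simp add: C_def)
  qed
  have "e \<in> C" using e by (simp add: C_def)
  moreover have "C \<subseteq> E" by (auto simp: C_def)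
  ultimately have "C = E" using conn[of C] s a by blast
  then show "(x, y) \<in> equiv_cl ?r" using e f unfolding C_def by blast
qed

end

text \<open>The root carries its special edge, and any other vertex is linked to the root. So every
  vertex of the tree appears as a nonempty block of labels.\<close>

lemma marked_fat_tree_has_edge:
  assumes T: "marked_fat_tree T" and v: "v \<in> verts T"
  shows "edges_at T v \<noteq> {}"
proof (cases "v = root_vertex T")
  case True
  then show ?thesis using marked_fat_treeD(7,10)[OF T] by blast
next
  case False
  have "(v, root_vertex T) \<in> (links T (edges T))\<^sup>*"
    using marked_fat_treeD(3,8)[OF T] v unfolding connected_graph_iff links_rtrancl by blast
  then obtain x where "(v, x) \<in> links T (edges T)" using False by (meson converse_rtranclE)
  then show ?thesis by (auto simp: links_def edges_at_def)
qed

lemma marked_fat_tree_surj: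
  assumes T: "marked_fat_tree T"
  shows "\<exists>n\<ge>1. \<exists>P R. (P, R) \<in> shallow_meanders_of_order n \<and> isomorphic T (marked_Gamma P R)"
proof -
  note D = marked_fat_treeD[OF T]
  have "\<exists>p. fst p \<in> black T \<and> snd p \<in> verts T - black T \<and> ends T e = {fst p, snd p}" if "e \<in> edges T" for e
    using D(9)[OF that] by auto
  then obtain p where p: "\<And>e. e \<in> edges T \<Longrightarrow> fst (p e) \<in> black T \<and> snd (p e) \<in> verts T - black T \<and>
    ends T e = {fst (p e), snd (p e)}" by metis
  define bl where "bl e = fst (p e)" for e
  define wh where "wh e = snd (p e)" for e
  let ?E = "edges T"
  have bl: "bl e \<in> black T" "bl e \<in> verts T" and wh: "wh e \<in> verts T" "wh e \<notin> black T"
    and en: "ends T e = {bl e, wh e}" if "e \<in> ?E" for e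
    using p[OF that] D(6) unfolding bl_def wh_def by blast+
  have at_black: "edges_at T v = {e\<in>?E. bl e = v}" if v: "v \<in> black T" for v
  proof -
    have "v \<in> ends T e \<longleftrightarrow> bl e = v" if "e \<in> ?E" for e using en[OF that] wh(2)[OF that] v by auto
    then show ?thesis unfolding edges_at_def by auto
  qed
  have at_white: "edges_at T v = {e\<in>?E. wh e = v}" if v: "v \<notin> black T" for v
  proof -
    have "v \<in> ends T e \<longleftrightarrow> wh e = v" if "e \<in> ?E" for e using en[OF that] bl(1)[OF that] v by auto
    then show ?thesis unfolding edges_at_def by auto
  qed
  define \<sigma> where "\<sigma> e = ccw T (bl e) e" for e
  define \<alpha> where "\<alpha> e = ccw T (wh e) e" for e
  \<comment> \<open>The component of the white end of \<open>i\<close> after deletion of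
    \<open>i\<close>, given by its edges.\<close>
  define D' where "D' i = {e\<in>?E - {i}. (wh i, wh e) \<in> equiv_cl (links T (?E - {i}))}" for i
  have s: "\<sigma> e \<in> ?E" "bl (\<sigma> e) = bl e" if e: "e \<in> ?E" for e
    using ccw_closed[OF T bl(2)[OF e], of e] at_black[OF bl(1)[OF e]] e by (auto simp: \<sigma>_def)
  have a: "\<alpha> e \<in> ?E" "wh (\<alpha> e) = wh e" if e: "e \<in> ?E" for e
    using ccw_closed[OF T wh(1)[OF e], of e] at_white[OF wh(2)[OF e]] e by (auto simp: \<alpha>_def)
  have iter: "\<exists>k. (c ^^ k) e = f" if "v \<in> verts T" "e \<in> edges_at T v" "f \<in> edges_at T v"
    "\<And>e. e \<in> edges_at T v \<Longrightarrow> c e = ccw T v e" for c v e f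
  proof -
    have cyc: "cyclic_on (ccw T v) (edges_at T v)" using D(5)[OF that(1)] that(2) by blast
    then have "f \<in> orbit (ccw T v) e"
      using that(2,3) orbit_cyclic_eq3 by metis
    then obtain k where k: "((ccw T v) ^^ k) e = f" unfolding orbit_altdef by blast
    have "(c ^^ k) e = ((ccw T v) ^^ k) e \<and> (c ^^ k) e \<in> edges_at T v"
      by (induction k) (use that(2,4) cyclic_on_closed[OF cyc] in auto)
    then show ?thesis using k by metis
  qed
  have link: "(bl e, wh e) \<in> equiv_cl (links T F)" if "e \<in> F" "F \<subseteq> ?E" for e F
    by (rule equiv_cl_base) (use that en in \<open>auto simp: links_def\<close>)
  interpret marked_tree_edges ?E \<sigma> \<alpha> bl wh "special T" "special T (root_vertex T)" D'
  proof
    show "finite ?E" using D(2) by (simp add: finite_graph_def)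
    show "\<sigma> e \<in> ?E" "bl (\<sigma> e) = bl e" "\<alpha> e \<in> ?E" "wh (\<alpha> e) = wh e" if "e \<in> ?E" for e
      using s a that by auto
    show "\<exists>k. (\<sigma> ^^ k) e = f" if ef: "e \<in> ?E" "f \<in> ?E" "bl e = bl f" for e f
      by (rule iter[OF bl(2)[OF ef(1)]]) (use at_black[OF bl(1)[OF ef(1)]] ef in \<open>auto simp: \<sigma>_def\<close>)
    show "\<exists>k. (\<alpha> ^^ k) e = f" if ef: "e \<in> ?E" "f \<in> ?E" "wh e = wh f" for e f
      by (rule iter[OF wh(1)[OF ef(1)]]) (use at_white[OF wh(2)[OF ef(1)]] ef in \<open>auto simp: \<alpha>_def\<close>)
    fix i assume i: "i \<in> ?E"
    have br: "(bl i, wh i) \<notin> equiv_cl (links T (?E - {i}))"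
      using finite_tree_bridge[OF D(1) i] en[OF i] unfolding bridge_def by blast
    show "D' i \<subseteq> ?E" "i \<notin> D' i" by (auto simp: D'_def)
    show "\<sigma> e \<in> D' i" if e: "e \<in> D' i" for e
    proof -
      have e': "e \<in> ?E - {i}" "(wh i, wh e) \<in> equiv_cl (links T (?E - {i}))" using e by (auto simp: D'_def)
      then have "(wh i, bl e) \<in> equiv_cl (links T (?E - {i}))"
        using equiv_cl_trans[OF e'(2) equiv_cl_sym[OF link[OF e'(1)]]] by blast
      then have b: "(wh i, bl (\<sigma> e)) \<in> equiv_cl (links T (?E - {i}))" using s e' by simp
      \<comment> \<open>If the rotation led to \<open>i\<close>, the two ends of the bridge
        \<open>i\<close> would be connected without \<open>i\<close>.\<close>
      then have "\<sigma> e \<noteq> i" using br equiv_cl_sym by metis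
      then have "\<sigma> e \<in> ?E - {i}" using s e' by simp
      then show ?thesis using equiv_cl_trans[OF b link] by (auto simp: D'_def)
    qed
    show "\<alpha> e \<in> insert i (D' i)" if e: "e \<in> insert i (D' i)" for e
    proof -
      have "e \<in> ?E" "(wh i, wh e) \<in> equiv_cl (links T (?E - {i}))" using e i by (auto simp: D'_def)
      then show ?thesis using a[of e] by (auto simp: D'_def)
    qed
  next
    fix e assume e: "e \<in> ?E"
    show "special T (bl e) \<in> ?E" "bl (special T (bl e)) = bl e"
      using D(10)[OF bl(1)[OF e]] at_black[OF bl(1)[OF e]] by auto
  next
    have "special T (root_vertex T) \<in> edges_at T (root_vertex T)" using D(10)[OF D(7)] .
    then show "special T (root_vertex T) \<in> ?E" "special T (bl (special T (root_vertex T))) = special T (root_vertex T)"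
      using at_black[OF D(7)] by auto
  next
    fix C assume C: "C \<subseteq> ?E" "C \<noteq> {}" "\<And>e. e \<in> C \<Longrightarrow> \<sigma> e \<in> C" "\<And>e. e \<in> C \<Longrightarrow> \<alpha> e \<in> C"
    have all: "f \<in> C" if vef: "v \<in> verts T" "e \<in> edges_at T v" "f \<in> edges_at T v" "e \<in> C" for v e f
    proof (cases "v \<in> black T")
      case True
      obtain k where "(\<sigma> ^^ k) e = f"
        using iter[OF vef(1-3), of \<sigma>] at_black[OF True] unfolding \<sigma>_def by auto
      then show ?thesis using funpow_closed[of C \<sigma>, OF C(3) vef(4)] by blast
    next
      case False
      obtain k where "(\<alpha> ^^ k) e = f"
        using iter[OF vef(1-3), of \<alpha>] at_white[OF False] unfolding \<alpha>_def by auto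
      then show ?thesis using funpow_closed[of C \<alpha>, OF C(4) vef(4)] by blast
    qed
    obtain c where c: "c \<in> C" using C(2) by blast
    have "f \<in> C" if f: "f \<in> ?E" for f
    proof -
      \<comment> \<open>By \<open>all\<close>, a vertex with one edge in \<open>C\<close> has all
        its edges in \<open>C\<close>; so this set of vertices is closed along edges and spreads
        over the connected graph.\<close>
      let ?U = "{v\<in>verts T. edges_at T v \<subseteq> C}"
      have "(bl c, bl f) \<in> equiv_cl (links T ?E)"
        using D(3) bl(2) c C(1) f unfolding connected_graph_iff by blast
      moreover have "u \<in> ?U \<longleftrightarrow> v \<in> ?U" if uv: "(u, v) \<in> links T ?E" for u v
      proof -
        obtain e where e: "e \<in> ?E" "ends T e = {u, v}" using uv by (auto simp: links_def)
        then have "u \<in> verts T" "v \<in> verts T" "e \<in> edges_at T u" "e \<in> edges_at T v"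
          using D(4)[OF e(1)] by (auto simp: edges_at_def)
        then show ?thesis using all by blast
      qed
      ultimately have "bl c \<in> ?U \<longleftrightarrow> bl f \<in> ?U" by (rule equiv_cl_closed)
      moreover have "c \<in> ?E" using c C(1) by blast
      then have "bl c \<in> ?U" using all[of "bl c" c] c bl[of c] at_black[of "bl c"] by blast
      ultimately have "edges_at T (bl f) \<subseteq> C" by blast
      then show ?thesis using at_black[OF bl(1)[OF f]] f by blast
    qed
    then show "C = ?E" using C(1) by blast
  qed
  let ?n = "card ?E" and ?H = "marked_Gamma black_partition white_partition"
  have n: "?n \<ge> 1" using s0E fin by (metis One_nat_def Suc_leI card_gt_0_iff empty_iff)
  have blacks: "bl ` ?E = black T"
  proof
    show "black T \<subseteq> bl ` ?E"
    proof
      fix v assume v: "v \<in> black T"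
      then show "v \<in> bl ` ?E" using D(10)[OF v] at_black[OF v] by auto
    qed
  qed (use bl(1) in blast)
  have whites: "wh ` ?E = verts T - black T"
  proof
    show "verts T - black T \<subseteq> wh ` ?E"
    proof
      fix v assume v: "v \<in> verts T - black T"
      then show "v \<in> wh ` ?E" using marked_fat_tree_has_edge[OF T, of v] at_white[of v] by auto
    qed
  qed (use wh in blast)
  have "card (verts T) = card (black T) + card (verts T - black T)"
    using D(2,6) unfolding finite_graph_def by (metis card_Diff_subset card_mono finite_subset le_add_diff_inverse)
  then have "card black_partition + card white_partition = ?n + 1"
    using finite_tree_iff_card[OF D(2,3)] D(1) card_black_partition card_white_partition blacks whites by simp
  then have sm: "(black_partition, white_partition) \<in> shallow_meanders_of_order ?n"
    unfolding shallow_meanders_of_order_iff[OF n] using black_partition_Interval white_partition_NC joins_colour_partitions by blast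
  define f :: "_ \<Rightarrow> nat set + nat set" where
    "f v = (if v \<in> black T then Inl (label ` edges_at T v) else Inr (label ` edges_at T v))" for v
  have f_bl: "f (bl e) = Inl (block_of black_partition (label e))" and f_wh: "f (wh e) = Inr (block_of white_partition (label e))"
    if e: "e \<in> ?E" for e
    using bl(1)[OF e] wh(2)[OF e] at_black[OF bl(1)[OF e]] at_white[OF wh(2)[OF e]]
      block_of_black_partition[OF e] block_of_white_partition[OF e] by (simp_all add: f_def)
  have eH: "edges ?H = label ` ?E"
    using partition_onD1[OF partition_on_black_partition] bij_betw_imp_surj_on[OF label_bij] by (simp add: marked_Gamma_sel)
  have "iso_maps f label T ?H"
    unfolding iso_maps_def
  proof (intro conjI ballI)
    show "bij_betw label ?E (edges ?H)" using label_inj eH by (simp add: bij_betw_def)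
    have "f ` verts T = f ` black T \<union> f ` (verts T - black T)" using D(6) by blast
    also have "f ` black T = Inl ` black_partition"
      unfolding blacks[symmetric] black_partition_def image_image using f_bl block_of_black_partition by (intro image_cong) auto
    also have "f ` (verts T - black T) = Inr ` white_partition"
      unfolding whites[symmetric] white_partition_def image_image using f_wh block_of_white_partition by (intro image_cong) auto
    finally have "f ` verts T = verts ?H" by (simp add: marked_Gamma_sel)
    moreover have "inj_on f (verts T)"
    proof (rule inj_onI)
      fix u v assume uv: "u \<in> verts T" "v \<in> verts T" "f u = f v"
      then have col: "u \<in> black T \<longleftrightarrow> v \<in> black T" and im: "label ` edges_at T u = label ` edges_at T v"
        by (auto simp: f_def split: if_splits)
      have "edges_at T u = edges_at T v"
        using inj_on_image_eq_iff[OF label_inj, of "edges_at T u" "edges_at T v"] im by (auto simp: edges_at_def)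
      then obtain e where "e \<in> edges_at T u" "e \<in> edges_at T v"
        using marked_fat_tree_has_edge[OF T uv(1)] by blast
      then show "u = v" using col at_black at_white by (cases "u \<in> black T") auto
    qed
    ultimately show "bij_betw f (verts T) (verts ?H)" by (simp add: bij_betw_def)
  next
    fix e assume "e \<in> ?E"
    then show "ends ?H (label e) = f ` ends T e" by (simp add: en f_bl f_wh marked_Gamma_sel)
  next
    fix v e assume v: "v \<in> verts T" and ev: "e \<in> edges_at T v"
    then have e: "e \<in> ?E" by (simp add: edges_at_def)
    show "ccw ?H (f v) (label e) = label (ccw T v e)"
    proof (cases "v \<in> black T")
      case True
      then have "v = bl e" using ev at_black[OF True] by simp
      then show ?thesis
        using next_in_bblock[OF e] block_of_black_partition[OF e] f_bl[OF e] by (simp add: marked_Gamma_sel \<sigma>_def)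
    next
      case False
      then have "v = wh e" using ev at_white[OF False] by simp
      then show ?thesis
        using prev_in_wblock[OF e] block_of_white_partition[OF e] f_wh[OF e] by (simp add: marked_Gamma_sel \<alpha>_def)
    qed
  next
    have "bl (special T (root_vertex T)) = root_vertex T" using D(10)[OF D(7)] at_black[OF D(7)] by simp
    then show "f (root_vertex T) = root_vertex ?H"
      using f_bl[OF s0E] label_s0 by (simp add: marked_Gamma_sel)
  next
    fix v assume v: "v \<in> verts T"
    show "v \<in> black T \<longleftrightarrow> f v \<in> black ?H"
    proof (cases "v \<in> black T")
      case True
      then have "f v \<in> Inl ` black_partition" unfolding blacks[symmetric] using f_bl block_of_black_partition black_partition_def by auto
      then show ?thesis using True by (simp add: marked_Gamma_sel)
    next
      case False
      then show ?thesis by (auto simp: f_def marked_Gamma_sel)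
    qed
  next
    fix v assume v: "v \<in> black T"
    then obtain e where e: "e \<in> ?E" "v = bl e" using blacks by blast
    have "label ` bblock e \<in> black_partition" using e(1) by (auto simp: black_partition_def)
    then have "special ?H (f v) = Min (label ` bblock e)"
      using f_bl[OF e(1)] block_of_black_partition[OF e(1)] e(2)
      by (simp add: marked_Gamma_sel edges_at_Gamma[OF partition_on_black_partition partition_on_white_partition])
    then show "special ?H (f v) = label (special T v)" using Min_bblock[OF e(1)] e(2) by simp
  qed
  then show ?thesis using n sm unfolding isomorphic_iff by blast
qed

theorem theorem6p2:
  shows "bij_betw forget shallow_meanders marked_fat_tree_classes"
proof -
  let ?r = "{(G, H). G \<in> nat_trees \<and> H \<in> nat_trees \<and> isomorphic G H}"
  have tree: "marked_fat_tree (marked_Gamma P R)" if "(P, R) \<in> shallow_meanders" for P R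
    using that marked_fat_tree_Gamma unfolding shallow_meanders_iff by blast
  \<comment> \<open>\<open>forget\<close> collects all copies on natural numbers, which is the full
    isomorphism class of any one of them.\<close>
  have class_eq: "forget (P, R) = ?r `` {T}"
    if m: "(P, R) \<in> shallow_meanders" and T: "T \<in> nat_trees" and iso: "isomorphic (marked_Gamma P R) T" for P R T
  proof -
    have tT: "marked_fat_tree T" using T by (simp add: nat_trees_def)
    have "isomorphic T (marked_Gamma P R)"
      using isomorphic_sym[OF tree[OF m] iso] marked_fat_treeD(6)[OF tT] by blast
    then have "isomorphic (marked_Gamma P R) T' \<longleftrightarrow> isomorphic T T'" for T'
      using isomorphic_trans[OF tree[OF m] iso] isomorphic_trans[OF tT] by blast
    then show ?thesis using T by (auto simp: forget_def)
  qed
  have "inj_on forget shallow_meanders"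
  proof (rule inj_onI, clarify)
    fix P R P' R'
    assume m: "(P, R) \<in> shallow_meanders" and m': "(P', R') \<in> shallow_meanders"
      and eq: "forget (P, R) = forget (P', R')"
    obtain T where T: "T \<in> nat_trees" "isomorphic (marked_Gamma P R) T" using exists_nat_copy[OF tree[OF m]] by blast
    then have "T \<in> forget (P', R')" unfolding eq[symmetric] by (simp add: forget_def)
    then have "isomorphic (marked_Gamma P' R') T" by (simp add: forget_def)
    moreover have "black T \<subseteq> verts T" using T(1) marked_fat_treeD(6) by (auto simp: nat_trees_def)
    ultimately have "isomorphic T (marked_Gamma P' R')" using isomorphic_sym[OF tree[OF m']] by blast
    then have "isomorphic (marked_Gamma P R) (marked_Gamma P' R')"
      using isomorphic_trans[OF tree[OF m] T(2)] by blast
    then show "P = P' \<and> R = R'" using marked_Gamma_inj m m' unfolding shallow_meanders_iff by blast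
  qed
  moreover have "forget ` shallow_meanders = marked_fat_tree_classes"
  proof
    show "forget ` shallow_meanders \<subseteq> marked_fat_tree_classes"
    proof clarify
      fix P R assume m: "(P, R) \<in> shallow_meanders"
      obtain T where T: "T \<in> nat_trees" "isomorphic (marked_Gamma P R) T" using exists_nat_copy[OF tree[OF m]] by blast
      show "forget (P, R) \<in> marked_fat_tree_classes"
        unfolding class_eq[OF m T] marked_fat_tree_classes_def using T(1) by (rule quotientI)
    qed
    show "marked_fat_tree_classes \<subseteq> forget ` shallow_meanders"
    proof
      fix c assume "c \<in> marked_fat_tree_classes"
      then obtain T where T: "T \<in> nat_trees" "c = ?r `` {T}"
        unfolding marked_fat_tree_classes_def by (rule quotientE)
      have tT: "marked_fat_tree T" using T(1) by (simp add: nat_trees_def)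
      obtain n P R where PR: "n \<ge> 1" "(P, R) \<in> shallow_meanders_of_order n" "isomorphic T (marked_Gamma P R)"
        using marked_fat_tree_surj[OF tT] by blast
      then have m: "(P, R) \<in> shallow_meanders" unfolding shallow_meanders_iff by blast
      have "isomorphic (marked_Gamma P R) T"
        using isomorphic_sym[OF tT PR(3)] marked_fat_treeD(6)[OF tree[OF m]] by blast
      then have "c = forget (P, R)" using class_eq[OF m T(1)] T(2) by simp
      then show "c \<in> forget ` shallow_meanders" using m by blast
    qed
  qed
  ultimately show ?thesis by (simp add: bij_betw_def)
qed

end
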